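(* Let $G_w$ be a weighted bicyclic graph with no pendant vertices. Then $i_-(G_w)=2$ if and only if $G_w$ is (isomorphic as a weighted graph to) one of the following: (1) $\infty(4,1,4)_w$ with $a_1a_3=a_2a_4$ and $b_1b_3=b_2b_4$; (2) $\theta(1,1,1)_w$ with $a_2b_1\ne a_1b_2$ or $a_2c_1\ne a_1c_2$; (3) $\theta(1,0,1)_w$, with arbitrary positive weights; (4) $\theta(1,0,2)_w$ with $b_1c_2\le c_1c_3$; (5) $\theta(2,0,2)_w$ with $a_2b_1c_2-a_1a_3c_2-a_2c_1c_3=0$; (6) $\theta(1,1,2)_w$ with $a_1b_2=a_2b_1$.
   Context: A weighted graph is a simple graph with a positive weight on each edge; its adjacency matrix has entry $w(xy)$ if $xy$ is an edge and $0$ otherwise, and $i_-(G_w)$ is the number of negative eigenvalues of this matrix, with multiplicity. A bicyclic graph is a connected simple graph with $|E|=|V|+1$. $\infty(4,1,4)_w$ consists of two $4$-cycles $v x_1x_2x_3v$ and $v y_1y_2y_3v$ sharing only the vertex $v$, with weights $w(vx_1)=a_1,w(x_1x_2)=a_2,w(x_2x_3)=a_3,w(x_3v)=a_4$ and $w(vy_1)=b_1,w(y_1y_2)=b_2,w(y_2y_3)=b_3,w(y_3v)=b_4$. For integers $p,l,q\ge0$ with at most one equal to $0$, $\theta(p,l,q)_w$ consists of two vertices $u,v$ joined by three internally disjoint paths $ux_1\cdots x_pv$, $uy_1\cdots y_lv$, $uz_1\cdots z_qv$ (a path with no internal vertex being the edge $uv$), with edge weights read from $u$ to $v$ equal to $a_1,\dots,a_{p+1}$,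 $b_1,\dots,b_{l+1}$ and $c_1,\dots,c_{q+1}$ respectively. *)

theory Defs
  imports "Jordan_Normal_Form.Char_Poly"
begin

record 'a wgraph =
  verts :: "'a set"
  edges :: "'a set set"
  weight :: "'a set \<Rightarrow> real"

text \<open>Only the values of \<open>weight\<close> on \<open>edges\<close> are meaningful.\<close>

definition weighted_graph :: "'a wgraph \<Rightarrow> bool" where
  "weighted_graph G \<longleftrightarrow>
     finite (verts G) \<and>
     (\<forall>e\<in>edges G. e \<subseteq> verts G \<and> card e = 2) \<and>
     (\<forall>e\<in>edges G. weight G e > 0)"

definition connected_graph :: "'a wgraph \<Rightarrow> bool" where
  "connected_graph G \<longleftrightarrow> verts G \<noteq> {} \<and>
     (\<forall>x\<in>verts G. \<forall>y\<in>verts G. (x, y) \<in> {(s, t). {s, t} \<in> edges G}\<^sup>*)"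

definition bicyclic :: "'a wgraph \<Rightarrow> bool" where
  "bicyclic G \<longleftrightarrow> connected_graph G \<and> card (edges G) = card (verts G) + 1"

definition degree_of :: "'a wgraph \<Rightarrow> 'a \<Rightarrow> nat" where
  "degree_of G x = card {e \<in> edges G. x \<in> e}"

definition pendant :: "'a wgraph \<Rightarrow> 'a \<Rightarrow> bool" where
  "pendant G x \<longleftrightarrow> x \<in> verts G \<and> degree_of G x = 1"

definition wgraph_iso :: "'a wgraph \<Rightarrow> 'b wgraph \<Rightarrow> bool" where
  "wgraph_iso G H \<longleftrightarrow> (\<exists>f. bij_betw f (verts G) (verts H) \<and>
     (\<forall>x\<in>verts G. \<forall>y\<in>verts G. {x, y} \<in> edges G \<longleftrightarrow> {f x, f y} \<in> edges H) \<and>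
     (\<forall>x\<in>verts G. \<forall>y\<in>verts G. {x, y} \<in> edges G \<longrightarrow> weight G {x, y} = weight H {f x, f y}))"

text \<open>The rows and columns of the adjacency matrix are indexed along an enumeration of the
  vertices. Another enumeration conjugates the matrix by a permutation matrix, so the
  arbitrary choice made here does not affect the spectrum.\<close>

definition vertex_list :: "'a wgraph \<Rightarrow> 'a list" where
  "vertex_list G = (SOME xs. distinct xs \<and> set xs = verts G)"

definition adj_matrix :: "'a wgraph \<Rightarrow> real mat" where
  "adj_matrix G = (let xs = vertex_list G; n = length xs in
     mat n n (\<lambda>(i, j). if {xs ! i, xs ! j} \<in> edges G then weight G {xs ! i, xs ! j} else 0))"

definition neg_inertia :: "'a wgraph \<Rightarrow> nat" where
  "neg_inertia G =
     (\<Sum>t\<in>{t. t < 0 \<and> eigenvalue (adj_matrix G) t}. order t (char_poly (adj_matrix G)))"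

text \<open>For a walk \<open>xs\<close> visiting \<open>x\<^sub>0, \<dots>, x\<^sub>n\<close>, the edge \<open>x\<^sub>i\<^sub>-\<^sub>1x\<^sub>i\<close> receives the weight
  \<open>a i\<close>; weight sequences are thus indexed from 1 and \<open>a 0\<close> is unused.\<close>

definition walk_edges :: "'v list \<Rightarrow> (nat \<Rightarrow> real) \<Rightarrow> ('v set \<times> real) list" where
  "walk_edges xs a = map (\<lambda>i. ({xs ! (i - 1), xs ! i}, a i)) [1..<length xs]"

definition wgraph_of :: "('v set \<times> real) list \<Rightarrow> 'v wgraph" where
  "wgraph_of es = \<lparr>verts = \<Union>(fst ` set es), edges = fst ` set es,
                   weight = (\<lambda>e. the (map_of es e))\<rparr>"

datatype vertex = U | V | X nat | Y nat | Z nat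

definition infinity414 :: "(nat \<Rightarrow> real) \<Rightarrow> (nat \<Rightarrow> real) \<Rightarrow> vertex wgraph" where
  "infinity414 a b = wgraph_of
     (walk_edges [V, X 1, X 2, X 3, V] a @
      walk_edges [V, Y 1, Y 2, Y 3, V] b)"

text \<open>Meant for \<open>p, l, q\<close> of which at most one is \<open>0\<close>; otherwise the edge \<open>UV\<close> would be
  listed more than once.\<close>

definition theta :: "nat \<Rightarrow> nat \<Rightarrow> nat \<Rightarrow> (nat \<Rightarrow> real) \<Rightarrow> (nat \<Rightarrow> real) \<Rightarrow> (nat \<Rightarrow> real)
    \<Rightarrow> vertex wgraph" where
  "theta p l q a b c = wgraph_of
     (walk_edges (U # map X [1..<p + 1] @ [V]) a @
      walk_edges (U # map Y [1..<l + 1] @ [V]) b @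
      walk_edges (U # map Z [1..<q + 1] @ [V]) c)"

definition pos_weights :: "nat \<Rightarrow> (nat \<Rightarrow> real) \<Rightarrow> bool" where
  "pos_weights n a \<longleftrightarrow> (\<forall>i\<in>{1..n}. a i > 0)"

end

theory Submission
  imports Defs
begin

text \<open>The quadratic form of a real symmetric matrix has, after diagonalization, as many negative
  squares as the matrix has negative eigenvalues. So a \<open>k\<close>-dimensional negative definite subspace
  forces \<open>i\<^sub>- \<ge> k\<close>, and \<open>k\<close> linear forms on whose common kernel the form is nonnegative
  force \<open>i\<^sub>- \<le> k\<close>.

  Two configurations force \<open>i\<^sub>- \<ge> 3\<close>: three pairwise nonadjacent vertices with a nonsingular
  weight matrix towards three further vertices, and a triangle with an edge that is not joined to
  two of its vertices. In a bicyclic graph without pendant vertices the numbers \<open>deg x - 2\<close> are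
  nonnegative and sum to \<open>2\<close>, so there is one vertex of degree four or there are two of degree
  three, and all others have degree two. Exploring the graph from these branch vertices for a few
  steps, one either meets one of the two configurations or closes up to one of the six graphs of
  the theorem. For these the conditions on the weights are read off from explicit linear
  forms or from the determinant of such a weight matrix; for \<open>\<theta>(1,0,2)\<close> they come from the triangle
  that remains after eliminating the edge \<open>z\<^sub>1z\<^sub>2\<close>.\<close>

section \<open>The real spectral theorem\<close>

text \<open>\<open>neg_inertia\<close> is defined through multiplicities of roots and an arbitrary
  enumeration of the vertices. Passing to \<open>qform\<close> removes both, and every bound becomes
  a dimension count on functions on the vertices. The first of the two configurations asks nothing
  about edges among the three further vertices, since one zero block is enough. This makes it
  checkable while only part of the graph is known. It takes six vertices, however, so it cannot
  decide \<theta>(1,0,2), which has five; there the signs of the weights matter, and the triangle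
  takes over. This is also why most conditions on the weights concern the vanishing of a
  determinant, while \<theta>(1,0,2) gets an inequality: eliminating \<open>z1 z2\<close> turns the
  weight \<open>b 1\<close> of the edge \<open>uv\<close> into \<open>b 1 - c 1 * c 3 / c 2\<close>,
  which can have either sign. The remaining triangle has two negative eigenvalues if this is
  positive and one otherwise. In \<theta>(1,1,2) there is no edge \<open>uv\<close>, the new weight
  is always negative, and only a determinant condition on \<open>x\<close> and \<open>y\<close> is
  left.\<close>

lemma nonzero_vec_component:
  assumes "v \<in> carrier_vec n" "v \<noteq> 0\<^sub>v n"
  obtains i where "i < n" "v $ i \<noteq> 0"
  using assms by (metis carrier_vecD eq_vecI index_zero_vec(1,2))

text \<open>The fundamental theorem of algebra gives a complex eigenvalue \<open>\<mu>\<close> with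
  eigenvector \<open>z\<close>. The number \<open>S\<close>, which is \<open>z* A z\<close>, equals
  \<open>\<mu>\<close> times the squared norm \<open>N\<close> and, as the matrix is real and
  symmetric, is its own conjugate. So \<open>\<mu>\<close> is real and a root of the real
  characteristic polynomial.\<close>

lemma real_symmetric_eigenvector:
  fixes A :: "real mat"
  assumes A: "A \<in> carrier_mat n n" and sym: "transpose_mat A = A" and n: "n > 0"
  obtains v e where "v \<in> carrier_vec n" "v \<noteq> 0\<^sub>v n" "A *\<^sub>v v = e \<cdot>\<^sub>v v"
proof -
  let ?C = "map_mat complex_of_real A"
  have C: "?C \<in> carrier_mat n n" using A by auto
  have "\<exists>\<mu>. poly (char_poly ?C) \<mu> = 0"
    using degree_monic_char_poly[OF C] n
    by (metis fundamental_theorem_of_algebra constant_degree less_irrefl)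
  then obtain \<mu> where \<mu>: "eigenvalue ?C \<mu>" using eigenvalue_root_char_poly[OF C] by blast
  then obtain z where z: "z \<in> carrier_vec n" "z \<noteq> 0\<^sub>v n" "?C *\<^sub>v z = \<mu> \<cdot>\<^sub>v z"
    unfolding eigenvalue_def eigenvector_def using C by auto
  have Asym: "A $$ (i, j) = A $$ (j, i)" if "i < n" "j < n" for i j
    using arg_cong[OF sym, of "\<lambda>M. M $$ (i, j)"] that A by simp
  have row: "(\<Sum>j<n. complex_of_real (A $$ (i, j)) * z $ j) = \<mu> * z $ i" if "i < n" for i
    using arg_cong[OF z(3), of "\<lambda>w. w $ i"] that A z(1)
    by (simp add: scalar_prod_def atLeast0LessThan)
  define S where "S = (\<Sum>i<n. \<Sum>j<n. complex_of_real (A $$ (i, j)) * z $ j * cnj (z $ i))"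
  define N where "N = (\<Sum>i<n. (cmod (z $ i))\<^sup>2)"
  have S: "S = \<mu> * of_real N"
  proof -
    have "S = (\<Sum>i<n. (\<Sum>j<n. complex_of_real (A $$ (i, j)) * z $ j) * cnj (z $ i))"
      by (simp add: S_def sum_distrib_right)
    also have "\<dots> = (\<Sum>i<n. \<mu> * (z $ i * cnj (z $ i)))" by (simp add: row mult.assoc)
    also have "\<dots> = \<mu> * of_real N"
      by (simp add: N_def sum_distrib_left complex_norm_square del: of_real_power)
    finally show ?thesis .
  qed
  have "cnj S = (\<Sum>i<n. \<Sum>j<n. complex_of_real (A $$ (i, j)) * cnj (z $ j) * z $ i)"
    by (simp add: S_def)
  also have "\<dots> = (\<Sum>j<n. \<Sum>i<n. complex_of_real (A $$ (i, j)) * cnj (z $ j) * z $ i)"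
    by (rule sum.swap)
  also have "\<dots> = S"
    unfolding S_def by (intro sum.cong refl) (auto simp: Asym)
  finally have cS: "cnj S = S" .
  obtain i where "i < n" "z $ i \<noteq> 0" using nonzero_vec_component[OF z(1,2)] .
  then have "N > 0"
    unfolding N_def by (intro sum_pos2[of _ i]) auto
  with S cS have "cnj \<mu> = \<mu>" by simp
  then have "\<mu> = of_real (Re \<mu>)" by (simp add: complex_eq_iff)
  moreover have "poly (char_poly ?C) \<mu> = 0" using eigenvalue_root_char_poly[OF C] \<mu> by blast
  ultimately have "poly (map_poly complex_of_real (char_poly A)) (of_real (Re \<mu>)) = 0"
    by (metis of_real_hom.char_poly_hom[OF A])
  then have "poly (char_poly A) (Re \<mu>) = 0" by simp
  then have "eigenvalue A (Re \<mu>)" using eigenvalue_root_char_poly[OF A] by blast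
  then show ?thesis using that A unfolding eigenvalue_def eigenvector_def by auto
qed

lemma symmetric_orthogonal_to_unit_vec:
  fixes w :: "real vec"
  assumes w: "w \<in> carrier_vec n" "w \<bullet> w = 1" and n: "n > 0"
  obtains W where "W \<in> carrier_mat n n" "transpose_mat W = W" "W * W = 1\<^sub>m n"
    "W *\<^sub>v unit_vec n 0 = w"
proof (cases "w = unit_vec n 0")
  case True
  then show ?thesis using that[of "1\<^sub>m n"] by auto
next
  case False
  \<comment> \<open>Householder reflection in the hyperplane orthogonal to \<open>u\<close>\<close>
  define u where "u = w - unit_vec n 0"
  have u: "u \<in> carrier_vec n" using w by (simp add: u_def)
  have uu0: "u \<bullet> u \<noteq> 0"
  proof
    assume "u \<bullet> u = 0"
    then have "(\<Sum>i<n. u $ i * u $ i) = 0" using u by (simp add: scalar_prod_def atLeast0LessThan)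
    then have u0: "u $ i = 0" if "i < n" for i
      using that by (subst (asm) sum_nonneg_eq_0_iff) auto
    have "w $ i = unit_vec n 0 $ i" if "i < n" for i
      using u0[OF that] that w by (simp add: u_def del: index_unit_vec(1))
    then have "w = unit_vec n 0"
      using w by (intro eq_vecI) auto
    with False show False by simp
  qed
  have uu: "u \<bullet> u = 2 - 2 * w $ 0"
    using w n unfolding u_def
    by (subst minus_scalar_prod_distrib[of _ n]) (auto simp: scalar_prod_minus_distrib[of _ n])
  define c where "c = 2 / (u \<bullet> u)"
  have c: "c * (u \<bullet> u) = 2" using uu0 by (simp add: c_def)
  define W where "W = mat n n (\<lambda>(i, j). (if i = j then 1 else 0) - c * u $ i * u $ j)"
  have "W * W = 1\<^sub>m n"
  proof (rule eq_matI)
    fix i j assume "i < dim_row (1\<^sub>m n :: real mat)" "j < dim_col (1\<^sub>m n :: real mat)"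
    then have ij: "i < n" "j < n" by auto
    have "(W * W) $$ (i, j) =
      (\<Sum>k<n. ((if i = k then 1 else 0) - c * u $ i * u $ k) * ((if k = j then 1 else 0) - c * u $ k * u $ j))"
      using ij by (simp add: W_def scalar_prod_def atLeast0LessThan)
    also have "\<dots> = (\<Sum>k<n. (if i = k then (if k = j then 1 else 0) - c * u $ k * u $ j else 0)
        - (if k = j then c * u $ i * u $ k else 0) + c * u $ i * u $ j * c * (u $ k * u $ k))"
      by (intro sum.cong refl) (auto simp: algebra_simps)
    also have "\<dots> = (if i = j then 1 else 0) - c * u $ i * u $ j - c * u $ i * u $ j
        + c * u $ i * u $ j * c * (\<Sum>k<n. u $ k * u $ k)"
      using ij by (simp add: sum.distrib sum_subtractf sum_distrib_left)
    also have "(\<Sum>k<n. u $ k * u $ k) = u \<bullet> u"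
      using u by (simp add: scalar_prod_def atLeast0LessThan)
    also have "c * u $ i * u $ j * c * (u \<bullet> u) = c * u $ i * u $ j * 2"
      using c by (simp add: mult.assoc)
    finally show "(W * W) $$ (i, j) = 1\<^sub>m n $$ (i, j)" using ij by simp
  qed (auto simp: W_def)
  moreover have "W *\<^sub>v unit_vec n 0 = w"
  proof (rule eq_vecI)
    fix i assume i: "i < dim_vec w"
    then have i: "i < n" using w by auto
    \<comment> \<open>Since \<open>u $ 0 = w $ 0 - 1\<close>, the squared norm of \<open>u\<close>
      is \<open>-2 * u $ 0\<close>; so the reflection adds exactly \<open>u\<close> to the first
      unit vector.\<close>
    have "c * u $ 0 = -1"
      using c uu uu0 w n by (simp add: u_def c_def field_simps)
    then have "c * u $ i * u $ 0 = - u $ i" by (metis mult.commute mult.left_commute mult_minus1_right)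
    moreover have "(W *\<^sub>v unit_vec n 0) $ i = (if i = 0 then 1 else 0) - c * u $ i * u $ 0"
      using i n by (simp add: W_def)
    ultimately show "(W *\<^sub>v unit_vec n 0) $ i = w $ i"
      using i n w by (simp add: u_def)
  qed (use w in \<open>auto simp: W_def\<close>)
  moreover have "W \<in> carrier_mat n n" "transpose_mat W = W"
    by (auto simp: W_def intro!: eq_matI)
  ultimately show ?thesis using that by blast
qed

text \<open>Deflation: in an orthonormal basis that starts with an eigenvector, symmetry clears the
  first row as well as the first column, and the induction hypothesis applies to the remaining
  block. The reflection \<open>W\<close> is its own inverse and its own transpose, so
  \<open>W * A * W\<close> is at once a similarity and a congruence.\<close>

theorem real_symmetric_diagonalization:
  fixes A :: "real mat"
  assumes "A \<in> carrier_mat n n" "transpose_mat A = A"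
  shows "\<exists>P D. P \<in> carrier_mat n n \<and> D \<in> carrier_mat n n \<and> diagonal_mat D \<and>
    transpose_mat P * P = 1\<^sub>m n \<and> A = P * D * transpose_mat P"
  using assms
proof (induction n arbitrary: A)
  case 0
  then show ?case
    by (intro exI[of _ "1\<^sub>m 0"] exI[of _ A]) (auto simp: diagonal_mat_def)
next
  case (Suc n)
  let ?n = "Suc n"
  note A = Suc.prems(1)
  obtain v e where v: "v \<in> carrier_vec ?n" "v \<noteq> 0\<^sub>v ?n" "A *\<^sub>v v = e \<cdot>\<^sub>v v"
    using real_symmetric_eigenvector[OF Suc.prems] by blast
  have vv: "v \<bullet> v > 0"
  proof -
    obtain i where "i < ?n" "v $ i \<noteq> 0" using nonzero_vec_component[OF v(1,2)] .
    then have "(\<Sum>i<?n. v $ i * v $ i) > 0"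
      by (intro sum_pos2[of _ i]) (auto simp: zero_less_mult_iff)
    then show ?thesis using v(1) by (simp add: scalar_prod_def atLeast0LessThan)
  qed
  define w where "w = (1 / sqrt (v \<bullet> v)) \<cdot>\<^sub>v v"
  have w: "w \<in> carrier_vec ?n" using v by (simp add: w_def)
  have ww: "w \<bullet> w = 1"
    using v vv by (simp add: w_def field_simps)
  have Aw: "A *\<^sub>v w = e \<cdot>\<^sub>v w"
    using v A by (simp add: w_def mult_mat_vec[of _ ?n ?n] smult_smult_assoc mult.commute)
  obtain W where W: "W \<in> carrier_mat ?n ?n" "transpose_mat W = W" "W * W = 1\<^sub>m ?n"
    and We: "W *\<^sub>v unit_vec ?n 0 = w"
    using symmetric_orthogonal_to_unit_vec[OF w ww] by auto
  define B where "B = W * A * W"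
  have B: "B \<in> carrier_mat ?n ?n" using W A by (simp add: B_def)
  have Bs: "transpose_mat B = B"
    using W A Suc.prems(2) 
    by (simp add: B_def transpose_mult[of _ ?n ?n _ ?n] assoc_mult_mat[of _ ?n ?n _ ?n _ ?n])
  have "W *\<^sub>v w = unit_vec ?n 0"
    unfolding We[symmetric] using W by (simp add: assoc_mult_mat_vec[symmetric, of _ ?n ?n _ ?n])
  then have Be: "B *\<^sub>v unit_vec ?n 0 = e \<cdot>\<^sub>v unit_vec ?n 0"
    using W A w unfolding B_def
    by (simp add: assoc_mult_mat_vec[of _ ?n ?n _ ?n] We Aw mult_mat_vec[of _ ?n ?n])
  have B0: "B $$ (i, 0) = (if i = 0 then e else 0)" if "i < ?n" for i
    using arg_cong[OF Be, of "\<lambda>x. x $ i"] B that by simp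
  have Bsym: "B $$ (i, j) = B $$ (j, i)" if "i < ?n" "j < ?n" for i j
    using arg_cong[OF Bs, of "\<lambda>M. M $$ (i, j)"] that B by simp
  define B' where "B' = mat n n (\<lambda>(i, j). B $$ (Suc i, Suc j))"
  have "B' \<in> carrier_mat n n" "transpose_mat B' = B'"
    using Bsym by (auto simp: B'_def)
  then obtain P' D' where P': "P' \<in> carrier_mat n n" and D': "D' \<in> carrier_mat n n" "diagonal_mat D'"
    and PP': "transpose_mat P' * P' = 1\<^sub>m n" and B': "B' = P' * D' * transpose_mat P'"
    using Suc.IH by blast
  let ?fb = "\<lambda>a M. four_block_mat (mat 1 1 (\<lambda>_. a)) (0\<^sub>m 1 n) (0\<^sub>m n 1) M"
  have fb_mult: "?fb a M * ?fb b N = ?fb (a * b) (M * N)"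
    if "M \<in> carrier_mat n n" "N \<in> carrier_mat n n" for a b :: real and M N
    using that by (subst mult_four_block_mat[of _ 1 1 _ n _ n _ _ 1 _ n])
      (auto intro!: cong_four_block_mat eq_matI simp: scalar_prod_def)
  have fb_T: "transpose_mat (?fb a M) = ?fb a (transpose_mat M)"
    if "M \<in> carrier_mat n n" for a :: real and M
    using that by (subst transpose_four_block_mat[of _ 1 1 _ n _ n])
      (auto intro!: cong_four_block_mat eq_matI)
  have fb_1: "?fb 1 (1\<^sub>m n) = 1\<^sub>m ?n"
    by (auto intro!: eq_matI simp: four_block_mat_def)
  have fb_B: "B = ?fb e B'"
  proof (rule eq_matI)
    fix i j assume "i < dim_row (?fb e B')" "j < dim_col (?fb e B')"
    then have "i < ?n" "j < ?n" by (auto simp: B'_def)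
    then show "B $$ (i, j) = ?fb e B' $$ (i, j)"
      using B0[of i] B0[of j] Bsym[of i j] by (auto simp: B'_def four_block_mat_def Let_def)
  qed (use B in \<open>auto simp: B'_def\<close>)
  define Q where "Q = ?fb 1 P'"
  define D where "D = ?fb e D'"
  have Q: "Q \<in> carrier_mat ?n ?n" and D: "D \<in> carrier_mat ?n ?n"
    using P' D' by (auto simp: Q_def D_def)
  have "diagonal_mat D"
    using D' by (auto simp: D_def diagonal_mat_def four_block_mat_def Let_def)
  have QQ: "transpose_mat Q * Q = 1\<^sub>m ?n"
    using P' by (simp add: Q_def fb_T fb_mult PP' fb_1 del: One_nat_def)
  have BQ: "B = Q * D * transpose_mat Q"
    using P' D' unfolding Q_def D_def fb_B
    by (simp add: fb_T fb_mult B' del: One_nat_def)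
  have "A = W * B * W"
  proof -
    have "W * B * W = (W * W) * A * (W * W)"
      unfolding B_def using W(1) A by (simp add: assoc_mult_mat[of _ ?n ?n _ ?n _ ?n])
    then show ?thesis using W A by simp
  qed
  then have "A = (W * Q) * D * transpose_mat (W * Q)"
    unfolding BQ using W(1,2) Q D
    by (simp add: transpose_mult[of _ ?n ?n _ ?n] assoc_mult_mat[of _ ?n ?n _ ?n _ ?n])
  moreover have "transpose_mat (W * Q) * (W * Q) = 1\<^sub>m ?n"
  proof -
    have "transpose_mat (W * Q) * (W * Q) = transpose_mat Q * (W * W) * Q"
      using W(1,2) Q
      by (simp add: transpose_mult[of _ ?n ?n _ ?n] assoc_mult_mat[of _ ?n ?n _ ?n _ ?n])
    then show ?thesis using W(3) Q QQ by simp
  qed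
  ultimately show ?case using W(1) Q D \<open>diagonal_mat D\<close>
    by (intro exI[of _ "W * Q"] exI[of _ D]) auto
qed

section \<open>Negative inertia and the quadratic form\<close>

lemma order_linear_factors:
  "order t (\<Prod>a\<leftarrow>as. [:- a, 1:]) = count_list as (t :: 'a :: field)"
proof (induction as)
  case (Cons a as)
  have "[:- a, 1:] * (\<Prod>a\<leftarrow>as. [:- a, 1:]) \<noteq> 0"
    by (simp only: mult_eq_0_iff prod_list_zero_iff) auto
  then show ?case
    using Cons by (simp add: order_mult order_linear' del: mult_pCons_left)
qed (simp add: order_0I)

lemma count_list_map_upt: "count_list (map d [0..<n]) t = card {i. i < n \<and> d i = t}"
proof (induction n)
  case (Suc n)
  have "{i. i < Suc n \<and> d i = t} = (if d n = t then insert n else id) {i. i < n \<and> d i = t}"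
    by (auto simp: less_Suc_eq)
  then show ?case using Suc by simp
qed simp

text \<open>This trades the algebraic definition of the inertia for a count. The characteristic
  polynomial is that of \<open>D\<close>, so the order of a root \<open>t\<close> is the number of
  diagonal entries equal to \<open>t\<close>; the sum over negative \<open>t\<close> groups the
  negative entries by value.\<close>

lemma sum_order_negative_eigenvalues:
  fixes A :: "real mat"
  assumes P: "P \<in> carrier_mat n n" "transpose_mat P * P = 1\<^sub>m n"
    and D: "D \<in> carrier_mat n n" "diagonal_mat D"
    and A: "A = P * D * transpose_mat P"
  shows "(\<Sum>t\<in>{t. t < 0 \<and> eigenvalue A t}. order t (char_poly A)) = card {i. i < n \<and> D $$ (i, i) < 0}"
proof -
  let ?d = "\<lambda>i. D $$ (i, i)"
  let ?S = "{i. i < n \<and> ?d i < 0}"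
  have "P * transpose_mat P = 1\<^sub>m n"
    using mat_mult_left_right_inverse[of "transpose_mat P" n P] P by simp
  then have "similar_mat A D"
    using P D A by (intro similar_matI[of _ _ P "transpose_mat P" n]) auto
  then have "char_poly A = char_poly D" by (rule char_poly_similar)
  also have "\<dots> = (\<Prod>a\<leftarrow>diag_mat D. [:- a, 1:])"
    using D by (intro char_poly_upper_triangular[of _ n]) (auto simp: diagonal_mat_def)
  finally have cp: "char_poly A = (\<Prod>a\<leftarrow>diag_mat D. [:- a, 1:])" .
  have dm: "diag_mat D = map ?d [0..<n]" using D by (simp add: diag_mat_def)
  have count: "order t (char_poly A) = card {i. i < n \<and> ?d i = t}" for t
    unfolding cp order_linear_factors dm by (rule count_list_map_upt)
  have "A \<in> carrier_mat n n" using P D A by simp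
  then have "eigenvalue A t \<longleftrightarrow> t \<in> ?d ` {..<n}" for t
    by (auto simp: eigenvalue_root_char_poly cp dm poly_prod_list prod_list_zero_iff)
  then have "{t. t < 0 \<and> eigenvalue A t} = ?d ` ?S" by auto
  then have "(\<Sum>t\<in>{t. t < 0 \<and> eigenvalue A t}. order t (char_poly A))
      = (\<Sum>t\<in>?d ` ?S. \<Sum>i\<in>{i \<in> ?S. ?d i = t}. 1)"
    unfolding count by (auto intro!: sum.cong arg_cong[of _ _ card])
  also have "\<dots> = card ?S"
    by (subst sum.image_gen[symmetric]) auto
  finally show ?thesis .
qed

text \<open>Gaussian elimination by induction on the equations: an equation with a nonzero
  coefficient at \<open>i0\<close> is solved for that unknown and substituted into the others, at
  the cost of one equation and one unknown. Both inertia bounds get their test function from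
  here.\<close>

lemma homogeneous_system_nontrivial:
  fixes M :: "'j \<Rightarrow> 'i \<Rightarrow> 'f :: field"
  assumes "finite J" "finite I" "card J < card I"
  shows "\<exists>c. (\<exists>i\<in>I. c i \<noteq> 0) \<and> (\<forall>j\<in>J. (\<Sum>i\<in>I. M j i * c i) = 0)"
  using assms
proof (induction J arbitrary: I M rule: finite_induct)
  case empty
  then show ?case by (intro exI[of _ "\<lambda>_. 1"]) (auto simp: card_gt_0_iff)
next
  case (insert j0 J)
  show ?case
  proof (cases "\<forall>i\<in>I. M j0 i = 0")
    case True
    have "card J < card I" using insert by simp
    then show ?thesis using insert.IH[OF \<open>finite I\<close>, of M] True by auto
  next
    case False
    then obtain i0 where i0: "i0 \<in> I" "M j0 i0 \<noteq> 0" by blast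
    define I' where "I' = I - {i0}"
    have I': "I = insert i0 I'" "i0 \<notin> I'" "finite I'" using i0 insert.prems by (auto simp: I'_def)
    have "card J < card I'" using insert.prems insert.hyps I' by simp
    then obtain c where c: "\<exists>i\<in>I'. c i \<noteq> 0"
      "\<And>j. j \<in> J \<Longrightarrow> (\<Sum>i\<in>I'. (M j i - M j i0 * (M j0 i / M j0 i0)) * c i) = 0"
      using insert.IH[OF I'(3), of "\<lambda>j i. M j i - M j i0 * (M j0 i / M j0 i0)"] by blast
    \<comment> \<open>Equation \<open>j0\<close> forces the value \<open>- s\<close> on the unknown
      \<open>i0\<close>.\<close>
    define s where "s = (\<Sum>i\<in>I'. M j0 i / M j0 i0 * c i)"
    define c' where "c' = c(i0 := - s)"
    have sum: "(\<Sum>i\<in>I. M j i * c' i) = (\<Sum>i\<in>I'. M j i * c i) - M j i0 * s" for j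
    proof -
      have "(\<Sum>i\<in>I'. M j i * c' i) = (\<Sum>i\<in>I'. M j i * c i)"
        using I' by (intro sum.cong) (auto simp: c'_def)
      then show ?thesis using I' by (simp add: c'_def)
    qed
    have "(\<Sum>i\<in>I. M j i * c' i) = 0" if "j \<in> insert j0 J" for j
    proof (cases "j = j0")
      case True
      then show ?thesis unfolding sum s_def using i0 by (simp add: sum_distrib_left)
    next
      case False
      then have "j \<in> J" using that by simp
      from c(2)[OF this] show ?thesis
        unfolding sum s_def
        by (simp add: left_diff_distrib sum_subtractf sum_distrib_left mult.assoc)
    qed
    moreover have "\<exists>i\<in>I. c' i \<noteq> 0" using c(1) I' by (auto simp: c'_def)
    ultimately show ?thesis by blast
  qed
qed

text \<open>The entries of the adjacency matrix indexed by the vertices themselves, so that the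
  enumeration behind \<open>adj_matrix\<close> is met only in
  \<open>qform_diagonalization\<close>.\<close>

definition wt :: "'a wgraph \<Rightarrow> 'a \<Rightarrow> 'a \<Rightarrow> real" where
  "wt G x y = (if {x, y} \<in> edges G then weight G {x, y} else 0)"

definition qform :: "'a wgraph \<Rightarrow> ('a \<Rightarrow> real) \<Rightarrow> real" where
  "qform G f = (\<Sum>x\<in>verts G. \<Sum>y\<in>verts G. wt G x y * f x * f y)"

lemma wt_commute: "wt G x y = wt G y x"
  by (simp add: wt_def insert_commute)

text \<open>The spectral theorem moved from indices to vertices: \<open>\<phi> i\<close> is the
  \<open>i\<close>-th column of the orthogonal matrix, read as a function on the vertices.
  Orthonormality is kept because the upper bound recovers coefficients from inner products.\<close>

lemma qform_diagonalization:
  fixes G :: "'a wgraph"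
  assumes fin: "finite (verts G)"
  obtains n :: nat and d :: "nat \<Rightarrow> real" and \<phi> :: "nat \<Rightarrow> 'a \<Rightarrow> real"
  where "\<And>f. qform G f = (\<Sum>i<n. d i * (\<Sum>x\<in>verts G. \<phi> i x * f x)\<^sup>2)"
    "\<And>i j. i < n \<Longrightarrow> j < n \<Longrightarrow> (\<Sum>x\<in>verts G. \<phi> i x * \<phi> j x) = (if i = j then 1 else 0)"
    "neg_inertia G = card {i. i < n \<and> d i < 0}"
proof -
  define xs where "xs = vertex_list G"
  define n where "n = length xs"
  have "distinct xs \<and> set xs = verts G"
    unfolding xs_def vertex_list_def by (rule someI_ex) (use finite_distinct_list[OF fin] in blast)
  then have xs: "distinct xs" "set xs = verts G" by auto
  define A where "A = adj_matrix G"
  have A: "A = mat n n (\<lambda>(i, j). wt G (xs ! i) (xs ! j))"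
    by (simp add: A_def adj_matrix_def Let_def xs_def n_def wt_def)
  have Ac: "A \<in> carrier_mat n n" by (simp add: A)
  have As: "transpose_mat A = A" by (auto simp: A wt_commute intro!: eq_matI)
  obtain P D where P: "P \<in> carrier_mat n n" "transpose_mat P * P = 1\<^sub>m n"
    and D: "D \<in> carrier_mat n n" "diagonal_mat D" and PD: "A = P * D * transpose_mat P"
    using real_symmetric_diagonalization[OF Ac As] by blast
  define d where "d i = D $$ (i, i)" for i
  have Aij: "wt G (xs ! i) (xs ! j) = (\<Sum>k<n. P $$ (i, k) * d k * P $$ (j, k))"
    if ij: "i < n" "j < n" for i j
  proof -
    have PDk: "(P * D) $$ (i, k) = P $$ (i, k) * d k" if k: "k < n" for k
    proof -
      have "(P * D) $$ (i, k) = (\<Sum>l<n. P $$ (i, l) * D $$ (l, k))"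
        using P D ij k by (simp add: scalar_prod_def atLeast0LessThan)
      also have "\<dots> = (\<Sum>l<n. if l = k then P $$ (i, k) * d k else 0)"
        using D k by (intro sum.cong) (auto simp: diagonal_mat_def d_def)
      finally show ?thesis using k by simp
    qed
    have "wt G (xs ! i) (xs ! j) = (P * D * transpose_mat P) $$ (i, j)"
      unfolding PD[symmetric] using ij by (simp add: A)
    also have "\<dots> = (\<Sum>k<n. (P * D) $$ (i, k) * P $$ (j, k))"
    proof -
      define M where "M = P * D"
      have "M \<in> carrier_mat n n" using P D by (simp add: M_def)
      then show ?thesis
        unfolding M_def[symmetric] using P ij by (simp add: scalar_prod_def atLeast0LessThan)
    qed
    finally show ?thesis by (simp add: PDk)
  qed
  have sumV: "(\<Sum>x\<in>verts G. h x) = (\<Sum>i<n. h (xs ! i))" for h :: "'a \<Rightarrow> real"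
    using sum.reindex_bij_betw[OF bij_betw_nth[OF xs(1), of "{..<n}" "verts G"], of h] xs(2)
    by (simp add: n_def)
  define \<phi> where "\<phi> k x = P $$ (the_inv_into {..<n} (nth xs) x, k)" for k x
  have \<phi>: "\<phi> k (xs ! i) = P $$ (i, k)" if "i < n" for i k
    using xs(1) that unfolding \<phi>_def
    by (subst the_inv_into_f_f) (auto simp: inj_on_def n_def nth_eq_iff_index_eq)
  show ?thesis
  proof
    fix f :: "'a \<Rightarrow> real"
    define g where "g i = f (xs ! i)" for i
    have "qform G f = (\<Sum>i<n. \<Sum>j<n. \<Sum>k<n. d k * ((P $$ (i, k) * g i) * (P $$ (j, k) * g j)))"
      unfolding qform_def sumV g_def
      by (intro sum.cong refl) (simp add: Aij sum_distrib_right sum_distrib_left mult_ac)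
    also have "\<dots> = (\<Sum>i<n. \<Sum>k<n. \<Sum>j<n. d k * ((P $$ (i, k) * g i) * (P $$ (j, k) * g j)))"
      by (rule sum.cong[OF refl]) (rule sum.swap)
    also have "\<dots> = (\<Sum>k<n. \<Sum>i<n. \<Sum>j<n. d k * ((P $$ (i, k) * g i) * (P $$ (j, k) * g j)))"
      by (rule sum.swap)
    also have "\<dots> = (\<Sum>k<n. d k * (\<Sum>x\<in>verts G. \<phi> k x * f x)\<^sup>2)"
      unfolding sumV by (intro sum.cong refl)
        (simp add: \<phi> power2_eq_square g_def flip: sum_distrib_left sum_distrib_right)
    finally show "qform G f = (\<Sum>k<n. d k * (\<Sum>x\<in>verts G. \<phi> k x * f x)\<^sup>2)" .
  next
    fix i j assume ij: "i < n" "j < n"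
    have "(\<Sum>x\<in>verts G. \<phi> i x * \<phi> j x) = (transpose_mat P * P) $$ (i, j)"
      unfolding sumV using ij P(1) by (simp add: \<phi> scalar_prod_def atLeast0LessThan)
    then show "(\<Sum>x\<in>verts G. \<phi> i x * \<phi> j x) = (if i = j then 1 else 0)"
      using P(2) ij by simp
  next
    show "neg_inertia G = card {i. i < n \<and> d i < 0}"
      using sum_order_negative_eigenvalues[OF P D PD]
      by (simp add: neg_inertia_def A_def[symmetric] d_def)
  qed
qed

text \<open>If fewer than \<open>k\<close> of the squares were negative, some nonzero combination of
  the \<open>\<psi> i\<close> would be annihilated by all negative coordinates, and the form would
  be nonnegative on it. Strict negativity for every nonzero coefficient vector also carries the
  independence of the \<open>\<psi> i\<close>.\<close>

lemma neg_inertia_geI: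
  fixes G :: "'a wgraph"
  assumes fin: "finite (verts G)"
    and neg: "\<And>c. \<exists>i<k. c i \<noteq> 0 \<Longrightarrow> qform G (\<lambda>x. \<Sum>i<k. c i * \<psi> i x) < 0"
  shows "k \<le> neg_inertia G"
proof (rule ccontr)
  assume less: "\<not> k \<le> neg_inertia G"
  obtain n :: nat and d :: "nat \<Rightarrow> real" and \<phi> :: "nat \<Rightarrow> 'a \<Rightarrow> real" where
    q: "\<And>f. qform G f = (\<Sum>i<n. d i * (\<Sum>x\<in>verts G. \<phi> i x * f x)\<^sup>2)"
    and "\<And>i j. i < n \<Longrightarrow> j < n \<Longrightarrow> (\<Sum>x\<in>verts G. \<phi> i x * \<phi> j x) = (if i = j then 1 else 0)"
    and inertia: "neg_inertia G = card {i. i < n \<and> d i < 0}"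
    by (rule qform_diagonalization[OF fin]) (rule that; assumption)
  let ?J = "{i. i < n \<and> d i < 0}"
  obtain c where c: "\<exists>i<k. c i \<noteq> 0"
    "\<And>j. j \<in> ?J \<Longrightarrow> (\<Sum>i<k. (\<Sum>x\<in>verts G. \<phi> j x * \<psi> i x) * c i) = 0"
    using homogeneous_system_nontrivial[of ?J "{..<k}" "\<lambda>j i. \<Sum>x\<in>verts G. \<phi> j x * \<psi> i x"]
      less inertia by auto
  have "(\<Sum>x\<in>verts G. \<phi> j x * (\<Sum>i<k. c i * \<psi> i x)) = (\<Sum>i<k. (\<Sum>x\<in>verts G. \<phi> j x * \<psi> i x) * c i)" for j
    by (simp add: sum_distrib_left sum_distrib_right mult_ac) (rule sum.swap)
  then have "qform G (\<lambda>x. \<Sum>i<k. c i * \<psi> i x) \<ge> 0"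
    unfolding q using c(2) by (intro sum_nonneg) (force simp: zero_le_mult_iff not_less)
  with neg[OF c(1)] show False by simp
qed

text \<open>The opposite count: among more than \<open>k\<close> negative eigenvectors, some nonzero
  combination lies in the common kernel of the \<open>l j\<close>. Orthonormality leaves it only
  negative coordinates, so the form is negative there.\<close>

lemma neg_inertia_leI:
  fixes G :: "'a wgraph"
  assumes fin: "finite (verts G)"
    and nonneg: "\<And>f. (\<And>j. j < k \<Longrightarrow> (\<Sum>x\<in>verts G. l j x * f x) = 0) \<Longrightarrow> qform G f \<ge> 0"
  shows "neg_inertia G \<le> k"
proof (rule ccontr)
  assume less: "\<not> neg_inertia G \<le> k"
  obtain n :: nat and d :: "nat \<Rightarrow> real" and \<phi> :: "nat \<Rightarrow> 'a \<Rightarrow> real" where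
    q: "\<And>f. qform G f = (\<Sum>i<n. d i * (\<Sum>x\<in>verts G. \<phi> i x * f x)\<^sup>2)"
    and ortho: "\<And>i j. i < n \<Longrightarrow> j < n \<Longrightarrow> (\<Sum>x\<in>verts G. \<phi> i x * \<phi> j x) = (if i = j then 1 else 0)"
    and inertia: "neg_inertia G = card {i. i < n \<and> d i < 0}"
    by (rule qform_diagonalization[OF fin]) (rule that; assumption)
  let ?J = "{i. i < n \<and> d i < 0}"
  obtain c where c: "\<exists>i\<in>?J. c i \<noteq> 0"
    "\<And>j. j < k \<Longrightarrow> (\<Sum>i\<in>?J. (\<Sum>x\<in>verts G. l j x * \<phi> i x) * c i) = 0"
    using homogeneous_system_nontrivial[of "{..<k}" ?J "\<lambda>j i. \<Sum>x\<in>verts G. l j x * \<phi> i x"]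
      less inertia by auto
  define f where "f x = (\<Sum>i\<in>?J. c i * \<phi> i x)" for x
  have swap: "(\<Sum>x\<in>verts G. h x * f x) = (\<Sum>i\<in>?J. (\<Sum>x\<in>verts G. h x * \<phi> i x) * c i)" for h
    by (simp add: f_def sum_distrib_left sum_distrib_right mult_ac) (rule sum.swap)
  have "qform G f \<ge> 0" by (rule nonneg) (use c(2) swap in simp)
  moreover have "(\<Sum>x\<in>verts G. \<phi> i x * f x) = (if i \<in> ?J then c i else 0)" if "i < n" for i
  proof -
    have "(\<Sum>x\<in>verts G. \<phi> i x * f x) = (\<Sum>j\<in>?J. if i = j then c i else 0)"
      unfolding swap using that by (intro sum.cong) (auto simp: ortho)
    then show ?thesis by simp
  qed
  then have "qform G f = (\<Sum>i<n. if i \<in> ?J then d i * (c i)\<^sup>2 else 0)"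
    unfolding q by (intro sum.cong) auto
  moreover have "(\<Sum>i<n. if i \<in> ?J then - (d i * (c i)\<^sup>2) else 0) > 0"
  proof -
    obtain i where "i \<in> ?J" "c i \<noteq> 0" using c(1) by blast
    then show ?thesis
      by (intro sum_pos2[of _ i]) (auto simp: mult_neg_pos mult_nonpos_nonneg)
  qed
  then have "(\<Sum>i<n. if i \<in> ?J then d i * (c i)\<^sup>2 else 0) < 0"
    by (simp add: sum_negf[symmetric] if_distrib[of uminus] flip: neg_less_0_iff_less cong: if_cong)
  ultimately show False by simp
qed

section \<open>Lower bounds from induced subgraphs\<close>

definition nbrs :: "'a wgraph \<Rightarrow> 'a \<Rightarrow> 'a set" where
  "nbrs G x = {y. {x, y} \<in> edges G}"

lemma nbrs_sym: "y \<in> nbrs G x \<longleftrightarrow> x \<in> nbrs G y"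
  by (simp add: nbrs_def insert_commute)

section \<open>Evaluation of the form on functions with small support\<close>

lemma qform_supported:
  assumes "finite (verts G)" "S \<subseteq> verts G" "\<And>x. x \<notin> S \<Longrightarrow> f x = 0"
  shows "qform G f = (\<Sum>x\<in>S. \<Sum>y\<in>S. wt G x y * f x * f y)"
proof -
  have S: "(\<Sum>x\<in>verts G. h x * f x) = (\<Sum>x\<in>S. h x * f x)" for h
    using assms by (intro sum.mono_neutral_right) auto
  have "qform G f = (\<Sum>x\<in>verts G. (\<Sum>y\<in>verts G. wt G x y * f y) * f x)"
    by (simp add: qform_def sum_distrib_left sum_distrib_right mult_ac)
  also have "\<dots> = (\<Sum>x\<in>S. (\<Sum>y\<in>S. wt G x y * f y) * f x)"
    by (simp only: S)
  finally show ?thesis by (simp add: sum_distrib_left sum_distrib_right mult_ac)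
qed

lemma qform_three:
  assumes "finite (verts G)" "distinct [x, y, z]" "{x, y, z} \<subseteq> verts G"
    and diag: "wt G x x = 0" "wt G y y = 0" "wt G z z = 0"
    and f: "\<And>v. v \<notin> {x, y, z} \<Longrightarrow> f v = 0"
  shows "qform G f = 2 * (wt G x y * f x * f y + wt G x z * f x * f z + wt G y z * f y * f z)"
  using assms by (subst qform_supported[OF assms(1,3) f])
    (auto simp: wt_commute[of G y x] wt_commute[of G z x] wt_commute[of G z y])

lemma qform_five:
  assumes "finite (verts G)" "distinct [x, y, z, s, t]" "{x, y, z, s, t} \<subseteq> verts G"
    and diag: "wt G x x = 0" "wt G y y = 0" "wt G z z = 0" "wt G s s = 0" "wt G t t = 0"
    and f: "\<And>v. v \<notin> {x, y, z, s, t} \<Longrightarrow> f v = 0"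
  shows "qform G f = 2 * (wt G x y * f x * f y + wt G x z * f x * f z + wt G y z * f y * f z
    + (wt G x s * f x + wt G y s * f y + wt G z s * f z) * f s
    + (wt G x t * f x + wt G y t * f y + wt G z t * f z) * f t + wt G s t * f s * f t)"
proof -
  have "qform G f = (\<Sum>u\<in>{x, y, z, s, t}. \<Sum>v\<in>{x, y, z, s, t}. wt G u v * f u * f v)"
    by (rule qform_supported[OF assms(1,3) f])
  also have "\<dots> = 2 * (wt G x y * f x * f y + wt G x z * f x * f z + wt G y z * f y * f z
    + (wt G x s * f x + wt G y s * f y + wt G z s * f z) * f s
    + (wt G x t * f x + wt G y t * f y + wt G z t * f z) * f t + wt G s t * f s * f t)"
    using assms(2) diag by (simp add: wt_commute[of G y x] wt_commute[of G z x] wt_commute[of G z y]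
      wt_commute[of G s x] wt_commute[of G s y] wt_commute[of G s z]
      wt_commute[of G t x] wt_commute[of G t y] wt_commute[of G t z] wt_commute[of G t s])
      (simp add: algebra_simps)
  finally show ?thesis .
qed

text \<open>\<open>F a b\<close> parametrises a test plane by its two coordinates; linearity in them
  turns it into the indexed family of the general bound.\<close>

lemma neg_inertia_ge2I:
  assumes "finite (verts G)"
    and lin: "\<And>a b x. F a b x = a * F 1 0 x + b * F 0 1 x"
    and neg: "\<And>a b. a \<noteq> 0 \<or> b \<noteq> 0 \<Longrightarrow> qform G (F a b) < 0"
  shows "2 \<le> neg_inertia G"
proof (rule neg_inertia_geI[OF assms(1)])
  fix c :: "nat \<Rightarrow> real" assume c: "\<exists>i<2. c i \<noteq> 0"
  let ?\<psi> = "(!) [F 1 0, F 0 1]"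
  have "F (c 0) (c 1) x = (\<Sum>i<2. c i * ?\<psi> i x)" for x
    using lin[of "c 0" "c 1" x] by (simp add: numeral_2_eq_2)
  then have "F (c 0) (c 1) = (\<lambda>x. \<Sum>i<2. c i * ?\<psi> i x)" by blast
  moreover have "c 0 \<noteq> 0 \<or> c 1 \<noteq> 0" using c by (auto simp: less_2_cases_iff)
  ultimately show "qform G (\<lambda>x. \<Sum>i<2. c i * ?\<psi> i x) < 0" using neg by metis
qed

lemma neg_inertia_ge3I:
  assumes "finite (verts G)"
    and lin: "\<And>a b c x. F a b c x = a * F 1 0 0 x + b * F 0 1 0 x + c * F 0 0 1 x"
    and neg: "\<And>a b c. a \<noteq> 0 \<or> b \<noteq> 0 \<or> c \<noteq> 0 \<Longrightarrow> qform G (F a b c) < 0"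
  shows "3 \<le> neg_inertia G"
proof (rule neg_inertia_geI[OF assms(1)])
  fix c :: "nat \<Rightarrow> real" assume c: "\<exists>i<3. c i \<noteq> 0"
  let ?\<psi> = "(!) [F 1 0 0, F 0 1 0, F 0 0 1]"
  have "F (c 0) (c 1) (c 2) x = (\<Sum>i<3. c i * ?\<psi> i x)" for x
    using lin[of "c 0" "c 1" "c 2" x] by (simp add: eval_nat_numeral)
  then have "F (c 0) (c 1) (c 2) = (\<lambda>x. \<Sum>i<3. c i * ?\<psi> i x)" by blast
  moreover have "c 0 \<noteq> 0 \<or> c 1 \<noteq> 0 \<or> c 2 \<noteq> 0"
    using c by (auto simp: numeral_3_eq_3 numeral_2_eq_2 less_Suc_eq)
  ultimately show "qform G (\<lambda>x. \<Sum>i<3. c i * ?\<psi> i x) < 0" using neg by metis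
qed

lemma neg_inertia_le1I:
  assumes "finite (verts G)"
    and "\<And>f. (\<Sum>x\<in>verts G. l x * f x) = 0 \<Longrightarrow> qform G f \<ge> 0"
  shows "neg_inertia G \<le> 1"
  by (rule neg_inertia_leI[where l = "\<lambda>_. l"]) (use assms in auto)

lemma neg_inertia_le2I:
  assumes "finite (verts G)"
    and "\<And>f. (\<Sum>x\<in>verts G. l1 x * f x) = 0 \<Longrightarrow> (\<Sum>x\<in>verts G. l2 x * f x) = 0 \<Longrightarrow> qform G f \<ge> 0"
  shows "neg_inertia G \<le> 2"
proof (rule neg_inertia_leI[where l = "(!) [l1, l2]", OF assms(1)])
  fix f assume l: "\<And>j. j < 2 \<Longrightarrow> (\<Sum>x\<in>verts G. ([l1, l2] ! j) x * f x) = 0"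
  show "0 \<le> qform G f" using l[of 0] l[of 1] by (intro assms(2)) auto
qed

text \<open>On the span of the \<open>x i\<close> and \<open>y j\<close> the form has the block shape
  \<open>D B; B\<^sup>T 0\<close>, so the coordinates along the \<open>y j\<close> can be solved for
  to make it minus the square norm of the coordinates along the \<open>x i\<close>.\<close>

lemma neg_inertia_ge_isotropic:
  fixes G :: "'a wgraph" and x y :: "nat \<Rightarrow> 'a" and C :: "nat \<Rightarrow> nat \<Rightarrow> real"
  assumes fin: "finite (verts G)"
    and inj: "inj_on x {..<k}" "inj_on y {..<k}"
    and disj: "x ` {..<k} \<inter> y ` {..<k} = {}"
    and sub: "x ` {..<k} \<union> y ` {..<k} \<subseteq> verts G"
    and iso: "\<And>i j. i < k \<Longrightarrow> j < k \<Longrightarrow> wt G (y i) (y j) = 0"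
    and inv: "\<And>i l. i < k \<Longrightarrow> l < k \<Longrightarrow> (\<Sum>j<k. wt G (x i) (y j) * C j l) = (if i = l then 1 else 0)"
  shows "k \<le> neg_inertia G"
proof -
  \<comment> \<open>Let A be the block on the \<open>x i\<close> and B the block between the
    \<open>x i\<close> and the \<open>y j\<close>. The form at coordinates \<open>c\<close>,
    \<open>q\<close> is \<open>c A c + 2 c B q\<close>, and \<open>B q = - (A + I) c / 2\<close>
    reduces it to minus the square norm of \<open>c\<close>. So \<open>D\<close> is A + I, and
    \<open>K\<close> solves for \<open>q\<close> with the right inverse \<open>C\<close> of
    B.\<close>
  define D where "D l i = wt G (x l) (x i) + (if l = i then 1 else 0)" for l i
  define K where "K j i = - (\<Sum>l<k. C j l * D l i) / 2" for j i
  define \<psi> where "\<psi> i z = (if z \<in> x ` {..<k} then if z = x i then 1 else 0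
    else if z \<in> y ` {..<k} then K (the_inv_into {..<k} y z) i else 0)" for i z
  show ?thesis
  proof (rule neg_inertia_geI[OF fin, where \<psi> = \<psi>])
    fix c :: "nat \<Rightarrow> real" assume c: "\<exists>i<k. c i \<noteq> 0"
    define f where "f z = (\<Sum>i<k. c i * \<psi> i z)" for z
    define q where "q j = (\<Sum>i<k. c i * K j i)" for j
    have fx: "f (x l) = c l" if "l < k" for l
    proof -
      have "f (x l) = (\<Sum>i<k. if l = i then c i else 0)"
        unfolding f_def using that inj(1) by (intro sum.cong) (auto simp: \<psi>_def inj_on_def)
      then show ?thesis using that by simp
    qed
    have fy: "f (y j) = q j" if j: "j < k" for j
    proof -
      have "y j \<notin> x ` {..<k}" using disj j by auto
      then show ?thesis
        using j the_inv_into_f_f[OF inj(2), of j] by (simp add: f_def q_def \<psi>_def)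
    qed
    have Bq: "(\<Sum>j<k. wt G (x i) (y j) * q j) = - ((\<Sum>m<k. D i m * c m) / 2)" if i: "i < k" for i
    proof -
      have "(\<Sum>j<k. wt G (x i) (y j) * q j) =
        (\<Sum>j<k. \<Sum>m<k. \<Sum>l<k. - (c m * D l m / 2) * (wt G (x i) (y j) * C j l))"
        by (simp add: q_def K_def sum_distrib_left sum_distrib_right sum_divide_distrib mult_ac
            flip: sum_negf)
      also have "\<dots> = (\<Sum>m<k. \<Sum>j<k. \<Sum>l<k. - (c m * D l m / 2) * (wt G (x i) (y j) * C j l))"
        by (rule sum.swap)
      also have "\<dots> = (\<Sum>m<k. \<Sum>l<k. \<Sum>j<k. - (c m * D l m / 2) * (wt G (x i) (y j) * C j l))"
        by (rule sum.cong[OF refl]) (rule sum.swap)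
      also have "\<dots> = (\<Sum>m<k. \<Sum>l<k. if i = l then - (c m * D l m / 2) else 0)"
        by (intro sum.cong refl) (simp add: inv i sum_distrib_left[symmetric] del: mult_minus_left)
      also have "\<dots> = (\<Sum>m<k. - (c m * D i m / 2))"
        using i by simp
      also have "\<dots> = - ((\<Sum>m<k. D i m * c m) / 2)"
        by (simp add: sum_negf sum_divide_distrib mult.commute)
      finally show ?thesis .
    qed
    have split: "(\<Sum>z\<in>x ` {..<k} \<union> y ` {..<k}. h z) = (\<Sum>i<k. h (x i)) + (\<Sum>j<k. h (y j))"
      for h :: "'a \<Rightarrow> real"
      using disj inj by (subst sum.union_disjoint) (auto simp: sum.reindex)
    have "qform G f = (\<Sum>z\<in>x ` {..<k} \<union> y ` {..<k}. \<Sum>z'\<in>x ` {..<k} \<union> y ` {..<k}. wt G z z' * f z * f z')"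
      by (rule qform_supported[OF fin sub]) (auto simp: f_def \<psi>_def)
    also have "\<dots> = (\<Sum>i<k. \<Sum>m<k. wt G (x i) (x m) * c i * c m) + (\<Sum>i<k. \<Sum>j<k. wt G (x i) (y j) * c i * q j)
       + ((\<Sum>j<k. \<Sum>i<k. wt G (x i) (y j) * c i * q j))"
      by (simp add: split fx fy iso sum.distrib wt_commute[of G "y _" "x _"] mult_ac)
    also have "(\<Sum>j<k. \<Sum>i<k. wt G (x i) (y j) * c i * q j) = (\<Sum>i<k. \<Sum>j<k. wt G (x i) (y j) * c i * q j)"
      by (rule sum.swap)
    also have "(\<Sum>i<k. \<Sum>j<k. wt G (x i) (y j) * c i * q j) = (\<Sum>i<k. c i * (\<Sum>j<k. wt G (x i) (y j) * q j))"
      by (simp add: sum_distrib_left mult_ac)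
    also have "\<dots> = (\<Sum>i<k. c i * - ((\<Sum>m<k. D i m * c m) / 2))"
      by (simp add: Bq)
    also have "(\<Sum>i<k. \<Sum>m<k. wt G (x i) (x m) * c i * c m) = (\<Sum>i<k. c i * ((\<Sum>m<k. D i m * c m) - c i))"
    proof (rule sum.cong[OF refl])
      fix i assume "i \<in> {..<k}"
      then have "(\<Sum>m<k. D i m * c m) - c i = (\<Sum>m<k. wt G (x i) (x m) * c m)"
        by (simp add: D_def distrib_right sum.distrib if_distrib[of "\<lambda>t. t * c _"] cong: if_cong)
      then show "(\<Sum>m<k. wt G (x i) (x m) * c i * c m) = c i * ((\<Sum>m<k. D i m * c m) - c i)"
        by (simp add: sum_distrib_left mult_ac)
    qed
    finally have "qform G f = - (\<Sum>i<k. (c i)\<^sup>2)"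
      by (simp add: right_diff_distrib sum_subtractf power2_eq_square sum_negf flip: sum_divide_distrib)
    moreover obtain i where "i < k" "c i \<noteq> 0" using c by blast
    then have "(\<Sum>i<k. (c i)\<^sup>2) > 0" by (intro sum_pos2[of _ i]) auto
    ultimately show "qform G (\<lambda>z. \<Sum>i<k. c i * \<psi> i z) < 0" by (simp add: f_def[abs_def])
  qed
qed

corollary neg_inertia_ge2_isotropic:
  assumes fin: "finite (verts G)"
    and "distinct [x1, x2, y1, y2]" "{x1, x2, y1, y2} \<subseteq> verts G"
    and "wt G y1 y1 = 0" "wt G y2 y2 = 0" "wt G y1 y2 = 0"
    and det: "wt G x1 y1 * wt G x2 y2 \<noteq> wt G x1 y2 * wt G x2 y1"
  shows "2 \<le> neg_inertia G"
proof -
  define d where "d = wt G x1 y1 * wt G x2 y2 - wt G x1 y2 * wt G x2 y1"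
  have d: "d \<noteq> 0" using det by (simp add: d_def)
  \<comment> \<open>The inverse of the 2 by 2 weight matrix by cofactors.\<close>
  let ?C = "\<lambda>i j. [[wt G x2 y2 / d, - (wt G x1 y2 / d)], [- (wt G x2 y1 / d), wt G x1 y1 / d]] ! i ! j"
  show ?thesis
  proof (rule neg_inertia_ge_isotropic[OF fin, of "(!) [x1, x2]" 2 "(!) [y1, y2]" ?C])
    fix i l :: nat assume "i < 2" "l < 2"
    then show "(\<Sum>j<2. wt G ([x1, x2] ! i) ([y1, y2] ! j) * ?C j l) = (if i = l then 1 else 0)"
      using d by (auto simp: numeral_2_eq_2 less_Suc_eq field_simps) (simp_all add: d_def algebra_simps)
  qed (use assms in \<open>auto simp: numeral_2_eq_2 less_Suc_eq inj_on_def wt_commute[of G y2 y1]\<close>)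
qed

corollary neg_inertia_ge3_isotropic:
  assumes fin: "finite (verts G)"
    and "distinct [x1, x2, x3, y1, y2, y3]" "{x1, x2, x3, y1, y2, y3} \<subseteq> verts G"
    and "wt G y1 y1 = 0" "wt G y2 y2 = 0" "wt G y3 y3 = 0"
    and "wt G y1 y2 = 0" "wt G y1 y3 = 0" "wt G y2 y3 = 0"
    and det: "wt G x1 y1 * (wt G x2 y2 * wt G x3 y3 - wt G x2 y3 * wt G x3 y2)
      - wt G x1 y2 * (wt G x2 y1 * wt G x3 y3 - wt G x2 y3 * wt G x3 y1)
      + wt G x1 y3 * (wt G x2 y1 * wt G x3 y2 - wt G x2 y2 * wt G x3 y1) \<noteq> 0"
  shows "3 \<le> neg_inertia G"
proof -
  define b where "b i j = wt G ([x1, x2, x3] ! i) ([y1, y2, y3] ! j)" for i j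
  define d where "d = b 0 0 * (b 1 1 * b 2 2 - b 1 2 * b 2 1)
      - b 0 1 * (b 1 0 * b 2 2 - b 1 2 * b 2 0) + b 0 2 * (b 1 0 * b 2 1 - b 1 1 * b 2 0)"
  have d: "d \<noteq> 0" using det by (simp add: d_def b_def)
  \<comment> \<open>The adjugate of \<open>b\<close>; division by the determinant \<open>d\<close>
    gives the right inverse.\<close>
  let ?adj = "[[b 1 1 * b 2 2 - b 1 2 * b 2 1, b 0 2 * b 2 1 - b 0 1 * b 2 2, b 0 1 * b 1 2 - b 0 2 * b 1 1],
    [b 1 2 * b 2 0 - b 1 0 * b 2 2, b 0 0 * b 2 2 - b 0 2 * b 2 0, b 0 2 * b 1 0 - b 0 0 * b 1 2],
    [b 1 0 * b 2 1 - b 1 1 * b 2 0, b 0 1 * b 2 0 - b 0 0 * b 2 1, b 0 0 * b 1 1 - b 0 1 * b 1 0]]"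
  have three: "{..<3} = {0, 1, 2::nat}" by auto
  show ?thesis
  proof (rule neg_inertia_ge_isotropic[OF fin, of "(!) [x1, x2, x3]" 3 "(!) [y1, y2, y3]"
        "\<lambda>i j. ?adj ! i ! j / d"])
    fix i l :: nat assume "i < 3" "l < 3"
    then have il: "i = 0 \<or> i = 1 \<or> i = 2" "l = 0 \<or> l = 1 \<or> l = 2" by auto
    have "(\<Sum>j<3. b i j * (?adj ! j ! l)) = (if i = l then d else 0)"
      using il by (auto simp: three d_def algebra_simps)
    then have "(\<Sum>j<3. b i j * (?adj ! j ! l / d)) = (if i = l then 1 else 0)"
      using d by (simp flip: sum_divide_distrib)
    then show "(\<Sum>j<3. wt G ([x1, x2, x3] ! i) ([y1, y2, y3] ! j) * (?adj ! j ! l / d)) = (if i = l then 1 else 0)"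
      by (simp add: b_def)
  next
    fix i j :: nat assume "i < 3" "j < 3"
    then have "i = 0 \<or> i = 1 \<or> i = 2" "j = 0 \<or> j = 1 \<or> j = 2" by auto
    then show "wt G ([y1, y2, y3] ! i) ([y1, y2, y3] ! j) = 0"
      using assms by (auto simp: wt_commute[of G y2 y1] wt_commute[of G y3 y1] wt_commute[of G y3 y2])
  qed (use assms(2,3) in \<open>auto simp: three inj_on_def\<close>)
qed

text \<open>The expression equals \<open>\<alpha> * (p + \<gamma> / \<alpha> * s) * (q + \<beta> /
  \<alpha> * s) - \<beta> * \<gamma> / \<alpha> * s^2\<close>, and \<open>p\<close>,
  \<open>q\<close> are chosen so that the two factors are \<open>t\<close> and \<open>- t\<close>.
  This exhibits the negative plane of a triangle with positive weights.\<close>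

lemma triangle_form_neg:
  fixes \<alpha> \<beta> \<gamma> :: real
  assumes "\<alpha> > 0" "\<beta> > 0" "\<gamma> > 0" "t \<noteq> 0 \<or> s \<noteq> 0"
  defines "p \<equiv> t - \<gamma> / \<alpha> * s" and "q \<equiv> - t - \<beta> / \<alpha> * s"
  shows "\<alpha> * p * q + \<beta> * p * s + \<gamma> * q * s < 0"
proof -
  have "\<alpha> * p * q + \<beta> * p * s + \<gamma> * q * s = - (\<alpha> * t\<^sup>2 + \<beta> * \<gamma> / \<alpha> * s\<^sup>2)"
    using assms by (simp add: p_def q_def field_simps power2_eq_square)
  moreover have "\<alpha> * t\<^sup>2 \<ge> 0" "\<beta> * \<gamma> / \<alpha> * s\<^sup>2 \<ge> 0" using assms(1-3) by simp_all
  moreover have "\<alpha> * t\<^sup>2 > 0 \<or> \<beta> * \<gamma> / \<alpha> * s\<^sup>2 > 0" using assms(1-4) by auto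
  ultimately show ?thesis by linarith
qed

lemma neg_inertia_ge2_triangle:
  assumes fin: "finite (verts G)" and "distinct [v, p, q]" "{v, p, q} \<subseteq> verts G"
    and diag: "wt G v v = 0" "wt G p p = 0" "wt G q q = 0"
    and pos: "wt G p q > 0" "wt G p v > 0" "wt G q v > 0"
  shows "2 \<le> neg_inertia G"
proof -
  define P where "P t s = t - wt G q v / wt G p q * s" for t s
  define Q where "Q t s = - t - wt G p v / wt G p q * s" for t s
  let ?F = "\<lambda>t s z. if z = v then s else if z = p then P t s else if z = q then Q t s else 0"
  show ?thesis
  proof (rule neg_inertia_ge2I[OF fin, of ?F])
    fix t s :: real assume "t \<noteq> 0 \<or> s \<noteq> 0"
    then have neg: "wt G p q * P t s * Q t s + wt G p v * P t s * s + wt G q v * Q t s * s < 0"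
      using triangle_form_neg[OF pos] unfolding P_def Q_def by blast
    have "qform G (?F t s) = 2 * (wt G v p * ?F t s v * ?F t s p + wt G v q * ?F t s v * ?F t s q
        + wt G p q * ?F t s p * ?F t s q)"
      by (rule qform_three[OF fin assms(2,3) diag]) simp
    also have "\<dots> = 2 * (wt G p q * P t s * Q t s + wt G p v * P t s * s + wt G q v * Q t s * s)"
      using assms(2) by (auto simp: wt_commute[of G v p] wt_commute[of G v q])
    finally show "qform G (?F t s) < 0" using neg by simp
  qed (auto simp: P_def Q_def algebra_simps)
qed

text \<open>Eliminating the hyperbolic pair \<open>r\<close>, \<open>m\<close> leaves a negative multiple of a square and a form on
  \<open>v\<close>, \<open>p\<close>, \<open>q\<close> whose off-diagonal coefficients are those in the positivity hypotheses.\<close>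

lemma neg_inertia_ge3_triangle_edge:
  assumes fin: "finite (verts G)" and "distinct [v, p, q, r, m]" "{v, p, q, r, m} \<subseteq> verts G"
    and diag: "wt G v v = 0" "wt G p p = 0" "wt G q q = 0" "wt G r r = 0" "wt G m m = 0"
    and nonneg: "\<And>x y. wt G x y \<ge> 0"
    and rm: "wt G r m > 0"
    and pq: "wt G p q * wt G r m > wt G p r * wt G q m + wt G p m * wt G q r"
    and pv: "wt G p v * wt G r m > wt G p r * wt G v m + wt G p m * wt G v r"
    and qv: "wt G q v * wt G r m > wt G q r * wt G v m + wt G q m * wt G v r"
  shows "3 \<le> neg_inertia G"
proof -
  define e where "e = wt G r m"
  define \<alpha> \<beta> \<gamma> where "\<alpha> = wt G p q * e - (wt G p r * wt G q m + wt G p m * wt G q r)"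
    and "\<beta> = wt G p v * e - (wt G p r * wt G v m + wt G p m * wt G v r)"
    and "\<gamma> = wt G q v * e - (wt G q r * wt G v m + wt G q m * wt G v r)"
  have pos: "\<alpha> > 0" "\<beta> > 0" "\<gamma> > 0" "e > 0"
    using pq pv qv rm by (simp_all add: \<alpha>_def \<beta>_def \<gamma>_def e_def)
  define P where "P t s = t - \<gamma> / \<alpha> * s" for t s
  define Q where "Q t s = - t - \<beta> / \<alpha> * s" for t s
  \<comment> \<open>\<open>R\<close> and \<open>M\<close> collect what \<open>r\<close> and
    \<open>m\<close> receive from the values on the triangle.\<close>
  define R where "R t s = s * wt G v r + P t s * wt G p r + Q t s * wt G q r" for t s
  define M where "M t s = s * wt G v m + P t s * wt G p m + Q t s * wt G q m" for t s
  \<comment> \<open>The part of the form that contains \<open>f r\<close> or \<open>f m\<close> is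
    \<open>2 * e * (f r + M / e) * (f m + R / e) - 2 * R * M / e\<close>; the values chosen here
    make the two factors \<open>w\<close> and \<open>- w\<close>.\<close>
  let ?F = "\<lambda>w t s z. if z = v then s else if z = p then P t s else if z = q then Q t s
    else if z = r then w - M t s / e else if z = m then - w - R t s / e else 0"
  show ?thesis
  proof (rule neg_inertia_ge3I[OF fin, of ?F])
    fix w t s :: real assume nz: "w \<noteq> 0 \<or> t \<noteq> 0 \<or> s \<noteq> 0"
    let ?T = "\<alpha> * P t s * Q t s + \<beta> * P t s * s + \<gamma> * Q t s * s"
    define f where "f = ?F w t s"
    have f: "f v = s" "f p = P t s" "f q = Q t s" "f r = w - M t s / e" "f m = - w - R t s / e"
      using assms(2) by (auto simp: f_def)
    have RM: "wt G v r * s + wt G p r * P t s + wt G q r * Q t s = R t s"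
      "wt G v m * s + wt G p m * P t s + wt G q m * Q t s = M t s"
      by (simp_all only: R_def M_def mult.commute)
    have "qform G f = 2 * (wt G v p * f v * f p + wt G v q * f v * f q + wt G p q * f p * f q
        + (wt G v r * f v + wt G p r * f p + wt G q r * f q) * f r
        + (wt G v m * f v + wt G p m * f p + wt G q m * f q) * f m + wt G r m * f r * f m)"
      by (rule qform_five[OF fin assms(2,3) diag]) (simp add: f_def)
    also have "\<dots> = 2 * (wt G p q * P t s * Q t s + wt G p v * P t s * s + wt G q v * Q t s * s)
          + 2 * (w - M t s / e) * R t s + 2 * (- w - R t s / e) * M t s
          + 2 * e * (w - M t s / e) * (- w - R t s / e)"
      unfolding f RM e_def[symmetric] wt_commute[of G v p] wt_commute[of G v q]
      by (simp only: distrib_left distrib_right mult_ac)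
    also have "\<dots> = - (2 * e * w\<^sup>2) + 2 / e * (e * (wt G p q * P t s * Q t s + wt G p v * P t s * s + wt G q v * Q t s * s) - R t s * M t s)"
      using pos by (simp add: field_simps power2_eq_square)
    also have "e * (wt G p q * P t s * Q t s + wt G p v * P t s * s + wt G q v * Q t s * s) - R t s * M t s
      = ?T - (wt G v r * wt G v m * s\<^sup>2 + wt G p r * wt G p m * (P t s)\<^sup>2 + wt G q r * wt G q m * (Q t s)\<^sup>2)"
      by (simp add: \<alpha>_def \<beta>_def \<gamma>_def R_def M_def algebra_simps power2_eq_square)
    finally have eq: "qform G f = - (2 * e * w\<^sup>2) + 2 / e * (?T -
        (wt G v r * wt G v m * s\<^sup>2 + wt G p r * wt G p m * (P t s)\<^sup>2 + wt G q r * wt G q m * (Q t s)\<^sup>2))" .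
    \<comment> \<open>The product \<open>R * M\<close> also contributes squares. Their coefficients
      are products of weights and they are subtracted, so they never raise the form.\<close>
    have sq: "wt G v r * wt G v m * s\<^sup>2 + wt G p r * wt G p m * (P t s)\<^sup>2 + wt G q r * wt G q m * (Q t s)\<^sup>2 \<ge> 0"
      using nonneg by (intro add_nonneg_nonneg mult_nonneg_nonneg) auto
    show "qform G (?F w t s) < 0"
    proof (cases "t = 0 \<and> s = 0")
      case True
      then show ?thesis unfolding f_def[symmetric] eq using nz pos by (simp add: P_def Q_def)
    next
      case False
      then have "?T < 0" using triangle_form_neg[OF pos(1-3)] unfolding P_def Q_def by blast
      then have "2 / e * (?T - (wt G v r * wt G v m * s\<^sup>2 + wt G p r * wt G p m * (P t s)\<^sup>2 + wt G q r * wt G q m * (Q t s)\<^sup>2)) < 0"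
        using sq pos by (intro mult_pos_neg) auto
      moreover have "2 * e * w\<^sup>2 \<ge> 0" using pos by simp
      ultimately show ?thesis unfolding f_def[symmetric] eq by linarith
    qed
  next
    fix w t s z
    have lin: "P t s = t * P 1 0 + s * P 0 1" "Q t s = t * Q 1 0 + s * Q 0 1"
      "P 0 0 = 0" "Q 0 0 = 0"
      by (simp_all add: P_def Q_def)
    then have "R t s = t * R 1 0 + s * R 0 1" "M t s = t * M 1 0 + s * M 0 1"
      "R 0 0 = 0" "M 0 0 = 0"
      by (simp_all add: R_def M_def algebra_simps)
    with lin show "?F w t s z = w * ?F 1 0 0 z + t * ?F 0 1 0 z + s * ?F 0 0 1 z"
      by (simp add: add_divide_distrib)
  qed
qed

section \<open>Structure of the graphs of inertia at most two\<close>

lemma card_eq_4E: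
  assumes "card A = 4"
  obtains a b c d where "A = {a, b, c, d}" "distinct [a, b, c, d]"
  using assms by (auto simp: card_Suc_eq numeral_eq_Suc)

locale bicyclic_core =
  fixes G :: "'a wgraph"
  assumes weighted: "weighted_graph G"
    and bicyclic: "bicyclic G"
    and no_pendant: "\<not> (\<exists>x. pendant G x)"
begin

abbreviation "N \<equiv> nbrs G"

section \<open>Degrees and connectivity\<close>

lemma fin: "finite (verts G)"
  using weighted by (simp add: weighted_graph_def)

lemma fin_edges: "finite (edges G)"
  using weighted by (intro finite_subset[of "edges G" "Pow (verts G)"]) (auto simp: weighted_graph_def)

lemma nbr_verts: "y \<in> N x \<Longrightarrow> x \<in> verts G" "y \<in> N x \<Longrightarrow> y \<in> verts G"
  using weighted by (auto simp: weighted_graph_def nbrs_def)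

lemma nbrs_subset: "N x \<subseteq> verts G"
  using nbr_verts(2) by blast

lemma nbr_neq: "y \<in> N x \<Longrightarrow> x \<noteq> y"
  using weighted by (auto simp: weighted_graph_def nbrs_def dest!: bspec[where x = "{x, y}"])

lemma nbr_irrefl [simp]: "x \<notin> N x"
  using nbr_neq by blast

lemma finite_nbrs: "finite (N x)"
  using finite_subset[OF _ fin] nbr_verts(2) by blast

lemma wt_pos: "y \<in> N x \<Longrightarrow> wt G x y > 0"
  using weighted by (simp add: wt_def nbrs_def weighted_graph_def)

lemma wt_zero: "y \<notin> N x \<Longrightarrow> wt G x y = 0"
  by (simp add: wt_def nbrs_def)

lemma wt_self [simp]: "wt G x x = 0"
  by (simp add: wt_zero)

lemma wt_nonneg: "wt G x y \<ge> 0"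
  using wt_pos[of y x] wt_zero[of y x] by fastforce

lemma degree_card_nbrs: "degree_of G x = card (N x)"
proof -
  have "{e \<in> edges G. x \<in> e} = (\<lambda>y. {x, y}) ` N x"
  proof (intro equalityI subsetI)
    fix e assume e: "e \<in> {e \<in> edges G. x \<in> e}"
    then have "card e = 2" using weighted by (auto simp: weighted_graph_def)
    then obtain y where "e = {x, y}" using e by (auto simp: card_2_iff)
    then show "e \<in> (\<lambda>y. {x, y}) ` N x" using e by (auto simp: nbrs_def)
  qed (auto simp: nbrs_def)
  moreover have "inj_on (\<lambda>y. {x, y}) (N x)"
    by (auto simp: inj_on_def doubleton_eq_iff)
  ultimately show ?thesis by (simp add: degree_of_def card_image)
qed

lemma handshake: "(\<Sum>x\<in>verts G. card (N x)) = 2 * card (edges G)"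
proof -
  have "(\<Sum>x\<in>verts G. card (N x)) = (\<Sum>x\<in>verts G. card {e \<in> edges G. x \<in> e})"
    by (simp add: degree_card_nbrs[symmetric] degree_of_def)
  also have "\<dots> = (\<Sum>e\<in>edges G. 2)"
  proof -
    have "card {x \<in> verts G. x \<in> e} = 2" if "e \<in> edges G" for e
    proof -
      have "{x \<in> verts G. x \<in> e} = e" "card e = 2"
        using that weighted by (auto simp: weighted_graph_def)
      then show ?thesis by simp
    qed
    then show ?thesis
      using sum_multicount_gen[OF fin fin_edges, of "\<lambda>x e. x \<in> e" "\<lambda>_. 2"] by simp
  qed
  finally show ?thesis by simp
qed

text \<open>Connectivity in the form that closes a case: once the neighbourhoods of the vertices
  found so far contain no new vertex, the whole graph has been found.\<close>

lemma verts_closed: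
  assumes "S \<noteq> {}" "S \<subseteq> verts G" "\<And>x. x \<in> S \<Longrightarrow> N x \<subseteq> S"
  shows "verts G = S"
proof (rule ccontr)
  obtain s where s: "s \<in> S" using assms(1) by blast
  assume "verts G \<noteq> S"
  then obtain y where y: "y \<in> verts G" "y \<notin> S" using assms(2) by blast
  have "(s, y) \<in> {(s, t). {s, t} \<in> edges G}\<^sup>*"
    using bicyclic s y assms(2) by (auto simp: bicyclic_def connected_graph_def)
  then have "y \<in> S"
    by (induction rule: rtrancl_induct) (use s assms(3) in \<open>auto simp: nbrs_def\<close>)
  with y show False by simp
qed

text \<open>Degree one is excluded by assumption. An isolated vertex would be the whole connected
  graph, which would then have two edges by the bicyclic count and none by the handshake
  identity.\<close>

lemma card_nbrs_ge2:
  assumes x: "x \<in> verts G"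
  shows "card (N x) \<ge> 2"
proof -
  have "card (N x) \<noteq> 1"
    using no_pendant x by (auto simp: pendant_def degree_card_nbrs)
  moreover have "card (N x) \<noteq> 0"
  proof
    assume "card (N x) = 0"
    then have "N x = {}" using finite_nbrs by simp
    then have "verts G = {x}" using verts_closed[of "{x}"] x by simp
    then show False
      using handshake bicyclic \<open>N x = {}\<close> by (simp add: bicyclic_def)
  qed
  ultimately show ?thesis by simp
qed

lemma degree_cases:
  obtains (four) v where "v \<in> verts G" "card (N v) = 4"
      "\<And>x. x \<in> verts G \<Longrightarrow> x \<noteq> v \<Longrightarrow> card (N x) = 2"
  | (three) u v where "u \<in> verts G" "v \<in> verts G" "u \<noteq> v" "card (N u) = 3" "card (N v) = 3"
      "\<And>x. x \<in> verts G \<Longrightarrow> x \<noteq> u \<Longrightarrow> x \<noteq> v \<Longrightarrow> card (N x) = 2"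
proof -
  \<comment> \<open>Truncated subtraction is exact here, all degrees being at least two.\<close>
  define h where "h x = card (N x) - 2" for x
  have h: "card (N x) = h x + 2" if "x \<in> verts G" for x
    using card_nbrs_ge2[OF that] by (simp add: h_def)
  have "(\<Sum>x\<in>verts G. card (N x)) = (\<Sum>x\<in>verts G. h x + 2)"
    by (rule sum.cong[OF refl h])
  then have "(\<Sum>x\<in>verts G. h x) + 2 * card (verts G) = 2 * card (edges G)"
    unfolding handshake sum.distrib by simp
  then have sum: "(\<Sum>x\<in>verts G. h x) = 2"
    using bicyclic by (simp add: bicyclic_def)
  then obtain v where v: "v \<in> verts G" "h v \<noteq> 0"
    by (metis sum.neutral zero_neq_numeral)
  have sum_v: "h v + (\<Sum>x\<in>verts G - {v}. h x) = 2"
    using sum v fin by (simp add: sum.remove)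
  show ?thesis
  proof (cases "(\<Sum>x\<in>verts G - {v}. h x) = 0")
    case True
    then have "\<And>x. x \<in> verts G \<Longrightarrow> x \<noteq> v \<Longrightarrow> h x = 0" using fin by simp
    then show ?thesis using four[of v] sum_v True v h by simp
  next
    case False
    then obtain u where u: "u \<in> verts G - {v}" "h u \<noteq> 0"
      by (metis sum.neutral)
    have "h v + h u + (\<Sum>x\<in>verts G - {v} - {u}. h x) = 2"
      using sum_v u fin by (simp add: sum.remove)
    then have "h v = 1" "h u = 1" "(\<Sum>x\<in>verts G - {v} - {u}. h x) = 0"
      using u v by linarith+
    moreover from this(3) have "\<And>x. x \<in> verts G \<Longrightarrow> x \<noteq> u \<Longrightarrow> x \<noteq> v \<Longrightarrow> h x = 0" using fin by simp
    ultimately show ?thesis using three[of u v] u v h by simp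
  qed
qed

lemma other_nbr:
  assumes "card (N x) = 2" "y \<in> N x"
  obtains z where "z \<noteq> y" "N x = {y, z}"
proof -
  obtain a b where "N x = {a, b}" "a \<noteq> b" using assms(1) by (auto simp: card_2_iff)
  then show ?thesis using assms(2) that[of a] that[of b] by (auto simp: insert_commute)
qed

lemma nbrs_eq2:
  assumes "card (N x) = 2" "y \<in> N x" "z \<in> N x" "y \<noteq> z"
  shows "N x = {y, z}"
  using assms by (auto simp: card_2_iff)

text \<open>Eliminating \<open>r\<close> and \<open>m\<close> alters the weights of the triangle
  only by products containing a weight between \<open>{p, q}\<close> and \<open>{r, m}\<close>, and
  these vanish. Edges from \<open>v\<close> to \<open>r\<close> or \<open>m\<close> may be present,
  which the applications exploit.\<close>

lemma triangle_edge:
  assumes "p \<in> N v" "q \<in> N v" "q \<in> N p" "m \<in> N r"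
    and "r \<notin> N p" "r \<notin> N q" "m \<notin> N p" "m \<notin> N q"
  shows "3 \<le> neg_inertia G"
proof (rule neg_inertia_ge3_triangle_edge[OF fin, of v p q r m])
  have sym: "v \<in> N p" "v \<in> N q" "p \<in> N q" using assms nbrs_sym by metis+
  show "distinct [v, p, q, r, m]" using assms sym nbr_neq by auto
  show "{v, p, q, r, m} \<subseteq> verts G" using assms nbr_verts by blast
  have z: "wt G p r = 0" "wt G p m = 0" "wt G q r = 0" "wt G q m = 0"
    using assms wt_zero by simp_all
  have "wt G r m > 0" "wt G p q > 0" "wt G p v > 0" "wt G q v > 0"
    using assms sym wt_pos by simp_all
  with z show "wt G r m > 0"
    "wt G p r * wt G q m + wt G p m * wt G q r < wt G p q * wt G r m"
    "wt G p r * wt G v m + wt G p m * wt G v r < wt G p v * wt G r m"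
    "wt G q r * wt G v m + wt G q m * wt G v r < wt G q v * wt G r m"
    by simp_all
qed (simp_all add: wt_nonneg)

text \<open>The weight matrix between the \<open>x\<close>s and the \<open>y\<close>s is triangular
  with positive diagonal, whatever the three remaining entries are.\<close>

lemma matching3:
  assumes adj: "x1 \<in> N y1" "x2 \<in> N y2" "x3 \<in> N y3"
    and indep: "y2 \<notin> N y1" "y3 \<notin> N y1" "y3 \<notin> N y2"
    and tri: "x1 \<notin> N y2" "x1 \<notin> N y3" "x2 \<notin> N y3"
  shows "3 \<le> neg_inertia G"
proof (rule neg_inertia_ge3_isotropic[OF fin, of x1 x2 x3 y1 y2 y3])
  have sym: "y1 \<in> N x1" "y2 \<in> N x2" "y3 \<in> N x3" "y1 \<notin> N y2" "y1 \<notin> N y3" "y2 \<notin> N y3"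
    "y2 \<notin> N x1" "y3 \<notin> N x1" "y3 \<notin> N x2"
    using assms nbrs_sym by metis+
  have "wt G x1 y1 > 0" "wt G x2 y2 > 0" "wt G x3 y3 > 0"
    using sym wt_pos by simp_all
  moreover have "wt G x1 y2 = 0" "wt G x1 y3 = 0" "wt G x2 y3 = 0"
    using sym wt_zero by simp_all
  ultimately show "wt G x1 y1 * (wt G x2 y2 * wt G x3 y3 - wt G x2 y3 * wt G x3 y2)
      - wt G x1 y2 * (wt G x2 y1 * wt G x3 y3 - wt G x2 y3 * wt G x3 y1)
      + wt G x1 y3 * (wt G x2 y1 * wt G x3 y2 - wt G x2 y2 * wt G x3 y1) \<noteq> 0"
    by simp
  show "distinct [x1, x2, x3, y1, y2, y3]" using assms sym nbr_neq by auto
  show "{x1, x2, x3, y1, y2, y3} \<subseteq> verts G" using assms nbr_verts by blast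
qed (use indep wt_zero in auto)

end

text \<open>The shape predicates list the complete neighbourhood of every vertex, so they supply the
  absent edges along with the present ones. They speak about vertices of \<open>G\<close> itself,
  which keeps isomorphisms out of both the classification and the inertia computations.\<close>

definition infinity414_at :: "'a wgraph \<Rightarrow> 'a \<Rightarrow> 'a \<Rightarrow> 'a \<Rightarrow> 'a \<Rightarrow> 'a \<Rightarrow> 'a \<Rightarrow> 'a \<Rightarrow> bool" where
  "infinity414_at G v x1 x2 x3 y1 y2 y3 \<longleftrightarrow>
     distinct [v, x1, x2, x3, y1, y2, y3] \<and> verts G = {v, x1, x2, x3, y1, y2, y3} \<and>
     nbrs G v = {x1, x3, y1, y3} \<and> nbrs G x1 = {v, x2} \<and> nbrs G x2 = {x1, x3} \<and> nbrs G x3 = {v, x2} \<and>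
     nbrs G y1 = {v, y2} \<and> nbrs G y2 = {y1, y3} \<and> nbrs G y3 = {v, y2}"

definition theta111_at :: "'a wgraph \<Rightarrow> 'a \<Rightarrow> 'a \<Rightarrow> 'a \<Rightarrow> 'a \<Rightarrow> 'a \<Rightarrow> bool" where
  "theta111_at G u v x y z \<longleftrightarrow>
     distinct [u, v, x, y, z] \<and> verts G = {u, v, x, y, z} \<and>
     nbrs G u = {x, y, z} \<and> nbrs G v = {x, y, z} \<and>
     nbrs G x = {u, v} \<and> nbrs G y = {u, v} \<and> nbrs G z = {u, v}"

definition theta101_at :: "'a wgraph \<Rightarrow> 'a \<Rightarrow> 'a \<Rightarrow> 'a \<Rightarrow> 'a \<Rightarrow> bool" where
  "theta101_at G u v x z \<longleftrightarrow>
     distinct [u, v, x, z] \<and> verts G = {u, v, x, z} \<and>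
     nbrs G u = {v, x, z} \<and> nbrs G v = {u, x, z} \<and> nbrs G x = {u, v} \<and> nbrs G z = {u, v}"

definition theta102_at :: "'a wgraph \<Rightarrow> 'a \<Rightarrow> 'a \<Rightarrow> 'a \<Rightarrow> 'a \<Rightarrow> 'a \<Rightarrow> bool" where
  "theta102_at G u v x z1 z2 \<longleftrightarrow>
     distinct [u, v, x, z1, z2] \<and> verts G = {u, v, x, z1, z2} \<and>
     nbrs G u = {v, x, z1} \<and> nbrs G v = {u, x, z2} \<and>
     nbrs G x = {u, v} \<and> nbrs G z1 = {u, z2} \<and> nbrs G z2 = {v, z1}"

definition theta202_at :: "'a wgraph \<Rightarrow> 'a \<Rightarrow> 'a \<Rightarrow> 'a \<Rightarrow> 'a \<Rightarrow> 'a \<Rightarrow> 'a \<Rightarrow> bool" where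
  "theta202_at G u v x1 x2 z1 z2 \<longleftrightarrow>
     distinct [u, v, x1, x2, z1, z2] \<and> verts G = {u, v, x1, x2, z1, z2} \<and>
     nbrs G u = {v, x1, z1} \<and> nbrs G v = {u, x2, z2} \<and>
     nbrs G x1 = {u, x2} \<and> nbrs G x2 = {v, x1} \<and> nbrs G z1 = {u, z2} \<and> nbrs G z2 = {v, z1}"

definition theta112_at :: "'a wgraph \<Rightarrow> 'a \<Rightarrow> 'a \<Rightarrow> 'a \<Rightarrow> 'a \<Rightarrow> 'a \<Rightarrow> 'a \<Rightarrow> bool" where
  "theta112_at G u v x y z1 z2 \<longleftrightarrow>
     distinct [u, v, x, y, z1, z2] \<and> verts G = {u, v, x, y, z1, z2} \<and>
     nbrs G u = {x, y, z1} \<and> nbrs G v = {x, y, z2} \<and>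
     nbrs G x = {u, v} \<and> nbrs G y = {u, v} \<and> nbrs G z1 = {u, z2} \<and> nbrs G z2 = {v, z1}"

section \<open>Shapes around a vertex of degree four\<close>

context bicyclic_core
begin

text \<open>Once the neighbours of \<open>v\<close> are paired by their further neighbours
  \<open>m\<close> and \<open>k\<close>, degree two completes the graph: \<open>N m = {p, q}\<close>
  and \<open>N k = {r, s}\<close>, which separates \<open>m\<close> and \<open>k\<close> from each
  other and from the neighbours of \<open>v\<close>.\<close>

lemma infinity414_atI:
  assumes v: "N v = {p, q, r, s}" "distinct [p, q, r, s]"
    and deg: "\<And>x. x \<in> verts G \<Longrightarrow> x \<noteq> v \<Longrightarrow> card (N x) = 2"
    and N: "N p = {v, m}" "N q = {v, m}" "N r = {v, k}" "N s = {v, k}"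
    and "m \<noteq> v" "k \<noteq> v"
  shows "infinity414_at G v p m q r k s"
proof -
  have m: "p \<in> N m" "q \<in> N m" and k: "r \<in> N k" "s \<in> N k"
    using N nbrs_sym[of _ G m] nbrs_sym[of _ G k] by simp_all
  have V: "{v, p, m, q, r, k, s} \<subseteq> verts G"
    using m k nbr_verts v by blast
  have Nm: "N m = {p, q}"
    by (rule nbrs_eq2[OF deg m]) (use V assms in auto)
  have Nk: "N k = {r, s}"
    by (rule nbrs_eq2[OF deg k]) (use V assms in auto)
  have vN: "v \<notin> {p, q, r, s}" using v(1) nbr_irrefl[of v] by simp
  have "m \<notin> {p, q, r, s}" using Nm N vN nbr_irrefl[of m] by (auto simp: doubleton_eq_iff)
  moreover have "k \<notin> {p, q, r, s}" using Nk N vN nbr_irrefl[of k] by (auto simp: doubleton_eq_iff)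
  moreover have "m \<noteq> k" using Nm Nk v(2) by (auto simp: doubleton_eq_iff)
  moreover have "verts G = {v, p, m, q, r, k, s}"
    by (rule verts_closed) (use V v N Nm Nk in auto)
  ultimately show ?thesis using assms vN Nm Nk by (auto simp: infinity414_at_def)
qed

text \<open>Each neighbour \<open>n\<close> of \<open>v\<close> has one further neighbour
  \<open>\<rho> n\<close>. Three distinct values of \<open>\<rho>\<close> would give the
  configuration of \<open>matching3\<close>, and a value taken three times would have degree at
  least three. So two values are taken twice each, which are the two 4-cycles.\<close>

lemma classification_degree_four:
  assumes ni: "neg_inertia G < 3"
    and v: "card (N v) = 4" and deg: "\<And>x. x \<in> verts G \<Longrightarrow> x \<noteq> v \<Longrightarrow> card (N x) = 2"
  shows "\<exists>x1 x2 x3 y1 y2 y3. infinity414_at G v x1 x2 x3 y1 y2 y3"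
proof -
  obtain p q r s where Nv: "N v = {p, q, r, s}" and dist: "distinct [p, q, r, s]"
    using v by (rule card_eq_4E)
  have "\<exists>n'. n' \<noteq> v \<and> N n = {v, n'}" if "n \<in> N v" for n
  proof -
    have "v \<in> N n" "n \<noteq> v" using that nbrs_sym nbr_neq by metis+
    then show ?thesis using other_nbr[OF deg[OF nbr_verts(2)[OF that]]] by metis
  qed
  then obtain \<rho> where \<rho>: "\<And>n. n \<in> N v \<Longrightarrow> \<rho> n \<noteq> v" "\<And>n. n \<in> N v \<Longrightarrow> N n = {v, \<rho> n}" by metis
  have indep: "b \<notin> N a" if ab: "a \<in> N v" "b \<in> N v" for a b
  proof
    assume adj: "b \<in> N a"
    then have "a \<noteq> b" using nbr_neq by blast
    have "card {a, b} \<le> 2" by (simp add: card_insert_if)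
    then have "\<not> N v \<subseteq> {a, b}" using card_mono[of "{a, b}" "N v"] v by auto
    then obtain c where c: "c \<in> N v" "c \<noteq> a" "c \<noteq> b" by blast
    have Na: "N a = {v, b}" using \<rho>(2)[OF ab(1)] adj ab(2) nbr_neq by auto
    have Nb: "N b = {v, a}" using \<rho>(2)[OF ab(2)] adj ab(1) nbrs_sym[of a G b] nbr_neq by auto
    have "c \<notin> N a" "c \<notin> N b" using c Na Nb nbr_neq by auto
    moreover have "\<rho> c \<noteq> a" "\<rho> c \<noteq> b"
      using calculation \<rho>(2)[OF c(1)] nbrs_sym by (metis insertCI)+
    ultimately have "3 \<le> neg_inertia G"
      using triangle_edge[of a v b "\<rho> c" c] ab adj \<rho>[OF c(1)] Na Nb by auto
    with ni show False by simp
  qed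
  have no3: "False" if "a \<in> N v" "b \<in> N v" "c \<in> N v" "\<rho> a \<noteq> \<rho> b" "\<rho> a \<noteq> \<rho> c" "\<rho> b \<noteq> \<rho> c" for a b c
  proof -
    have "3 \<le> neg_inertia G"
      using matching3[of "\<rho> a" a "\<rho> b" b "\<rho> c" c] that \<rho> indep by simp
    with ni show False by simp
  qed
  have no_triple: "False" if "a \<in> N v" "b \<in> N v" "c \<in> N v" "distinct [a, b, c]" "\<rho> a = \<rho> b" "\<rho> a = \<rho> c" for a b c
  proof -
    have "a \<in> N (\<rho> a)" "b \<in> N (\<rho> a)" "c \<in> N (\<rho> a)"
      using \<rho>(2) that nbrs_sym by (metis insertCI)+
    moreover have "card (N (\<rho> a)) = 2"
      using deg[of "\<rho> a"] \<rho>(1)[OF that(1)] calculation(1) nbr_verts by blast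
    ultimately show False using that(4) by (auto simp: card_2_iff)
  qed
  have mem: "p \<in> N v" "q \<in> N v" "r \<in> N v" "s \<in> N v" using Nv by auto
  consider "\<rho> p = \<rho> q" "\<rho> r = \<rho> s" | "\<rho> p = \<rho> r" "\<rho> q = \<rho> s" | "\<rho> p = \<rho> s" "\<rho> q = \<rho> r"
    using no3[OF mem(1,2,3)] no3[OF mem(1,2,4)] no3[OF mem(1,3,4)] no3[OF mem(2,3,4)]
      no_triple[OF mem(1,2,3)] no_triple[OF mem(1,2,4)] no_triple[OF mem(1,3,4)] no_triple[OF mem(2,3,4)] dist
    by (metis distinct_length_2_or_more distinct_singleton)
  then show ?thesis
  proof cases
    case 1
    then show ?thesis
      using infinity414_atI[OF Nv dist deg, of "\<rho> p" "\<rho> r"] \<rho> mem by metis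
  next
    case 2
    have "infinity414_at G v p (\<rho> p) r q (\<rho> q) s"
      by (rule infinity414_atI) (use 2 Nv dist deg \<rho> mem in auto)
    then show ?thesis by blast
  next
    case 3
    have "infinity414_at G v p (\<rho> p) s q (\<rho> q) r"
      by (rule infinity414_atI) (use 3 Nv dist deg \<rho> mem in auto)
    then show ?thesis by blast
  qed
qed

section \<open>Shapes around two vertices of degree three\<close>

lemma other_nbrs3:
  assumes "card (N x) = 3" "y \<in> N x"
  obtains a b where "N x = {y, a, b}" "distinct [y, a, b]"
proof -
  obtain a b c where "N x = {a, b, c}" "distinct [a, b, c]" using assms(1) by (auto simp: card_3_iff)
  then show ?thesis using assms(2) that[of b c] that[of a c] that[of a b] by (auto simp: insert_commute)
qed

lemma other_nbr3:
  assumes "card (N x) = 3" "y \<in> N x" "z \<in> N x" "y \<noteq> z"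
  obtains a where "N x = {y, z, a}" "distinct [y, z, a]"
proof -
  obtain a b where "N x = {y, a, b}" "distinct [y, a, b]" by (rule other_nbrs3[OF assms(1,2)])
  then show ?thesis using assms(3,4) that[of a] that[of b] by (auto simp: insert_commute)
qed

text \<open>With a common neighbour \<open>x\<close>, the triangle \<open>u v x\<close> forbids an
  edge joined to neither \<open>v\<close> nor \<open>x\<close>, so the third neighbours of
  \<open>u\<close> and \<open>v\<close> coincide or are adjacent. Without a common neighbour, the
  two other neighbours of \<open>u\<close> and those of \<open>v\<close> have to be matched by
  edges, which is \<theta>(2,0,2).\<close>

lemma classification_adjacent:
  assumes ni: "neg_inertia G < 3"
    and u: "card (N u) = 3" and v: "card (N v) = 3" and uv: "v \<in> N u"
    and deg: "\<And>x. x \<in> verts G \<Longrightarrow> x \<noteq> u \<Longrightarrow> x \<noteq> v \<Longrightarrow> card (N x) = 2"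
  shows "(\<exists>x z. theta101_at G u v x z) \<or> (\<exists>x z1 z2. theta102_at G u v x z1 z2) \<or>
    (\<exists>x1 x2 z1 z2. theta202_at G u v x1 x2 z1 z2)"
proof -
  have vu: "u \<in> N v" and neq: "u \<noteq> v" using uv nbrs_sym[of u G v] nbr_neq by auto
  have other: "\<exists>n'. n' \<noteq> w \<and> N n = {w, n'}" if "n \<in> N w" "n \<noteq> u" "n \<noteq> v" for n w
  proof -
    have "w \<in> N n" using that(1) nbrs_sym[of w G n] by simp
    then show ?thesis using other_nbr[OF deg[OF nbr_verts(2)[OF that(1)] that(2,3)]] by metis
  qed
  show ?thesis
  proof (cases "N u \<inter> N v = {}")
    case False
    then obtain x where x: "x \<in> N u" "x \<in> N v" by blast
    have xuv: "x \<noteq> u" "x \<noteq> v" using x nbr_neq by auto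
    have "u \<in> N x" "v \<in> N x" using x nbrs_sym[of _ G x] by auto
    then have Nx: "N x = {u, v}"
      using nbrs_eq2[OF deg] x nbr_verts xuv neq by blast
    obtain q where Nu: "N u = {v, x, q}" "distinct [v, x, q]"
      using other_nbr3[OF u uv x(1)] xuv by metis
    obtain s where Nv: "N v = {u, x, s}" "distinct [u, x, s]"
      using other_nbr3[OF v vu x(2)] xuv by metis
    have qs: "q \<noteq> u" "q \<noteq> v" "s \<noteq> u" "s \<noteq> v"
      using Nu Nv nbr_irrefl[of u] nbr_irrefl[of v] by auto
    obtain q' where q': "q' \<noteq> u" "N q = {u, q'}" using other[of q u] Nu qs by auto
    obtain s' where s': "s' \<noteq> v" "N s = {v, s'}" using other[of s v] Nv qs by auto
    have Vsub: "{u, v, x, q, s} \<subseteq> verts G" using nbrs_subset[of u] nbrs_subset[of v] Nu Nv by auto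
    show ?thesis
    proof (cases "q = s")
      case True
      have Nq: "N q = {u, v}" using q' s' True neq by (auto simp: doubleton_eq_iff)
      have "verts G = {u, v, x, q}"
        by (rule verts_closed) (use Vsub Nu Nv Nx Nq True in auto)
      then have "theta101_at G u v x q"
        using Nu Nv Nx Nq True neq xuv qs by (auto simp: theta101_at_def)
      then show ?thesis by blast
    next
      case False
      show ?thesis
      proof (cases "q' = s")
        case True
        have "q \<in> N s" using q' True nbrs_sym[of q G s] by simp
        then have Ns: "N s = {v, q}" using s' qs by auto
        have "verts G = {u, v, x, q, s}"
          by (rule verts_closed) (use Vsub Nu Nv Nx Ns q' True in auto)
        then have "theta102_at G u v x q s"
          using Nu Nv Nx Ns q' True neq xuv qs False by (auto simp: theta102_at_def)
        then show ?thesis by blast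
      next
        case qs': False
        have "q' \<in> N q" using q' by simp
        then have "q \<in> N q'" using nbrs_sym[of q G q'] by simp
        have "q' \<noteq> v" using \<open>q \<in> N q'\<close> Nv qs False Nu by auto
        moreover have "q' \<noteq> x" using \<open>q \<in> N q'\<close> Nx qs by auto
        \<comment> \<open>The edge \<open>q q'\<close> is attached to the triangle only through
          \<open>u\<close>.\<close>
        ultimately have "3 \<le> neg_inertia G"
          using triangle_edge[OF uv x(1) x(2) \<open>q' \<in> N q\<close>] Nv Nx Nu qs q' qs' False by auto
        with ni show ?thesis by simp
      qed
    qed
  next
    case disj: True
    obtain p q where Nu: "N u = {v, p, q}" "distinct [v, p, q]" by (rule other_nbrs3[OF u uv])
    obtain r s where Nv: "N v = {u, r, s}" "distinct [u, r, s]" by (rule other_nbrs3[OF v vu])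
    have pq: "p \<noteq> u" "p \<noteq> v" "q \<noteq> u" "q \<noteq> v" and rs: "r \<noteq> u" "r \<noteq> v" "s \<noteq> u" "s \<noteq> v"
      using Nu Nv nbr_irrefl[of u] nbr_irrefl[of v] by auto
    have dist: "p \<noteq> q" "r \<noteq> s" "p \<noteq> r" "p \<noteq> s" "q \<noteq> r" "q \<noteq> s"
      using disj Nu Nv by auto
    obtain p' where p': "p' \<noteq> u" "N p = {u, p'}" using other[of p u] Nu pq by auto
    obtain q' where q': "q' \<noteq> u" "N q = {u, q'}" using other[of q u] Nu pq by auto
    obtain r' where r': "r' \<noteq> v" "N r = {v, r'}" using other[of r v] Nv rs by auto
    obtain s' where s': "s' \<noteq> v" "N s = {v, s'}" using other[of s v] Nv rs by auto
    have rev_adj: "p \<in> N p'" "q \<in> N q'" "r \<in> N r'" "s \<in> N s'"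
      using p' q' r' s' nbrs_sym[of p G p'] nbrs_sym[of q G q'] nbrs_sym[of r G r'] nbrs_sym[of s G s'] by auto
    have Vsub: "{u, v, p, q, r, s} \<subseteq> verts G" using nbrs_subset[of u] nbrs_subset[of v] Nu Nv by auto
    have pv': "p' \<noteq> v" "q' \<noteq> v" and ru': "r' \<noteq> u" "s' \<noteq> u"
      using rev_adj Nu Nv pq rs dist by auto
    have pq': "p' \<noteq> q"
    proof
      assume "p' = q"
      then have "N p = {u, q}" "N q = {u, p}" using p' q' rev_adj pq by auto
      then have "3 \<le> neg_inertia G"
        using triangle_edge[of p u q r v] Nu Nv pq rs dist neq by auto
      with ni show False by simp
    qed
    then have qp': "q' \<noteq> p" using rev_adj q' p' pq by auto
    show ?thesis
    proof (cases "p' = q'")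
      case True
      have Np': "N p' = {p, q}"
        using nbrs_eq2[OF deg, of p' p q] rev_adj True p' pv' dist nbr_verts by blast
      \<comment> \<open>Here \<open>u p p' q\<close> is a 4-cycle; the independent vertices
        \<open>r\<close>, \<open>u\<close>, \<open>p'\<close> are matched to \<open>r'\<close>,
        \<open>v\<close>, \<open>p\<close>.\<close>
      have "3 \<le> neg_inertia G"
        by (rule matching3[of r' r v u p p'])
          (use r' ru' uv Nu Nv Np' rev_adj p' q' pq rs dist neq True in auto)
      with ni show ?thesis by simp
    next
      case False
      \<comment> \<open>Otherwise \<open>t\<close>, \<open>p\<close>, \<open>q\<close> are
        independent and matched to \<open>v\<close>, \<open>p'\<close>, \<open>q'\<close>. Applied
        to both \<open>r\<close> and \<open>s\<close>, this closes the graph.\<close>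
      have cover: "t = p' \<or> t = q'" if t: "t \<in> {r, s}" for t
      proof (rule ccontr)
        assume nt: "\<not> (t = p' \<or> t = q')"
        have vt: "v \<in> N t" using t r' s' by auto
        have "p \<notin> N t" "q \<notin> N t"
          using nbrs_sym[of p G t] nbrs_sym[of q G t] nt t p' q' rs by auto
        then have "3 \<le> neg_inertia G"
          by (intro matching3[of v t p' p q' q])
            (use vt p' q' pv' pq' pq neq False in auto)
        with ni show False by simp
      qed
      then consider "r = p'" "s = q'" | "r = q'" "s = p'" using dist by blast
      then show ?thesis
      proof cases
        case 1
        then have Nrs: "N r = {v, p}" "N s = {v, q}" using rev_adj r' s' pq by auto
        have "verts G = {u, v, p, r, q, s}"
          by (rule verts_closed) (use Vsub Nu Nv Nrs p' q' 1 in auto)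
        then have "theta202_at G u v p r q s"
          using Nu Nv Nrs p' q' 1 neq pq rs dist by (auto simp: theta202_at_def)
        then show ?thesis by blast
      next
        case 2
        then have Nrs: "N s = {v, p}" "N r = {v, q}" using rev_adj r' s' pq by auto
        have "verts G = {u, v, p, s, q, r}"
          by (rule verts_closed) (use Vsub Nu Nv Nrs p' q' 2 in auto)
        then have "theta202_at G u v p s q r"
          using Nu Nv Nrs p' q' 2 neq pq rs dist by (auto simp: theta202_at_def)
        then show ?thesis by blast
      qed
    qed
  qed
qed

text \<open>Adjacent neighbours of \<open>u\<close> would form a triangle with \<open>u\<close> away
  from an edge at \<open>v\<close>, and three distinct further neighbours would give a matching. So
  two neighbours share their further neighbour, and \<open>u p m q\<close> is a 4-cycle. By symmetry
  the same is available at \<open>v\<close>.\<close>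

lemma twin_nbrs:
  assumes ni: "neg_inertia G < 3"
    and u: "card (N u) = 3" and v: "card (N v) = 3" and uv: "v \<notin> N u" "u \<noteq> v"
    and deg: "\<And>x. x \<in> verts G \<Longrightarrow> x \<noteq> u \<Longrightarrow> x \<noteq> v \<Longrightarrow> card (N x) = 2"
    and disj: "N u \<inter> N v = {}"
  obtains p q r m where "N u = {p, q, r}" "distinct [p, q, r]" "N p = {u, m}" "N m = {p, q}"
proof -
  have vu: "u \<notin> N v" using uv nbrs_sym[of u G v] by simp
  have "\<exists>n'. n' \<noteq> u \<and> N n = {u, n'}" if n: "n \<in> N u" for n
  proof -
    have "u \<in> N n" "n \<noteq> u" "n \<noteq> v" using n uv nbrs_sym[of u G n] nbr_neq by auto
    then show ?thesis using other_nbr[OF deg[OF nbr_verts(2)[OF n]]] by metis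
  qed
  then obtain \<rho> where \<rho>: "\<And>n. n \<in> N u \<Longrightarrow> \<rho> n \<noteq> u" "\<And>n. n \<in> N u \<Longrightarrow> N n = {u, \<rho> n}" by metis
  obtain s where s: "s \<in> N v" using v by fastforce
  have sN: "s \<notin> N u" "s \<noteq> u" using s disj vu by auto
  have indep: "b \<notin> N a" if ab: "a \<in> N u" "b \<in> N u" for a b
  proof
    assume adj: "b \<in> N a"
    then have adj': "a \<in> N b" using nbrs_sym[of a G b] by simp
    have Na: "N a = {u, b}" using \<rho>(2)[OF ab(1)] adj nbr_neq[OF ab(2)] by auto
    have Nb: "N b = {u, a}" using \<rho>(2)[OF ab(2)] adj' nbr_neq[OF ab(1)] by auto
    have "3 \<le> neg_inertia G"
      by (rule triangle_edge[OF ab adj s]) (use Na Nb ab sN uv in auto)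
    with ni show False by simp
  qed
  obtain p q r where Nu: "N u = {p, q, r}" "distinct [p, q, r]"
    using u by (auto simp: card_3_iff)
  have "\<rho> p = \<rho> q \<or> \<rho> p = \<rho> r \<or> \<rho> q = \<rho> r"
  proof (rule ccontr)
    assume neq: "\<not> ?thesis"
    have "p \<in> N u" "q \<in> N u" "r \<in> N u" using Nu by auto
    note mem = this
    have "3 \<le> neg_inertia G"
      by (rule matching3[of "\<rho> p" p "\<rho> q" q "\<rho> r" r]) (use neq mem \<rho> indep in auto)
    with ni show False by simp
  qed
  then consider "\<rho> p = \<rho> q" | "\<rho> p = \<rho> r" | "\<rho> q = \<rho> r" by blast
  moreover have twin: "\<exists>m. N a = {u, m} \<and> N m = {a, b}"
    if ab: "a \<in> N u" "b \<in> N u" "a \<noteq> b" "\<rho> a = \<rho> b" for a b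
  proof -
    have "a \<in> N (\<rho> a)" "b \<in> N (\<rho> a)"
      using \<rho>(2)[OF ab(1)] \<rho>(2)[OF ab(2)] ab(4) nbrs_sym[of _ G "\<rho> a"] by auto
    moreover have "\<rho> a \<noteq> v" using calculation ab disj by auto
    ultimately have "N (\<rho> a) = {a, b}"
      using nbrs_eq2[OF deg] \<rho>(1)[OF ab(1)] ab(3) nbr_verts by blast
    then show ?thesis using \<rho>(2)[OF ab(1)] by blast
  qed
  ultimately show ?thesis
  proof cases
    case 1
    then obtain m where "N p = {u, m}" "N m = {p, q}" using twin[of p q] Nu by auto
    then show ?thesis using that[of p q r m] Nu by simp
  next
    case 2
    then obtain m where "N p = {u, m}" "N m = {p, r}" using twin[of p r] Nu by auto
    then show ?thesis using that[of p r q m] Nu by (auto simp: insert_commute)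
  next
    case 3
    then obtain m where "N q = {u, m}" "N m = {q, r}" using twin[of q r] Nu by auto
    then show ?thesis using that[of q r p m] Nu by (auto simp: insert_commute)
  qed
qed

text \<open>The number of common neighbours of \<open>u\<close> and \<open>v\<close> decides. With
  none or one, a forbidden configuration always occurs; with three the graph is \<theta>(1,1,1), and
  with two the remaining branch must have exactly two inner vertices.\<close>

lemma classification_nonadjacent:
  assumes ni: "neg_inertia G < 3"
    and u: "card (N u) = 3" and v: "card (N v) = 3" and uv: "v \<notin> N u" "u \<noteq> v"
    and deg: "\<And>x. x \<in> verts G \<Longrightarrow> x \<noteq> u \<Longrightarrow> x \<noteq> v \<Longrightarrow> card (N x) = 2"
  shows "(\<exists>x y z. theta111_at G u v x y z) \<or> (\<exists>x y z1 z2. theta112_at G u v x y z1 z2)"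
proof -
  have vu: "u \<notin> N v" using uv nbrs_sym[of u G v] by simp
  have uV: "u \<in> verts G" "v \<in> verts G"
  proof -
    have "N u \<noteq> {}" "N v \<noteq> {}" using u v by auto
    then show "u \<in> verts G" "v \<in> verts G" using nbr_verts(1) by blast+
  qed
  have other: "\<exists>n'. n' \<noteq> w \<and> N n = {w, n'}" if "n \<in> N w" "w = u \<or> w = v" for n w
  proof -
    have "w \<in> N n" "n \<noteq> u" "n \<noteq> v" using that uv vu nbr_irrefl nbrs_sym[of w G n] by auto
    then show ?thesis using other_nbr[OF deg[OF nbr_verts(2)[OF that(1)]]] by metis
  qed
  have common: "N x = {u, v}" if "x \<in> N u" "x \<in> N v" for x
  proof -
    have "u \<in> N x" "v \<in> N x" "x \<noteq> u" "x \<noteq> v"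
      using that uv vu nbrs_sym[of _ G x] by auto
    then show ?thesis using nbrs_eq2[OF deg] nbr_verts uv(2) by blast
  qed
  show ?thesis
  proof (cases "N u \<inter> N v = {}")
    case True
    obtain p q r m where 1: "N u = {p, q, r}" "distinct [p, q, r]" "N p = {u, m}" "N m = {p, q}"
      by (rule twin_nbrs[OF ni u v uv deg True])
    have disj': "N v \<inter> N u = {}" and deg': "\<And>x. x \<in> verts G \<Longrightarrow> x \<noteq> v \<Longrightarrow> x \<noteq> u \<Longrightarrow> card (N x) = 2"
      using True deg by auto
    obtain s t w k where 2: "N v = {s, t, w}" "distinct [s, t, w]" "N s = {v, k}" "N k = {s, t}"
      by (rule twin_nbrs[OF ni v u vu uv(2)[symmetric] deg' disj'])
    have pq: "p \<noteq> u" "q \<noteq> u" "r \<noteq> u" "s \<noteq> v" "t \<noteq> v" "p \<noteq> v" "q \<noteq> v" "s \<noteq> u" "t \<noteq> u"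
      using 1 2 nbr_irrefl[of u] nbr_irrefl[of v] uv vu by auto
    have neq: "p \<noteq> s" "q \<noteq> s" "r \<noteq> s" "r \<noteq> t" "p \<noteq> t" using True 1 2 by auto
    have mk: "m \<noteq> k" "m \<noteq> v" "m \<noteq> u" using 1 2 neq True pq by (auto simp: doubleton_eq_iff)
    have mk': "s \<noteq> m" "r \<noteq> m" "r \<noteq> k"
    proof -
      show "s \<noteq> m" using 1 2 pq by (auto simp: doubleton_eq_iff)
      have "u \<in> N r" using 1 nbrs_sym[of u G r] by simp
      then show "r \<noteq> m" "r \<noteq> k" using 1 2 pq by auto
    qed
    have rm: "m \<notin> N r" "k \<notin> N r" 
      using 1 2 neq nbrs_sym[of m G r] nbrs_sym[of k G r] by auto
    \<comment> \<open>There are 4-cycles at both ends; the independent vertices \<open>p\<close>,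
      \<open>s\<close>, \<open>r\<close> are matched to \<open>m\<close>, \<open>k\<close>,
      \<open>u\<close>.\<close>
    have "3 \<le> neg_inertia G"
      by (rule matching3[of m p k s u r])
        (use 1 2 pq neq mk mk' rm uv nbrs_sym[of u G r] in auto)
    with ni show ?thesis by simp
  next
    case False
    then obtain x where x: "x \<in> N u" "x \<in> N v" by blast
    note Nx = common[OF x]
    have xuv: "x \<noteq> u" "x \<noteq> v" using x nbr_neq by auto
    show ?thesis
    proof (cases "\<exists>y. y \<noteq> x \<and> y \<in> N u \<and> y \<in> N v")
      case True
      then obtain y where y: "y \<noteq> x" "y \<in> N u" "y \<in> N v" by blast
      note Ny = common[OF y(2,3)]
      obtain r where Nu: "N u = {x, y, r}" "distinct [x, y, r]"
        using other_nbr3[OF u x(1) y(2)] y(1) by metis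
      obtain w where Nv: "N v = {x, y, w}" "distinct [x, y, w]"
        using other_nbr3[OF v x(2) y(3)] y(1) by metis
      have neq: "y \<noteq> u" "y \<noteq> v" "r \<noteq> u" "w \<noteq> v" "r \<noteq> v" "w \<noteq> u"
        using Nu Nv nbr_irrefl[of u] nbr_irrefl[of v] uv vu by auto
      have Vsub: "{u, v, x, y, r, w} \<subseteq> verts G" using uV nbrs_subset[of u] nbrs_subset[of v] Nu Nv by auto
      show ?thesis
      proof (cases "r = w")
        case True
        then have Nr: "N r = {u, v}" using common[of r] Nu Nv by simp
        have "verts G = {u, v, x, y, r}"
          by (rule verts_closed) (use Vsub Nu Nv Nx Ny Nr True in auto)
        then have "theta111_at G u v x y r"
          using Nu Nv Nx Ny Nr True uv xuv neq by (auto simp: theta111_at_def)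
        then show ?thesis by blast
      next
        case rw: False
        obtain r' where r': "r' \<noteq> u" "N r = {u, r'}" using other[of r u] Nu by auto
        obtain w' where w': "w' \<noteq> v" "N w = {v, w'}" using other[of w v] Nv by auto
        have rev_adj: "r \<in> N r'" "w \<in> N w'"
          using r' w' nbrs_sym[of r G r'] nbrs_sym[of w G w'] by auto
        have rv': "r' \<noteq> v" "w' \<noteq> u" using rev_adj Nu Nv rw by auto
        show ?thesis
        proof (cases "r' = w")
          case True
          then have Nw: "N w = {v, r}" using rev_adj w' neq by auto
          have "verts G = {u, v, x, y, r, w}"
            by (rule verts_closed) (use Vsub Nu Nv Nx Ny Nw r' True in auto)
          then have "theta112_at G u v x y r w"
            using Nu Nv Nx Ny Nw r' True uv xuv neq rw by (auto simp: theta112_at_def)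
          then show ?thesis by blast
        next
          case False
          have wr': "w' \<noteq> r" using rev_adj r' w' False neq by auto
          have xrw: "x \<noteq> r'" "x \<noteq> w'" using rev_adj Nx neq by auto
          have "3 \<le> neg_inertia G"
          proof (cases "r' = w'")
            case True
            show ?thesis
            \<comment> \<open>The third branch is \<open>u r r' w v\<close>. The weight matrix is
              not triangular here, but its determinant consists of two terms of the same sign, so it
              is nonzero for all positive weights.\<close>
            proof (rule neg_inertia_ge3_isotropic[OF fin, of u v r' x r w])
              have V: "r' \<in> verts G" using rev_adj(1) nbr_verts by blast
              have "r' \<notin> {x, r, w, u, v}"
                using rev_adj r' w' True rv' Nx False neq nbr_irrefl[of r'] xuv rw Nu Nv by auto
              then show "distinct [u, v, r', x, r, w]"
                using uv xuv neq Nu Nv rw by auto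
              show "{u, v, r', x, r, w} \<subseteq> verts G" using V Vsub by simp
              have "wt G u x > 0" "wt G u r > 0" "wt G v x > 0" "wt G v w > 0" "wt G r' r > 0" "wt G r' w > 0"
                using wt_pos Nu Nv rev_adj True by simp_all
              then have pos: "wt G u x * wt G v w * wt G r' r > 0" "wt G u r * wt G v x * wt G r' w > 0"
                by simp_all
              have "wt G u w = 0" "wt G v r = 0" "wt G r' x = 0"
                using wt_zero[of w u] wt_zero[of r v] wt_zero[of r' x] wt_commute[of G r' x] Nu Nv Nx rw r' rv' by auto
              then have "wt G u x * (wt G v r * wt G r' w - wt G v w * wt G r' r)
                - wt G u r * (wt G v x * wt G r' w - wt G v w * wt G r' x)
                + wt G u w * (wt G v x * wt G r' r - wt G v r * wt G r' x)
                = - (wt G u x * wt G v w * wt G r' r) - wt G u r * wt G v x * wt G r' w"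
                by simp
              with pos show "wt G u x * (wt G v r * wt G r' w - wt G v w * wt G r' r)
                - wt G u r * (wt G v x * wt G r' w - wt G v w * wt G r' x)
                + wt G u w * (wt G v x * wt G r' r - wt G v r * wt G r' x) \<noteq> 0"
                by linarith
              have "r \<notin> N x" "w \<notin> N x" "w \<notin> N r" using Nx r' neq False by auto
              then show "wt G x r = 0" "wt G x w = 0" "wt G r w = 0" by (simp_all add: wt_zero)
            qed simp_all
          next
            case False2: False
            show ?thesis
              by (rule matching3[of r' r w' w u x])
                (simp_all add: r' w' rv' Nx neq xuv xrw wr' False False[symmetric] False2 False2[symmetric])
          qed
          with ni show ?thesis by simp
        qed
      qed
    next
      case only: False
      obtain q r where Nu: "N u = {x, q, r}" "distinct [x, q, r]" by (rule other_nbrs3[OF u x(1)])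
      obtain t w where Nv: "N v = {x, t, w}" "distinct [x, t, w]" by (rule other_nbrs3[OF v x(2)])
      have neq: "q \<noteq> u" "q \<noteq> v" "r \<noteq> u" "r \<noteq> v" "t \<noteq> u" "t \<noteq> v"
        using Nu Nv nbr_irrefl[of u] nbr_irrefl[of v] uv vu by auto
      have dist: "q \<noteq> t" "q \<noteq> w" "r \<noteq> t" "r \<noteq> w" using only Nu Nv by auto
      obtain q' where q': "q' \<noteq> u" "N q = {u, q'}" using other[of q u] Nu by auto
      obtain r' where r': "r' \<noteq> u" "N r = {u, r'}" using other[of r u] Nu by auto
      have rev_adj: "q \<in> N q'" "r \<in> N r'"
        using q' r' nbrs_sym[of q G q'] nbrs_sym[of r G r'] by auto
      have qv': "q' \<noteq> v" "r' \<noteq> v" using rev_adj Nv Nu dist by auto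
      have qr': "q' \<noteq> r"
      proof
        assume "q' = r"
        then have Nqr: "N q = {u, r}" "N r = {u, q}" using q' r' rev_adj neq by auto
        have "3 \<le> neg_inertia G"
          by (rule triangle_edge[of q u r x v]) (use Nqr Nu Nv neq xuv uv in auto)
        with ni show False by simp
      qed
      have qx': "q' \<noteq> x" "r' \<noteq> x" using rev_adj Nx neq by auto
      have "3 \<le> neg_inertia G"
      proof (cases "q' = r'")
        case True
        have Nm: "N q' = {q, r}"
          using nbrs_eq2[OF deg, of q' q r] rev_adj True q' qv' Nu nbr_verts by fastforce
        show ?thesis
        \<comment> \<open>With the 4-cycle \<open>u q q' r\<close>, the independent vertices are
          \<open>v\<close>, \<open>u\<close>, \<open>q'\<close>, matched to \<open>t\<close>,
          \<open>x\<close>, \<open>q\<close>.\<close>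
        proof (rule matching3[of t v x u q q'])
          show "q' \<notin> N v" "q' \<notin> N u"
            using nbrs_sym[of q' G v] nbrs_sym[of q' G u] Nm neq by auto
          show "t \<notin> N u" using Nu Nv dist by auto
        qed (use Nu Nv Nm neq dist uv vu nbrs_sym[of v G t] in auto)
      next
        case False
        show ?thesis
          by (rule matching3[of q' q r' r u x])
            (use q' r' qv' qr' qx' Nx neq False xuv in simp_all)
      qed
      with ni show ?thesis by simp
    qed
  qed
qed

text \<open>Only the bound \<open>neg_inertia G < 3\<close> enters, so the outcome is a list of
  shapes; the conditions on the weights are decided afterwards, shape by shape.\<close>

theorem classification:
  assumes "neg_inertia G < 3"
  obtains (infinity414) v x1 x2 x3 y1 y2 y3 where "infinity414_at G v x1 x2 x3 y1 y2 y3"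
  | (theta111) u v x y z where "theta111_at G u v x y z"
  | (theta101) u v x z where "theta101_at G u v x z"
  | (theta102) u v x z1 z2 where "theta102_at G u v x z1 z2"
  | (theta202) u v x1 x2 z1 z2 where "theta202_at G u v x1 x2 z1 z2"
  | (theta112) u v x y z1 z2 where "theta112_at G u v x y z1 z2"
proof (cases rule: degree_cases)
  case (four v)
  obtain x1 x2 x3 y1 y2 y3 where "infinity414_at G v x1 x2 x3 y1 y2 y3"
    using classification_degree_four[OF assms four(2)] four(3) by metis
  then show ?thesis by (rule infinity414)
next
  case (three u v)
  show ?thesis
  proof (cases "v \<in> N u")
    case True
    have "(\<exists>x z. theta101_at G u v x z) \<or> (\<exists>x z1 z2. theta102_at G u v x z1 z2) \<or>
      (\<exists>x1 x2 z1 z2. theta202_at G u v x1 x2 z1 z2)"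
      by (rule classification_adjacent[OF assms three(4,5) True]) (rule three(6))
    then show ?thesis
      by (elim disjE exE) (erule theta101 theta102 theta202 | assumption)+
  next
    case False
    have "(\<exists>x y z. theta111_at G u v x y z) \<or> (\<exists>x y z1 z2. theta112_at G u v x y z1 z2)"
      by (rule classification_nonadjacent[OF assms three(4,5) False three(3)]) (rule three(6))
    then show ?thesis
      by (elim disjE exE) (erule theta111 theta112 | assumption)+
  qed
qed

end

section \<open>The six families\<close>

context bicyclic_core
begin

lemma qform_nbrs: "qform G f = (\<Sum>x\<in>verts G. f x * (\<Sum>y\<in>N x. wt G x y * f y))"
proof -
  have "(\<Sum>y\<in>verts G. wt G x y * f y) = (\<Sum>y\<in>N x. wt G x y * f y)" for x
    by (rule sum.mono_neutral_right[OF fin nbrs_subset]) (simp add: wt_zero)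
  from this[symmetric] show ?thesis
    by (simp add: qform_def sum_distrib_left mult_ac)
qed

text \<open>Meant for \<open>u\<close> and \<open>v\<close> that together meet every edge: the form
  vanishes when both coordinates are zero.\<close>

lemma neg_inertia_le2_coordinates:
  assumes "u \<in> verts G" "v \<in> verts G"
    and nonneg: "\<And>f. f u = 0 \<Longrightarrow> f v = 0 \<Longrightarrow> qform G f \<ge> 0"
  shows "neg_inertia G \<le> 2"
proof (rule neg_inertia_le2I[OF fin, of "\<lambda>z. if z = u then 1 else 0" "\<lambda>z. if z = v then 1 else 0"])
  fix f :: "'a \<Rightarrow> real"
  have "(\<Sum>z\<in>verts G. (if z = w then 1 else 0) * f z) = f w" if "w \<in> verts G" for w
  proof -
    have "(\<Sum>z\<in>verts G. (if z = w then 1 else 0) * f z) = (\<Sum>z\<in>verts G. if z = w then f z else 0)"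
      by (rule sum.cong) auto
    then show ?thesis using that fin by simp
  qed
  moreover assume "(\<Sum>z\<in>verts G. (if z = u then 1 else 0) * f z) = 0"
    "(\<Sum>z\<in>verts G. (if z = v then 1 else 0) * f z) = 0"
  ultimately show "0 \<le> qform G f" using assms(1,2) by (intro nonneg) auto
qed

text \<open>Among \<open>x1\<close>, \<open>x3\<close>, \<open>y1\<close> the vertex
  \<open>y2\<close> sees only \<open>y1\<close>, so expanding along its row leaves
  \<open>wt G y2 y1\<close> times the 2 by 2 minor of the first cycle.\<close>

lemma infinity414_ge3:
  assumes at: "infinity414_at G v x1 x2 x3 y1 y2 y3"
    and cond: "wt G v x1 * wt G x2 x3 \<noteq> wt G x1 x2 * wt G x3 v"
  shows "3 \<le> neg_inertia G"
proof (rule neg_inertia_ge3_isotropic[OF fin, of v x2 y2 x1 x3 y1])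
  note at' = at[unfolded infinity414_at_def]
  have "wt G y2 y1 > 0" using at' by (intro wt_pos) simp
  moreover have "wt G x2 y1 = 0" "wt G y2 x1 = 0" "wt G y2 x3 = 0"
    using at' by (auto intro!: wt_zero)
  ultimately show "wt G v x1 * (wt G x2 x3 * wt G y2 y1 - wt G x2 y1 * wt G y2 x3)
    - wt G v x3 * (wt G x2 x1 * wt G y2 y1 - wt G x2 y1 * wt G y2 x1)
    + wt G v y1 * (wt G x2 x1 * wt G y2 x3 - wt G x2 x3 * wt G y2 x1) \<noteq> 0"
    using cond by (simp add: wt_commute[of G x2 x1] wt_commute[of G v x3] mult.commute)
qed (use at[unfolded infinity414_at_def] in \<open>auto intro!: wt_zero\<close>)

lemma infinity414_swap:
  "infinity414_at G v x1 x2 x3 y1 y2 y3 \<Longrightarrow> infinity414_at G v y1 y2 y3 x1 x2 x3"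
  unfolding infinity414_at_def by (auto simp: insert_commute)

lemma neg_inertia_infinity414:
  assumes at: "infinity414_at G v x1 x2 x3 y1 y2 y3"
  shows "neg_inertia G = 2 \<longleftrightarrow> wt G v x1 * wt G x2 x3 = wt G x1 x2 * wt G x3 v \<and>
    wt G v y1 * wt G y2 y3 = wt G y1 y2 * wt G y3 v" (is "_ \<longleftrightarrow> ?C")
proof
  assume "neg_inertia G = 2"
  then show ?C
    using infinity414_ge3[OF at] infinity414_ge3[OF infinity414_swap[OF at]] by linarith
next
  assume C: ?C
  note at' = at[unfolded infinity414_at_def]
  have pos: "wt G x2 x3 > 0" "wt G y2 y3 > 0" "wt G x2 x1 > 0" "wt G y2 y1 > 0"
    using at' by (simp_all add: wt_pos)
  have "2 \<le> neg_inertia G"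
  proof (rule neg_inertia_ge2_isotropic[OF fin, of x2 y2 x1 y1])
    have "wt G x2 y1 = 0" using at' by (auto intro!: wt_zero)
    then show "wt G x2 x1 * wt G y2 y1 \<noteq> wt G x2 y1 * wt G y2 x1" using pos by simp
  qed (use at' in \<open>auto intro!: wt_zero\<close>)
  moreover have "neg_inertia G \<le> 2"
  \<comment> \<open>The forms are the adjacency rows of \<open>x2\<close> and \<open>y2\<close>, and
    balance of the two cycles makes the row of \<open>v\<close> a combination of them. As the graph
    is bipartite with \<open>{v, x2, y2}\<close> as one side, the form is zero on their common
    kernel.\<close>
  proof (rule neg_inertia_le2I[OF fin, of "(\<lambda>_. 0)(x1 := wt G x1 x2, x3 := wt G x2 x3)"
        "(\<lambda>_. 0)(y1 := wt G y1 y2, y3 := wt G y2 y3)"])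
    fix f
    assume "(\<Sum>z\<in>verts G. ((\<lambda>_. 0)(x1 := wt G x1 x2, x3 := wt G x2 x3)) z * f z) = 0"
      "(\<Sum>z\<in>verts G. ((\<lambda>_. 0)(y1 := wt G y1 y2, y3 := wt G y2 y3)) z * f z) = 0"
    then have l: "wt G x1 x2 * f x1 + wt G x2 x3 * f x3 = 0" "wt G y1 y2 * f y1 + wt G y2 y3 * f y3 = 0"
      using at' by auto
    have "wt G x2 x3 * (wt G v x1 * f x1 + wt G x3 v * f x3) = wt G x3 v * (wt G x1 x2 * f x1 + wt G x2 x3 * f x3)"
      using C by (simp add: algebra_simps)
    then have 1: "wt G v x1 * f x1 + wt G x3 v * f x3 = 0" using l pos by simp
    have "wt G y2 y3 * (wt G v y1 * f y1 + wt G y3 v * f y3) = wt G y3 v * (wt G y1 y2 * f y1 + wt G y2 y3 * f y3)"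
      using C by (simp add: algebra_simps)
    then have 2: "wt G v y1 * f y1 + wt G y3 v * f y3 = 0" using l pos by simp
    have "qform G f = 2 * f v * ((wt G v x1 * f x1 + wt G x3 v * f x3) + (wt G v y1 * f y1 + wt G y3 v * f y3))
      + 2 * f x2 * (wt G x1 x2 * f x1 + wt G x2 x3 * f x3) + 2 * f y2 * (wt G y1 y2 * f y1 + wt G y2 y3 * f y3)"
      using at' unfolding qform_nbrs
      by (simp add: wt_commute[of G x1 v] wt_commute[of G v x3] wt_commute[of G y1 v] wt_commute[of G v y3]
          wt_commute[of G x2 x1] wt_commute[of G x3 x2] wt_commute[of G y2 y1] wt_commute[of G y3 y2])
        (simp add: algebra_simps)
    then show "0 \<le> qform G f" unfolding l 1 2 by simp
  qed
  ultimately show "neg_inertia G = 2" by simp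
qed

text \<open>In this complete bipartite graph the negative inertia is the rank of the 2 by 3 weight
  matrix between \<open>{u, v}\<close> and \<open>{x, y, z}\<close>. The rank is one exactly when
  the columns of \<open>y\<close> and \<open>z\<close> are proportional to the nonzero column of
  \<open>x\<close>.\<close>

lemma neg_inertia_theta111:
  assumes at: "theta111_at G u v x y z"
  shows "neg_inertia G = 2 \<longleftrightarrow> wt G x v * wt G u y \<noteq> wt G u x * wt G y v \<or>
    wt G x v * wt G u z \<noteq> wt G u x * wt G z v" (is "_ \<longleftrightarrow> ?C")
proof -
  note at' = at[unfolded theta111_at_def]
  note comm = wt_commute[of G x u] wt_commute[of G v x] wt_commute[of G y u] wt_commute[of G v y]
    wt_commute[of G z u] wt_commute[of G v z]
  have q: "qform G f = 2 * f x * (wt G u x * f u + wt G x v * f v) +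
      2 * f y * (wt G u y * f u + wt G y v * f v) + 2 * f z * (wt G u z * f u + wt G z v * f v)" for f
    using at' unfolding qform_nbrs by (simp add: comm) (simp add: algebra_simps)
  have ge: "2 \<le> neg_inertia G" if "wt G x v * wt G u t \<noteq> wt G u x * wt G t v" "t \<in> {y, z}" for t
    by (rule neg_inertia_ge2_isotropic[OF fin, of u v x t])
      (use at' that in \<open>auto simp: comm mult.commute intro!: wt_zero\<close>)
  have le: "neg_inertia G \<le> 2"
    by (rule neg_inertia_le2_coordinates[of u v]) (use at' in \<open>simp_all add: q\<close>)
  have le1: "neg_inertia G \<le> 1" if C: "\<not> ?C"
  proof (rule neg_inertia_le1I[OF fin, of "(\<lambda>_. 0)(u := wt G u x, v := wt G x v)"])
    fix f
    assume "(\<Sum>z\<in>verts G. ((\<lambda>_. 0)(u := wt G u x, v := wt G x v)) z * f z) = 0"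
    then have l: "wt G u x * f u + wt G x v * f v = 0" using at' by auto
    have pos: "wt G u x > 0" using at' by (simp add: wt_pos)
    have "wt G u t * f u + wt G t v * f v = 0" if "wt G x v * wt G u t = wt G u x * wt G t v" for t
    proof -
      have "wt G u x * (wt G u t * f u + wt G t v * f v) = wt G u t * (wt G u x * f u + wt G x v * f v)"
        using that by (simp add: algebra_simps)
      then show ?thesis using l pos by simp
    qed
    then show "0 \<le> qform G f" using C l by (simp add: q)
  qed
  show ?thesis using ge[of y] ge[of z] le le1 by fastforce
qed

text \<open>The triangle \<open>u v x\<close> provides two negative directions, and every edge meets
  \<open>u\<close> or \<open>v\<close>; both facts hold for all positive weights.\<close>

lemma neg_inertia_theta101:
  assumes at: "theta101_at G u v x z"
  shows "neg_inertia G = 2"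
proof -
  note at' = at[unfolded theta101_at_def]
  have "2 \<le> neg_inertia G"
    by (rule neg_inertia_ge2_triangle[OF fin, of u v x]) (use at' in \<open>auto intro!: wt_pos\<close>)
  moreover have "neg_inertia G \<le> 2"
    by (rule neg_inertia_le2_coordinates[of u v]) (use at' in \<open>simp_all add: qform_nbrs\<close>)
  ultimately show ?thesis by simp
qed

text \<open>After splitting off a hyperbolic pair, both \<open>\<theta>(1,0,2)\<close> and \<open>\<theta>(1,1,2)\<close> reduce to a
  triangle whose edge \<open>uv\<close> has the weight \<open>-k \<le> 0\<close>.\<close>

lemma signed_triangle_nonneg:
  fixes a1 a2 k \<alpha> c w u v :: real
  assumes "a1 > 0" "a2 > 0" "c > 0" "k \<ge> 0" and w: "2 * a1 * a2 * w = k * (a1 * u + a2 * v)"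
  shows "2 * \<alpha>\<^sup>2 / c + 2 * w * (a1 * u + a2 * v) - 2 * k * u * v \<ge> 0"
proof -
  \<comment> \<open>This value makes \<open>2 * w * (a1 * u + a2 * v)\<close> equal to
    \<open>k * (a1 * u + a2 * v)^2 / (a1 * a2)\<close>, whose mixed term cancels
    \<open>2 * k * u * v\<close>.\<close>
  have w': "w = k * (a1 * u + a2 * v) / (2 * a1 * a2)" using w assms(1,2) by (simp add: field_simps)
  have "2 * w * (a1 * u + a2 * v) - 2 * k * u * v = k * ((a1 * u)\<^sup>2 + (a2 * v)\<^sup>2) / (a1 * a2)"
    unfolding w' using assms(1,2) by (simp add: field_simps power2_eq_square)
  also have "\<dots> \<ge> 0" using assms by simp
  finally show ?thesis using assms(3) by (simp add: add.assoc add_nonneg_nonneg flip: add_diff_eq)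
qed

lemma neg_inertia_theta102:
  assumes at: "theta102_at G u v x z1 z2"
  shows "neg_inertia G = 2 \<longleftrightarrow> wt G u v * wt G z1 z2 \<le> wt G u z1 * wt G z2 v" (is "_ \<longleftrightarrow> ?C")
proof -
  note at' = at[unfolded theta102_at_def]
  note comm = wt_commute[of G x u] wt_commute[of G v x] wt_commute[of G v u] wt_commute[of G z1 u]
    wt_commute[of G z2 z1] wt_commute[of G v z2]
  have pos: "wt G u x > 0" "wt G x v > 0" "wt G z1 z2 > 0" "wt G v x > 0" "wt G z2 z1 > 0" "wt G v u > 0"
    "wt G u v > 0"
    using at' by (simp_all add: wt_pos)
  have zero: "wt G v z1 = 0" "wt G u z2 = 0" "wt G x z1 = 0" "wt G x z2 = 0"
    using at' by (auto intro!: wt_zero)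
  have ge2: "2 \<le> neg_inertia G"
    by (rule neg_inertia_ge2_isotropic[OF fin, of v z2 x z1])
      (use at' pos zero in \<open>auto intro!: wt_zero\<close>)
  \<comment> \<open>If the condition fails, the weight of \<open>uv\<close> stays positive after the
    elimination of \<open>z1 z2\<close>, and so does the whole triangle.\<close>
  have ge3: "3 \<le> neg_inertia G" if "\<not> ?C"
    by (rule neg_inertia_ge3_triangle_edge[OF fin, of x u v z1 z2])
      (use at' pos zero that wt_nonneg in \<open>auto simp: comm\<close>)
  have "neg_inertia G \<le> 2" if C: ?C
  proof -
    \<comment> \<open>The weight of \<open>uv\<close> left after eliminating \<open>z1 z2\<close> is
      \<open>- k\<close>.\<close>
    define k where "k = wt G u z1 * wt G z2 v / wt G z1 z2 - wt G u v"
    have k: "k \<ge> 0" using C pos by (simp add: k_def field_simps)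
    show ?thesis
    \<comment> \<open>The first form equates the two factors of the hyperbolic pair, so that their
      product becomes a square. The second is the hypothesis on \<open>w\<close> in
      \<open>signed_triangle_nonneg\<close>, with \<open>w\<close> the value at
      \<open>x\<close>.\<close>
    proof (rule neg_inertia_le2I[OF fin, of
          "(\<lambda>_. 0)(z1 := wt G z1 z2, v := wt G z2 v, z2 := - wt G z1 z2, u := - wt G u z1)"
          "(\<lambda>_. 0)(x := 2 * wt G u x * wt G x v, u := - k * wt G u x, v := - k * wt G x v)"])
      fix f
      assume "(\<Sum>z\<in>verts G. ((\<lambda>_. 0)(z1 := wt G z1 z2, v := wt G z2 v, z2 := - wt G z1 z2, u := - wt G u z1)) z * f z) = 0"
        "(\<Sum>z\<in>verts G. ((\<lambda>_. 0)(x := 2 * wt G u x * wt G x v, u := - k * wt G u x, v := - k * wt G x v)) z * f z) = 0"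
      then have l: "wt G z1 z2 * f z1 + wt G z2 v * f v = wt G z1 z2 * f z2 + wt G u z1 * f u"
        "2 * wt G u x * wt G x v * f x = k * (wt G u x * f u + wt G x v * f v)"
        using at' by (auto simp: algebra_simps)
      have "qform G f = 2 * (wt G z1 z2 * f z1 + wt G z2 v * f v) * (wt G z1 z2 * f z2 + wt G u z1 * f u) / wt G z1 z2
        + 2 * f x * (wt G u x * f u + wt G x v * f v) - 2 * k * f u * f v"
        using at' pos unfolding qform_nbrs k_def by (simp add: comm) (simp add: field_simps)
      also have "\<dots> = 2 * (wt G z1 z2 * f z1 + wt G z2 v * f v)\<^sup>2 / wt G z1 z2
        + 2 * f x * (wt G u x * f u + wt G x v * f v) - 2 * k * f u * f v"
        by (simp add: l(1) power2_eq_square)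
      also have "\<dots> \<ge> 0"
        by (rule signed_triangle_nonneg[OF pos(1,2,3) k l(2)])
      finally show "0 \<le> qform G f" .
    qed
  qed
  with ge2 ge3 show ?thesis by fastforce
qed

text \<open>Among \<open>x\<close>, \<open>y\<close>, \<open>z1\<close> the vertex \<open>z2\<close>
  sees only \<open>z1\<close>, so the determinant against \<open>u\<close>, \<open>v\<close>,
  \<open>z2\<close> reduces to the minor of \<open>x\<close> and \<open>y\<close>. If that vanishes,
  \<open>x\<close> and \<open>y\<close> have proportional rows and act as a single vertex.\<close>

lemma neg_inertia_theta112:
  assumes at: "theta112_at G u v x y z1 z2"
  shows "neg_inertia G = 2 \<longleftrightarrow> wt G u x * wt G y v = wt G x v * wt G u y" (is "_ \<longleftrightarrow> ?C")
proof -
  note at' = at[unfolded theta112_at_def]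
  note comm = wt_commute[of G x u] wt_commute[of G v x] wt_commute[of G y u] wt_commute[of G v y] 
    wt_commute[of G z1 u] wt_commute[of G z2 z1] wt_commute[of G v z2]
  have pos: "wt G u x > 0" "wt G x v > 0" "wt G z1 z2 > 0" "wt G v x > 0" "wt G z2 z1 > 0"
    "wt G u z1 > 0" "wt G z2 v > 0"
    using at' by (simp_all add: wt_pos)
  have zero: "wt G v z1 = 0" "wt G z2 x = 0" "wt G z2 y = 0"
    using at' by (auto intro!: wt_zero)
  have ge2: "2 \<le> neg_inertia G"
    by (rule neg_inertia_ge2_isotropic[OF fin, of v z2 x z1])
      (use at' pos zero in \<open>auto intro!: wt_zero\<close>)
  have ge3: "3 \<le> neg_inertia G" if "\<not> ?C"
    by (rule neg_inertia_ge3_isotropic[OF fin, of u v z2 x y z1])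
      (use at' pos zero that in \<open>auto simp: comm intro!: wt_zero\<close>)
  have "neg_inertia G \<le> 2" if C: ?C
  proof -
    define k where "k = wt G u z1 * wt G z2 v / wt G z1 z2"
    have k: "k \<ge> 0" using pos by (simp add: k_def)
    \<comment> \<open>\<open>h\<close> is the ratio of the rows of \<open>y\<close> and
      \<open>x\<close>; \<open>f x + h * f y\<close> then takes the place that \<open>f x\<close>
      has in the case of \<theta>(1,0,2).\<close>
    define h where "h = wt G u y / wt G u x"
    have h: "wt G u y = h * wt G u x" "wt G y v = h * wt G x v"
      using C pos by (simp_all add: h_def field_simps)
    show ?thesis
    proof (rule neg_inertia_le2I[OF fin, of
          "(\<lambda>_. 0)(z1 := wt G z1 z2, v := wt G z2 v, z2 := - wt G z1 z2, u := - wt G u z1)"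
          "(\<lambda>_. 0)(x := 2 * wt G u x * wt G x v, y := 2 * wt G u x * wt G x v * h,
             u := - k * wt G u x, v := - k * wt G x v)"])
      fix f
      assume "(\<Sum>z\<in>verts G. ((\<lambda>_. 0)(z1 := wt G z1 z2, v := wt G z2 v, z2 := - wt G z1 z2, u := - wt G u z1)) z * f z) = 0"
        "(\<Sum>z\<in>verts G. ((\<lambda>_. 0)(x := 2 * wt G u x * wt G x v, y := 2 * wt G u x * wt G x v * h,
             u := - k * wt G u x, v := - k * wt G x v)) z * f z) = 0"
      then have l: "wt G z1 z2 * f z1 + wt G z2 v * f v = wt G z1 z2 * f z2 + wt G u z1 * f u"
        "2 * wt G u x * wt G x v * (f x + h * f y) = k * (wt G u x * f u + wt G x v * f v)"
        using at' by (auto simp: algebra_simps)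
      have "qform G f = 2 * (wt G z1 z2 * f z1 + wt G z2 v * f v) * (wt G z1 z2 * f z2 + wt G u z1 * f u) / wt G z1 z2
        + 2 * (f x + h * f y) * (wt G u x * f u + wt G x v * f v) - 2 * k * f u * f v"
        using at' pos unfolding qform_nbrs k_def by (simp add: comm h) (simp add: field_simps)
      also have "\<dots> = 2 * (wt G z1 z2 * f z1 + wt G z2 v * f v)\<^sup>2 / wt G z1 z2
        + 2 * (f x + h * f y) * (wt G u x * f u + wt G x v * f v) - 2 * k * f u * f v"
        by (simp add: l(1) power2_eq_square)
      also have "\<dots> \<ge> 0"
        by (rule signed_triangle_nonneg[OF pos(1,2,3) k l(2)])
      finally show "0 \<le> qform G f" .
    qed
  qed
  with ge2 ge3 show ?thesis by fastforce
qed

text \<open>The graph is bipartite with sides \<open>{u, x2, z2}\<close> and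
  \<open>{v, x1, z1}\<close>, and the left side of the condition is the determinant of the 3 by 3
  weight matrix between them.\<close>

lemma neg_inertia_theta202:
  assumes at: "theta202_at G u v x1 x2 z1 z2"
  shows "neg_inertia G = 2 \<longleftrightarrow> wt G x1 x2 * wt G u v * wt G z1 z2
    - wt G u x1 * wt G x2 v * wt G z1 z2 - wt G x1 x2 * wt G u z1 * wt G z2 v = 0" (is "_ \<longleftrightarrow> ?C")
proof -
  note at' = at[unfolded theta202_at_def]
  note comm = wt_commute[of G v u] wt_commute[of G x1 u] wt_commute[of G x2 x1] wt_commute[of G v x2] 
    wt_commute[of G z1 u] wt_commute[of G z2 z1] wt_commute[of G v z2]
  have pos: "wt G x1 x2 > 0" "wt G z1 z2 > 0"
    using at' by (simp_all add: wt_pos)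
  have zero: "wt G x2 z1 = 0" "wt G z2 x1 = 0"
    using at' by (auto intro!: wt_zero)
  have ge2: "2 \<le> neg_inertia G"
    by (rule neg_inertia_ge2_isotropic[OF fin, of x2 z2 x1 z1])
      (use at' pos zero in \<open>auto simp: comm intro!: wt_zero\<close>)
  have ge3: "3 \<le> neg_inertia G" if "\<not> ?C"
    by (rule neg_inertia_ge3_isotropic[OF fin, of u x2 z2 v x1 z1])
      (use at' zero that in \<open>auto simp: comm algebra_simps intro!: wt_zero\<close>)
  have "neg_inertia G \<le> 2" if C: ?C
  \<comment> \<open>The forms are the adjacency rows of \<open>x2\<close> and \<open>z2\<close>; a
    zero determinant makes the row of \<open>u\<close> a combination of them.\<close>
  proof (rule neg_inertia_le2I[OF fin, of "(\<lambda>_. 0)(v := wt G x2 v, x1 := wt G x1 x2)"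
        "(\<lambda>_. 0)(v := wt G z2 v, z1 := wt G z1 z2)"])
    fix f
    assume "(\<Sum>z\<in>verts G. ((\<lambda>_. 0)(v := wt G x2 v, x1 := wt G x1 x2)) z * f z) = 0"
      "(\<Sum>z\<in>verts G. ((\<lambda>_. 0)(v := wt G z2 v, z1 := wt G z1 z2)) z * f z) = 0"
    then have l: "wt G x2 v * f v + wt G x1 x2 * f x1 = 0" "wt G z2 v * f v + wt G z1 z2 * f z1 = 0"
      using at' by auto
    have "wt G x1 x2 * wt G z1 z2 * (wt G u v * f v + wt G u x1 * f x1 + wt G u z1 * f z1)
      = wt G u x1 * wt G z1 z2 * (wt G x2 v * f v + wt G x1 x2 * f x1)
        + wt G u z1 * wt G x1 x2 * (wt G z2 v * f v + wt G z1 z2 * f z1)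
        + (wt G x1 x2 * wt G u v * wt G z1 z2 - wt G u x1 * wt G x2 v * wt G z1 z2
            - wt G x1 x2 * wt G u z1 * wt G z2 v) * f v"
      by (simp add: algebra_simps)
    then have 1: "wt G u v * f v + wt G u x1 * f x1 + wt G u z1 * f z1 = 0"
      unfolding l C using pos by simp
    have "qform G f = 2 * f u * (wt G u v * f v + wt G u x1 * f x1 + wt G u z1 * f z1)
      + 2 * f x2 * (wt G x2 v * f v + wt G x1 x2 * f x1) + 2 * f z2 * (wt G z2 v * f v + wt G z1 z2 * f z1)"
      using at' unfolding qform_nbrs by (simp add: comm) (simp add: algebra_simps)
    then show "0 \<le> qform G f" unfolding l 1 by simp
  qed
  with ge2 ge3 show ?thesis by fastforce
qed

end

section \<open>Isomorphisms with the standard graphs\<close>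

lemma wt_nonzero_iff:
  assumes "weighted_graph G"
  shows "wt G x y \<noteq> 0 \<longleftrightarrow> {x, y} \<in> edges G"
proof -
  have "weight G {x, y} > 0" if "{x, y} \<in> edges G"
    using assms that by (simp add: weighted_graph_def)
  then show ?thesis by (auto simp: wt_def)
qed

text \<open>Edge weights are positive, so \<open>wt\<close> is nonzero exactly on edges and one
  equation covers both clauses of \<open>wgraph_iso\<close>. The map is turned around to start from
  \<open>H\<close>: the vertices of a standard graph have names, and their images become the
  arguments of a shape predicate.\<close>

lemma wgraph_iso_iff_wt:
  assumes "weighted_graph G" "weighted_graph H"
  shows "wgraph_iso G H \<longleftrightarrow> (\<exists>g. inj_on g (verts H) \<and> verts G = g ` verts H \<and>
    (\<forall>h\<in>verts H. \<forall>k\<in>verts H. wt G (g h) (g k) = wt H h k))"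
proof -
  have eq: "({x, y} \<in> edges G \<longleftrightarrow> {f x, f y} \<in> edges H) \<and>
      ({x, y} \<in> edges G \<longrightarrow> weight G {x, y} = weight H {f x, f y}) \<longleftrightarrow> wt G x y = wt H (f x) (f y)" for f x y
    using wt_nonzero_iff[OF assms(1), of x y] wt_nonzero_iff[OF assms(2), of "f x" "f y"]
    by (auto simp: wt_def)
  have "wgraph_iso G H \<longleftrightarrow> (\<exists>f. bij_betw f (verts G) (verts H) \<and>
    (\<forall>x\<in>verts G. \<forall>y\<in>verts G. wt G x y = wt H (f x) (f y)))"
    unfolding wgraph_iso_def eq[symmetric] by (simp add: ball_conj_distrib)
  also have "\<dots> \<longleftrightarrow> (\<exists>g. bij_betw g (verts H) (verts G) \<and>
    (\<forall>h\<in>verts H. \<forall>k\<in>verts H. wt G (g h) (g k) = wt H h k))" (is "?L \<longleftrightarrow> ?R")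
  proof
    assume ?L
    then obtain f where f: "bij_betw f (verts G) (verts H)"
      "\<forall>x\<in>verts G. \<forall>y\<in>verts G. wt G x y = wt H (f x) (f y)" by blast
    have "bij_betw (inv_into (verts G) f) (verts H) (verts G)" by (rule bij_betw_inv_into[OF f(1)])
    moreover have "wt G (inv_into (verts G) f h) (inv_into (verts G) f k) = wt H h k"
      if "h \<in> verts H" "k \<in> verts H" for h k
      using f that bij_betwE[OF calculation] by (simp add: bij_betw_inv_into_right)
    ultimately show ?R by blast
  next
    assume ?R
    then obtain g where g: "bij_betw g (verts H) (verts G)"
      "\<forall>h\<in>verts H. \<forall>k\<in>verts H. wt G (g h) (g k) = wt H h k" by blast
    have "bij_betw (inv_into (verts H) g) (verts G) (verts H)" by (rule bij_betw_inv_into[OF g(1)])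
    moreover have "wt G x y = wt H (inv_into (verts H) g x) (inv_into (verts H) g y)"
      if "x \<in> verts G" "y \<in> verts G" for x y
      using g that bij_betwE[OF calculation] by (simp add: bij_betw_inv_into_right flip: g(2))
    ultimately show ?L by blast
  qed
  finally show ?thesis by (simp add: bij_betw_def eq_commute[of "_ ` _"] conj_assoc)
qed

text \<open>Neighbourhoods in \<open>G\<close> are read off the weight table of a standard graph,
  where the set on the right is computed by enumeration.\<close>

lemma nbrs_image:
  assumes "weighted_graph G" "verts G = g ` A"
    and "\<forall>h\<in>A. \<forall>k\<in>A. wt G (g h) (g k) = w h k"
  shows "\<forall>h\<in>A. nbrs G (g h) = g ` {k \<in> A. w h k \<noteq> 0}"
proof
  fix h assume h: "h \<in> A"
  have "nbrs G (g h) = {y \<in> verts G. wt G (g h) y \<noteq> 0}"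
    using assms(1) by (auto simp: nbrs_def wt_nonzero_iff weighted_graph_def)
  also have "\<dots> = g ` {k \<in> A. w h k \<noteq> 0}"
    using assms(2,3) h by auto
  finally show "nbrs G (g h) = g ` {k \<in> A. w h k \<noteq> 0}" .
qed

lemma wt_wgraph_of: "wt (wgraph_of es) x y = (case map_of es {x, y} of None \<Rightarrow> 0 | Some w \<Rightarrow> w)"
proof (cases "map_of es {x, y}")
  case None
  then have "{x, y} \<notin> fst ` set es" by (simp add: map_of_eq_None_iff)
  then show ?thesis using None by (simp add: wt_def wgraph_of_def)
next
  case (Some w)
  from map_of_SomeD[OF this] have "{x, y} \<in> fst ` set es" by (rule rev_image_eqI) simp
  then show ?thesis using Some by (simp add: wt_def wgraph_of_def)
qed

lemma Collect_insert_conj: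
  "{k \<in> insert a A. P k} = (if P a then insert a {k \<in> A. P k} else {k \<in> A. P k})"
  by auto

lemma pos_weights_simps:
  "pos_weights 1 a \<longleftrightarrow> a 1 > 0"
  "pos_weights 2 a \<longleftrightarrow> a 1 > 0 \<and> a 2 > 0"
  "pos_weights 3 a \<longleftrightarrow> a 1 > 0 \<and> a 2 > 0 \<and> a 3 > 0"
  "pos_weights 4 a \<longleftrightarrow> a 1 > 0 \<and> a 2 > 0 \<and> a 3 > 0 \<and> a 4 > 0"
proof -
  have "{1..1} = {1::nat}" "{1..2} = {1, 2::nat}" "{1..3} = {1, 2, 3::nat}" "{1..4} = {1, 2, 3, 4::nat}" by auto
  then show "pos_weights 1 a \<longleftrightarrow> a 1 > 0"
    "pos_weights 2 a \<longleftrightarrow> a 1 > 0 \<and> a 2 > 0"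
    "pos_weights 3 a \<longleftrightarrow> a 1 > 0 \<and> a 2 > 0 \<and> a 3 > 0"
    "pos_weights 4 a \<longleftrightarrow> a 1 > 0 \<and> a 2 > 0 \<and> a 3 > 0 \<and> a 4 > 0"
    by (simp_all add: pos_weights_def)
qed

section \<open>The standard graphs as explicit edge lists\<close>

lemma theta111_eq: "theta 1 1 1 a b c = wgraph_of
  [({U, X 1}, a 1), ({X 1, V}, a 2), ({U, Y 1}, b 1), ({Y 1, V}, b 2), ({U, Z 1}, c 1), ({Z 1, V}, c 2)]"
  by (simp add: theta_def walk_edges_def upt_conv_Cons eval_nat_numeral)

lemma theta101_eq: "theta 1 0 1 a b c = wgraph_of
  [({U, X 1}, a 1), ({X 1, V}, a 2), ({U, V}, b 1), ({U, Z 1}, c 1), ({Z 1, V}, c 2)]"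
  by (simp add: theta_def walk_edges_def upt_conv_Cons eval_nat_numeral)

lemma theta102_eq: "theta 1 0 2 a b c = wgraph_of
  [({U, X 1}, a 1), ({X 1, V}, a 2), ({U, V}, b 1), ({U, Z 1}, c 1), ({Z 1, Z 2}, c 2), ({Z 2, V}, c 3)]"
  by (simp add: theta_def walk_edges_def upt_conv_Cons eval_nat_numeral)

lemma theta202_eq: "theta 2 0 2 a b c = wgraph_of
  [({U, X 1}, a 1), ({X 1, X 2}, a 2), ({X 2, V}, a 3), ({U, V}, b 1),
   ({U, Z 1}, c 1), ({Z 1, Z 2}, c 2), ({Z 2, V}, c 3)]"
  by (simp add: theta_def walk_edges_def upt_conv_Cons eval_nat_numeral)

lemma theta112_eq: "theta 1 1 2 a b c = wgraph_of
  [({U, X 1}, a 1), ({X 1, V}, a 2), ({U, Y 1}, b 1), ({Y 1, V}, b 2),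
   ({U, Z 1}, c 1), ({Z 1, Z 2}, c 2), ({Z 2, V}, c 3)]"
  by (simp add: theta_def walk_edges_def upt_conv_Cons eval_nat_numeral)

lemma infinity414_eq: "infinity414 a b = wgraph_of
  [({V, X 1}, a 1), ({X 1, X 2}, a 2), ({X 2, X 3}, a 3), ({X 3, V}, a 4),
   ({V, Y 1}, b 1), ({Y 1, Y 2}, b 2), ({Y 2, Y 3}, b 3), ({Y 3, V}, b 4)]"
  by (simp add: infinity414_def walk_edges_def upt_conv_Cons eval_nat_numeral)

lemma weighted_wgraph_of:
  assumes "distinct (map fst es)" "\<forall>(e, w)\<in>set es. card e = 2 \<and> w > 0"
  shows "weighted_graph (wgraph_of es)"
  using assms by (force simp: weighted_graph_def wgraph_of_def intro: card_ge_0_finite)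

text \<open>A standard graph is a finite table of weights, so both directions are evaluation: the
  values of an isomorphism are the vertices of the shape, and conversely the shape defines the map.
  The theta graphs follow the same pattern.\<close>

lemma infinity414_iso_iff:
  assumes G: "weighted_graph G" and pos: "pos_weights 4 a" "pos_weights 4 b"
  shows "wgraph_iso G (infinity414 a b) \<longleftrightarrow> (\<exists>v x1 x2 x3 y1 y2 y3. infinity414_at G v x1 x2 x3 y1 y2 y3 \<and>
    wt G v x1 = a 1 \<and> wt G x1 x2 = a 2 \<and> wt G x2 x3 = a 3 \<and> wt G x3 v = a 4 \<and> wt G v y1 = b 1 \<and> wt G y1 y2 = b 2 \<and> wt G y2 y3 = b 3 \<and> wt G y3 v = b 4)"
    (is "wgraph_iso G ?H \<longleftrightarrow> ?R")
proof -
  have V: "verts ?H = {V, X 1, X 2, X 3, Y 1, Y 2, Y 3}"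
    unfolding infinity414_eq wgraph_of_def by auto
  have H: "weighted_graph ?H"
    unfolding infinity414_eq by (rule weighted_wgraph_of)
      (use pos[unfolded pos_weights_simps] in \<open>auto simp: doubleton_eq_iff\<close>)
  note wtH = infinity414_eq wt_wgraph_of
  note pos' = pos[unfolded pos_weights_simps]
  show ?thesis
  proof
    assume "wgraph_iso G ?H"
    then obtain g where g: "inj_on g (verts ?H)" "verts G = g ` verts ?H"
      "\<forall>h\<in>verts ?H. \<forall>k\<in>verts ?H. wt G (g h) (g k) = wt ?H h k"
      unfolding wgraph_iso_iff_wt[OF G H] by blast
    note g' = g(1,2)[unfolded V]
    note nbrs = nbrs_image[OF G g(2,3), unfolded V, unfolded wtH]
    have "infinity414_at G (g V) (g (X 1)) (g (X 2)) (g (X 3)) (g (Y 1)) (g (Y 2)) (g (Y 3))"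
      unfolding infinity414_at_def using g' nbrs pos'
      by (simp add: Collect_insert_conj doubleton_eq_iff) auto
    moreover have "wt G (g V) (g (X 1)) = a 1 \<and>
      wt G (g (X 1)) (g (X 2)) = a 2 \<and>
      wt G (g (X 2)) (g (X 3)) = a 3 \<and>
      wt G (g (X 3)) (g V) = a 4 \<and>
      wt G (g V) (g (Y 1)) = b 1 \<and>
      wt G (g (Y 1)) (g (Y 2)) = b 2 \<and>
      wt G (g (Y 2)) (g (Y 3)) = b 3 \<and>
      wt G (g (Y 3)) (g V) = b 4"
      using g(3)[unfolded V, unfolded wtH] by (simp add: doubleton_eq_iff)
    ultimately show ?R by blast
  next
    assume ?R
    then obtain v x1 x2 x3 y1 y2 y3 where at: "infinity414_at G v x1 x2 x3 y1 y2 y3"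
      and w: "wt G v x1 = a 1" "wt G x1 x2 = a 2" "wt G x2 x3 = a 3" "wt G x3 v = a 4" "wt G v y1 = b 1" "wt G y1 y2 = b 2" "wt G y2 y3 = b 3" "wt G y3 v = b 4"
      by blast
    note at' = at[unfolded infinity414_at_def]
    \<comment> \<open>Vertex indices start at 1, hence the shift; \<open>undefined\<close> stands
      for constructors that do not occur in this graph.\<close>
    define g where "g h = (case h of U \<Rightarrow> undefined | V \<Rightarrow> v | X i \<Rightarrow> [x1, x2, x3] ! (i - 1) | Y i \<Rightarrow> [y1, y2, y3] ! (i - 1) | Z i \<Rightarrow> undefined)" for h
    have g: "g V = v" "g (X 1) = x1" "g (X 2) = x2" "g (X 3) = x3" "g (Y 1) = y1" "g (Y 2) = y2" "g (Y 3) = y3"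
      by (simp_all add: g_def)
    have zero: "t \<notin> nbrs G s \<Longrightarrow> wt G s t = 0" for s t
      by (simp add: nbrs_def wt_def)
    have "\<forall>h\<in>verts ?H. \<forall>k\<in>verts ?H. wt G (g h) (g k) = wt ?H h k"
      unfolding V unfolding wtH using at' by (clarsimp simp: doubleton_eq_iff g w zero wt_commute[of G x1 v] wt_commute[of G x2 x1] wt_commute[of G x3 x2] wt_commute[of G v x3] wt_commute[of G y1 v] wt_commute[of G y2 y1] wt_commute[of G y3 y2] wt_commute[of G v y3] simp del: One_nat_def)
    moreover have "inj_on g (verts ?H)" "verts G = g ` verts ?H"
      using at' unfolding V by (auto simp: g inj_on_def simp del: One_nat_def)
    ultimately show "wgraph_iso G ?H"
      unfolding wgraph_iso_iff_wt[OF G H] by blast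
  qed
qed

lemma theta111_iso_iff:
  assumes G: "weighted_graph G" and pos: "pos_weights 2 a" "pos_weights 2 b" "pos_weights 2 c"
  shows "wgraph_iso G (theta 1 1 1 a b c) \<longleftrightarrow> (\<exists>u v x y z. theta111_at G u v x y z \<and>
    wt G u x = a 1 \<and> wt G x v = a 2 \<and> wt G u y = b 1 \<and> wt G y v = b 2 \<and> wt G u z = c 1 \<and> wt G z v = c 2)"
    (is "wgraph_iso G ?H \<longleftrightarrow> ?R")
proof -
  have V: "verts ?H = {U, V, X 1, Y 1, Z 1}"
    unfolding theta111_eq wgraph_of_def by auto
  have H: "weighted_graph ?H"
    unfolding theta111_eq by (rule weighted_wgraph_of)
      (use pos[unfolded pos_weights_simps] in \<open>auto simp: doubleton_eq_iff\<close>)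
  note wtH = theta111_eq wt_wgraph_of
  note pos' = pos[unfolded pos_weights_simps]
  show ?thesis
  proof
    assume "wgraph_iso G ?H"
    then obtain g where g: "inj_on g (verts ?H)" "verts G = g ` verts ?H"
      "\<forall>h\<in>verts ?H. \<forall>k\<in>verts ?H. wt G (g h) (g k) = wt ?H h k"
      unfolding wgraph_iso_iff_wt[OF G H] by blast
    note g' = g(1,2)[unfolded V]
    note nbrs = nbrs_image[OF G g(2,3), unfolded V, unfolded wtH]
    have "theta111_at G (g U) (g V) (g (X 1)) (g (Y 1)) (g (Z 1))"
      unfolding theta111_at_def using g' nbrs pos'
      by (simp add: Collect_insert_conj doubleton_eq_iff) auto
    moreover have "wt G (g U) (g (X 1)) = a 1 \<and>
      wt G (g (X 1)) (g V) = a 2 \<and>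
      wt G (g U) (g (Y 1)) = b 1 \<and>
      wt G (g (Y 1)) (g V) = b 2 \<and>
      wt G (g U) (g (Z 1)) = c 1 \<and>
      wt G (g (Z 1)) (g V) = c 2"
      using g(3)[unfolded V, unfolded wtH] by (simp add: doubleton_eq_iff)
    ultimately show ?R by blast
  next
    assume ?R
    then obtain u v x y z where at: "theta111_at G u v x y z"
      and w: "wt G u x = a 1" "wt G x v = a 2" "wt G u y = b 1" "wt G y v = b 2" "wt G u z = c 1" "wt G z v = c 2"
      by blast
    note at' = at[unfolded theta111_at_def]
    define g where "g h = (case h of U \<Rightarrow> u | V \<Rightarrow> v | X i \<Rightarrow> [x] ! (i - 1) | Y i \<Rightarrow> [y] ! (i - 1) | Z i \<Rightarrow> [z] ! (i - 1))" for h
    have g: "g U = u" "g V = v" "g (X 1) = x" "g (Y 1) = y" "g (Z 1) = z"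
      by (simp_all add: g_def)
    have zero: "t \<notin> nbrs G s \<Longrightarrow> wt G s t = 0" for s t
      by (simp add: nbrs_def wt_def)
    have "\<forall>h\<in>verts ?H. \<forall>k\<in>verts ?H. wt G (g h) (g k) = wt ?H h k"
      unfolding V unfolding wtH using at' by (clarsimp simp: doubleton_eq_iff g w zero wt_commute[of G x u] wt_commute[of G v x] wt_commute[of G y u] wt_commute[of G v y] wt_commute[of G z u] wt_commute[of G v z] simp del: One_nat_def)
    moreover have "inj_on g (verts ?H)" "verts G = g ` verts ?H"
      using at' unfolding V by (auto simp: g inj_on_def simp del: One_nat_def)
    ultimately show "wgraph_iso G ?H"
      unfolding wgraph_iso_iff_wt[OF G H] by blast
  qed
qed

lemma theta101_iso_iff:
  assumes G: "weighted_graph G" and pos: "pos_weights 2 a" "pos_weights 1 b" "pos_weights 2 c"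
  shows "wgraph_iso G (theta 1 0 1 a b c) \<longleftrightarrow> (\<exists>u v x z. theta101_at G u v x z \<and>
    wt G u x = a 1 \<and> wt G x v = a 2 \<and> wt G u v = b 1 \<and> wt G u z = c 1 \<and> wt G z v = c 2)"
    (is "wgraph_iso G ?H \<longleftrightarrow> ?R")
proof -
  have V: "verts ?H = {U, V, X 1, Z 1}"
    unfolding theta101_eq wgraph_of_def by auto
  have H: "weighted_graph ?H"
    unfolding theta101_eq by (rule weighted_wgraph_of)
      (use pos[unfolded pos_weights_simps] in \<open>auto simp: doubleton_eq_iff\<close>)
  note wtH = theta101_eq wt_wgraph_of
  note pos' = pos[unfolded pos_weights_simps]
  show ?thesis
  proof
    assume "wgraph_iso G ?H"
    then obtain g where g: "inj_on g (verts ?H)" "verts G = g ` verts ?H"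
      "\<forall>h\<in>verts ?H. \<forall>k\<in>verts ?H. wt G (g h) (g k) = wt ?H h k"
      unfolding wgraph_iso_iff_wt[OF G H] by blast
    note g' = g(1,2)[unfolded V]
    note nbrs = nbrs_image[OF G g(2,3), unfolded V, unfolded wtH]
    have "theta101_at G (g U) (g V) (g (X 1)) (g (Z 1))"
      unfolding theta101_at_def using g' nbrs pos'
      by (simp add: Collect_insert_conj doubleton_eq_iff) auto
    moreover have "wt G (g U) (g (X 1)) = a 1 \<and>
      wt G (g (X 1)) (g V) = a 2 \<and>
      wt G (g U) (g V) = b 1 \<and>
      wt G (g U) (g (Z 1)) = c 1 \<and>
      wt G (g (Z 1)) (g V) = c 2"
      using g(3)[unfolded V, unfolded wtH] by (simp add: doubleton_eq_iff)
    ultimately show ?R by blast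
  next
    assume ?R
    then obtain u v x z where at: "theta101_at G u v x z"
      and w: "wt G u x = a 1" "wt G x v = a 2" "wt G u v = b 1" "wt G u z = c 1" "wt G z v = c 2"
      by blast
    note at' = at[unfolded theta101_at_def]
    define g where "g h = (case h of U \<Rightarrow> u | V \<Rightarrow> v | X i \<Rightarrow> [x] ! (i - 1) | Y i \<Rightarrow> undefined | Z i \<Rightarrow> [z] ! (i - 1))" for h
    have g: "g U = u" "g V = v" "g (X 1) = x" "g (Z 1) = z"
      by (simp_all add: g_def)
    have zero: "t \<notin> nbrs G s \<Longrightarrow> wt G s t = 0" for s t
      by (simp add: nbrs_def wt_def)
    have "\<forall>h\<in>verts ?H. \<forall>k\<in>verts ?H. wt G (g h) (g k) = wt ?H h k"
      unfolding V unfolding wtH using at' by (clarsimp simp: doubleton_eq_iff g w zero wt_commute[of G x u] wt_commute[of G v x] wt_commute[of G v u] wt_commute[of G z u] wt_commute[of G v z] simp del: One_nat_def)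
    moreover have "inj_on g (verts ?H)" "verts G = g ` verts ?H"
      using at' unfolding V by (auto simp: g inj_on_def simp del: One_nat_def)
    ultimately show "wgraph_iso G ?H"
      unfolding wgraph_iso_iff_wt[OF G H] by blast
  qed
qed

lemma theta102_iso_iff:
  assumes G: "weighted_graph G" and pos: "pos_weights 2 a" "pos_weights 1 b" "pos_weights 3 c"
  shows "wgraph_iso G (theta 1 0 2 a b c) \<longleftrightarrow> (\<exists>u v x z1 z2. theta102_at G u v x z1 z2 \<and>
    wt G u x = a 1 \<and> wt G x v = a 2 \<and> wt G u v = b 1 \<and> wt G u z1 = c 1 \<and> wt G z1 z2 = c 2 \<and> wt G z2 v = c 3)"
    (is "wgraph_iso G ?H \<longleftrightarrow> ?R")
proof -
  have V: "verts ?H = {U, V, X 1, Z 1, Z 2}"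
    unfolding theta102_eq wgraph_of_def by auto
  have H: "weighted_graph ?H"
    unfolding theta102_eq by (rule weighted_wgraph_of)
      (use pos[unfolded pos_weights_simps] in \<open>auto simp: doubleton_eq_iff\<close>)
  note wtH = theta102_eq wt_wgraph_of
  note pos' = pos[unfolded pos_weights_simps]
  show ?thesis
  proof
    assume "wgraph_iso G ?H"
    then obtain g where g: "inj_on g (verts ?H)" "verts G = g ` verts ?H"
      "\<forall>h\<in>verts ?H. \<forall>k\<in>verts ?H. wt G (g h) (g k) = wt ?H h k"
      unfolding wgraph_iso_iff_wt[OF G H] by blast
    note g' = g(1,2)[unfolded V]
    note nbrs = nbrs_image[OF G g(2,3), unfolded V, unfolded wtH]
    have "theta102_at G (g U) (g V) (g (X 1)) (g (Z 1)) (g (Z 2))"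
      unfolding theta102_at_def using g' nbrs pos'
      by (simp add: Collect_insert_conj doubleton_eq_iff) auto
    moreover have "wt G (g U) (g (X 1)) = a 1 \<and>
      wt G (g (X 1)) (g V) = a 2 \<and>
      wt G (g U) (g V) = b 1 \<and>
      wt G (g U) (g (Z 1)) = c 1 \<and>
      wt G (g (Z 1)) (g (Z 2)) = c 2 \<and>
      wt G (g (Z 2)) (g V) = c 3"
      using g(3)[unfolded V, unfolded wtH] by (simp add: doubleton_eq_iff)
    ultimately show ?R by blast
  next
    assume ?R
    then obtain u v x z1 z2 where at: "theta102_at G u v x z1 z2"
      and w: "wt G u x = a 1" "wt G x v = a 2" "wt G u v = b 1" "wt G u z1 = c 1" "wt G z1 z2 = c 2" "wt G z2 v = c 3"
      by blast
    note at' = at[unfolded theta102_at_def]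
    define g where "g h = (case h of U \<Rightarrow> u | V \<Rightarrow> v | X i \<Rightarrow> [x] ! (i - 1) | Y i \<Rightarrow> undefined | Z i \<Rightarrow> [z1, z2] ! (i - 1))" for h
    have g: "g U = u" "g V = v" "g (X 1) = x" "g (Z 1) = z1" "g (Z 2) = z2"
      by (simp_all add: g_def)
    have zero: "t \<notin> nbrs G s \<Longrightarrow> wt G s t = 0" for s t
      by (simp add: nbrs_def wt_def)
    have "\<forall>h\<in>verts ?H. \<forall>k\<in>verts ?H. wt G (g h) (g k) = wt ?H h k"
      unfolding V unfolding wtH using at' by (clarsimp simp: doubleton_eq_iff g w zero wt_commute[of G x u] wt_commute[of G v x] wt_commute[of G v u] wt_commute[of G z1 u] wt_commute[of G z2 z1] wt_commute[of G v z2] simp del: One_nat_def)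
    moreover have "inj_on g (verts ?H)" "verts G = g ` verts ?H"
      using at' unfolding V by (auto simp: g inj_on_def simp del: One_nat_def)
    ultimately show "wgraph_iso G ?H"
      unfolding wgraph_iso_iff_wt[OF G H] by blast
  qed
qed

lemma theta202_iso_iff:
  assumes G: "weighted_graph G" and pos: "pos_weights 3 a" "pos_weights 1 b" "pos_weights 3 c"
  shows "wgraph_iso G (theta 2 0 2 a b c) \<longleftrightarrow> (\<exists>u v x1 x2 z1 z2. theta202_at G u v x1 x2 z1 z2 \<and>
    wt G u x1 = a 1 \<and> wt G x1 x2 = a 2 \<and> wt G x2 v = a 3 \<and> wt G u v = b 1 \<and> wt G u z1 = c 1 \<and> wt G z1 z2 = c 2 \<and> wt G z2 v = c 3)"
    (is "wgraph_iso G ?H \<longleftrightarrow> ?R")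
proof -
  have V: "verts ?H = {U, V, X 1, X 2, Z 1, Z 2}"
    unfolding theta202_eq wgraph_of_def by auto
  have H: "weighted_graph ?H"
    unfolding theta202_eq by (rule weighted_wgraph_of)
      (use pos[unfolded pos_weights_simps] in \<open>auto simp: doubleton_eq_iff\<close>)
  note wtH = theta202_eq wt_wgraph_of
  note pos' = pos[unfolded pos_weights_simps]
  show ?thesis
  proof
    assume "wgraph_iso G ?H"
    then obtain g where g: "inj_on g (verts ?H)" "verts G = g ` verts ?H"
      "\<forall>h\<in>verts ?H. \<forall>k\<in>verts ?H. wt G (g h) (g k) = wt ?H h k"
      unfolding wgraph_iso_iff_wt[OF G H] by blast
    note g' = g(1,2)[unfolded V]
    note nbrs = nbrs_image[OF G g(2,3), unfolded V, unfolded wtH]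
    have "theta202_at G (g U) (g V) (g (X 1)) (g (X 2)) (g (Z 1)) (g (Z 2))"
      unfolding theta202_at_def using g' nbrs pos'
      by (simp add: Collect_insert_conj doubleton_eq_iff) auto
    moreover have "wt G (g U) (g (X 1)) = a 1 \<and>
      wt G (g (X 1)) (g (X 2)) = a 2 \<and>
      wt G (g (X 2)) (g V) = a 3 \<and>
      wt G (g U) (g V) = b 1 \<and>
      wt G (g U) (g (Z 1)) = c 1 \<and>
      wt G (g (Z 1)) (g (Z 2)) = c 2 \<and>
      wt G (g (Z 2)) (g V) = c 3"
      using g(3)[unfolded V, unfolded wtH] by (simp add: doubleton_eq_iff)
    ultimately show ?R by blast
  next
    assume ?R
    then obtain u v x1 x2 z1 z2 where at: "theta202_at G u v x1 x2 z1 z2"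
      and w: "wt G u x1 = a 1" "wt G x1 x2 = a 2" "wt G x2 v = a 3" "wt G u v = b 1" "wt G u z1 = c 1" "wt G z1 z2 = c 2" "wt G z2 v = c 3"
      by blast
    note at' = at[unfolded theta202_at_def]
    define g where "g h = (case h of U \<Rightarrow> u | V \<Rightarrow> v | X i \<Rightarrow> [x1, x2] ! (i - 1) | Y i \<Rightarrow> undefined | Z i \<Rightarrow> [z1, z2] ! (i - 1))" for h
    have g: "g U = u" "g V = v" "g (X 1) = x1" "g (X 2) = x2" "g (Z 1) = z1" "g (Z 2) = z2"
      by (simp_all add: g_def)
    have zero: "t \<notin> nbrs G s \<Longrightarrow> wt G s t = 0" for s t
      by (simp add: nbrs_def wt_def)
    have "\<forall>h\<in>verts ?H. \<forall>k\<in>verts ?H. wt G (g h) (g k) = wt ?H h k"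
      unfolding V unfolding wtH using at' by (clarsimp simp: doubleton_eq_iff g w zero wt_commute[of G x1 u] wt_commute[of G x2 x1] wt_commute[of G v x2] wt_commute[of G v u] wt_commute[of G z1 u] wt_commute[of G z2 z1] wt_commute[of G v z2] simp del: One_nat_def)
    moreover have "inj_on g (verts ?H)" "verts G = g ` verts ?H"
      using at' unfolding V by (auto simp: g inj_on_def simp del: One_nat_def)
    ultimately show "wgraph_iso G ?H"
      unfolding wgraph_iso_iff_wt[OF G H] by blast
  qed
qed

lemma theta112_iso_iff:
  assumes G: "weighted_graph G" and pos: "pos_weights 2 a" "pos_weights 2 b" "pos_weights 3 c"
  shows "wgraph_iso G (theta 1 1 2 a b c) \<longleftrightarrow> (\<exists>u v x y z1 z2. theta112_at G u v x y z1 z2 \<and>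
    wt G u x = a 1 \<and> wt G x v = a 2 \<and> wt G u y = b 1 \<and> wt G y v = b 2 \<and> wt G u z1 = c 1 \<and> wt G z1 z2 = c 2 \<and> wt G z2 v = c 3)"
    (is "wgraph_iso G ?H \<longleftrightarrow> ?R")
proof -
  have V: "verts ?H = {U, V, X 1, Y 1, Z 1, Z 2}"
    unfolding theta112_eq wgraph_of_def by auto
  have H: "weighted_graph ?H"
    unfolding theta112_eq by (rule weighted_wgraph_of)
      (use pos[unfolded pos_weights_simps] in \<open>auto simp: doubleton_eq_iff\<close>)
  note wtH = theta112_eq wt_wgraph_of
  note pos' = pos[unfolded pos_weights_simps]
  show ?thesis
  proof
    assume "wgraph_iso G ?H"
    then obtain g where g: "inj_on g (verts ?H)" "verts G = g ` verts ?H"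
      "\<forall>h\<in>verts ?H. \<forall>k\<in>verts ?H. wt G (g h) (g k) = wt ?H h k"
      unfolding wgraph_iso_iff_wt[OF G H] by blast
    note g' = g(1,2)[unfolded V]
    note nbrs = nbrs_image[OF G g(2,3), unfolded V, unfolded wtH]
    have "theta112_at G (g U) (g V) (g (X 1)) (g (Y 1)) (g (Z 1)) (g (Z 2))"
      unfolding theta112_at_def using g' nbrs pos'
      by (simp add: Collect_insert_conj doubleton_eq_iff) auto
    moreover have "wt G (g U) (g (X 1)) = a 1 \<and>
      wt G (g (X 1)) (g V) = a 2 \<and>
      wt G (g U) (g (Y 1)) = b 1 \<and>
      wt G (g (Y 1)) (g V) = b 2 \<and>
      wt G (g U) (g (Z 1)) = c 1 \<and>
      wt G (g (Z 1)) (g (Z 2)) = c 2 \<and>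
      wt G (g (Z 2)) (g V) = c 3"
      using g(3)[unfolded V, unfolded wtH] by (simp add: doubleton_eq_iff)
    ultimately show ?R by blast
  next
    assume ?R
    then obtain u v x y z1 z2 where at: "theta112_at G u v x y z1 z2"
      and w: "wt G u x = a 1" "wt G x v = a 2" "wt G u y = b 1" "wt G y v = b 2" "wt G u z1 = c 1" "wt G z1 z2 = c 2" "wt G z2 v = c 3"
      by blast
    note at' = at[unfolded theta112_at_def]
    define g where "g h = (case h of U \<Rightarrow> u | V \<Rightarrow> v | X i \<Rightarrow> [x] ! (i - 1) | Y i \<Rightarrow> [y] ! (i - 1) | Z i \<Rightarrow> [z1, z2] ! (i - 1))" for h
    have g: "g U = u" "g V = v" "g (X 1) = x" "g (Y 1) = y" "g (Z 1) = z1" "g (Z 2) = z2"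
      by (simp_all add: g_def)
    have zero: "t \<notin> nbrs G s \<Longrightarrow> wt G s t = 0" for s t
      by (simp add: nbrs_def wt_def)
    have "\<forall>h\<in>verts ?H. \<forall>k\<in>verts ?H. wt G (g h) (g k) = wt ?H h k"
      unfolding V unfolding wtH using at' by (clarsimp simp: doubleton_eq_iff g w zero wt_commute[of G x u] wt_commute[of G v x] wt_commute[of G y u] wt_commute[of G v y] wt_commute[of G z1 u] wt_commute[of G z2 z1] wt_commute[of G v z2] simp del: One_nat_def)
    moreover have "inj_on g (verts ?H)" "verts G = g ` verts ?H"
      using at' unfolding V by (auto simp: g inj_on_def simp del: One_nat_def)
    ultimately show "wgraph_iso G ?H"
      unfolding wgraph_iso_iff_wt[OF G H] by blast
  qed
qed

section \<open>Conditions on the weights folded into the inertia\<close>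

context bicyclic_core
begin

text \<open>For a graph of this shape the condition on the weights is equivalent to
  \<open>neg_inertia G = 2\<close>. From right to left the weight sequences are read off
  \<open>G\<close> itself.\<close>

lemma infinity414_characterization:
  "(\<exists>a b. pos_weights 4 a \<and> pos_weights 4 b \<and> a 1 * a 3 = a 2 * a 4 \<and> b 1 * b 3 = b 2 * b 4 \<and>
      wgraph_iso G (infinity414 a b)) \<longleftrightarrow>
    (\<exists>v x1 x2 x3 y1 y2 y3. infinity414_at G v x1 x2 x3 y1 y2 y3 \<and> neg_inertia G = 2)" (is "?L \<longleftrightarrow> ?R")
proof
  assume ?L
  then obtain a b where pos: "pos_weights 4 a" "pos_weights 4 b"
    and cond: "a 1 * a 3 = a 2 * a 4 \<and> b 1 * b 3 = b 2 * b 4" and iso: "wgraph_iso G (infinity414 a b)"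
    by blast
  from iso[unfolded infinity414_iso_iff[OF weighted pos]]
  obtain v x1 x2 x3 y1 y2 y3 where at: "infinity414_at G v x1 x2 x3 y1 y2 y3"
    and w: "wt G v x1 = a 1" "wt G x1 x2 = a 2" "wt G x2 x3 = a 3" "wt G x3 v = a 4" "wt G v y1 = b 1" "wt G y1 y2 = b 2" "wt G y2 y3 = b 3" "wt G y3 v = b 4"
    by blast
  have "neg_inertia G = 2"
    using neg_inertia_infinity414[OF at] cond by (simp add: w)
  with at show ?R by blast
next
  assume ?R
  then obtain v x1 x2 x3 y1 y2 y3 where at: "infinity414_at G v x1 x2 x3 y1 y2 y3" and ni: "neg_inertia G = 2"
    by blast
  \<comment> \<open>The leading \<open>0\<close> is a filler, since weights are indexed from
    1.\<close>
  define a where "a = (!) [0, wt G v x1, wt G x1 x2, wt G x2 x3, wt G x3 v]"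
  define b where "b = (!) [0, wt G v y1, wt G y1 y2, wt G y2 y3, wt G y3 v]"
  have w: "wt G v x1 = a 1" "wt G x1 x2 = a 2" "wt G x2 x3 = a 3" "wt G x3 v = a 4" "wt G v y1 = b 1" "wt G y1 y2 = b 2" "wt G y2 y3 = b 3" "wt G y3 v = b 4"
    by (simp_all add: a_def b_def)
  have "wt G s t > 0" if "t \<in> nbrs G s" for s t
    using wt_pos[OF that] .
  then have pos: "pos_weights 4 a" "pos_weights 4 b"
    using at unfolding pos_weights_simps w[symmetric] infinity414_at_def by simp_all
  moreover have "wgraph_iso G (infinity414 a b)"
    unfolding infinity414_iso_iff[OF weighted pos] using at w by blast
  moreover have "a 1 * a 3 = a 2 * a 4 \<and> b 1 * b 3 = b 2 * b 4"
    using neg_inertia_infinity414[OF at] ni by (simp add: w)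
  ultimately show ?L by blast
qed

lemma theta111_characterization:
  "(\<exists>a b c. pos_weights 2 a \<and> pos_weights 2 b \<and> pos_weights 2 c \<and> (a 2 * b 1 \<noteq> a 1 * b 2 \<or> a 2 * c 1 \<noteq> a 1 * c 2) \<and>
      wgraph_iso G (theta 1 1 1 a b c)) \<longleftrightarrow>
    (\<exists>u v x y z. theta111_at G u v x y z \<and> neg_inertia G = 2)" (is "?L \<longleftrightarrow> ?R")
proof
  assume ?L
  then obtain a b c where pos: "pos_weights 2 a" "pos_weights 2 b" "pos_weights 2 c"
    and cond: "(a 2 * b 1 \<noteq> a 1 * b 2 \<or> a 2 * c 1 \<noteq> a 1 * c 2)" and iso: "wgraph_iso G (theta 1 1 1 a b c)"
    by blast
  from iso[unfolded theta111_iso_iff[OF weighted pos]]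
  obtain u v x y z where at: "theta111_at G u v x y z"
    and w: "wt G u x = a 1" "wt G x v = a 2" "wt G u y = b 1" "wt G y v = b 2" "wt G u z = c 1" "wt G z v = c 2"
    by blast
  have "neg_inertia G = 2"
    using neg_inertia_theta111[OF at] cond by (simp add: w)
  with at show ?R by blast
next
  assume ?R
  then obtain u v x y z where at: "theta111_at G u v x y z" and ni: "neg_inertia G = 2"
    by blast
  define a where "a = (!) [0, wt G u x, wt G x v]"
  define b where "b = (!) [0, wt G u y, wt G y v]"
  define c where "c = (!) [0, wt G u z, wt G z v]"
  have w: "wt G u x = a 1" "wt G x v = a 2" "wt G u y = b 1" "wt G y v = b 2" "wt G u z = c 1" "wt G z v = c 2"
    by (simp_all add: a_def b_def c_def)
  have "wt G s t > 0" if "t \<in> nbrs G s" for s t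
    using wt_pos[OF that] .
  then have pos: "pos_weights 2 a" "pos_weights 2 b" "pos_weights 2 c"
    using at unfolding pos_weights_simps w[symmetric] theta111_at_def by simp_all
  moreover have "wgraph_iso G (theta 1 1 1 a b c)"
    unfolding theta111_iso_iff[OF weighted pos] using at w by blast
  moreover have "(a 2 * b 1 \<noteq> a 1 * b 2 \<or> a 2 * c 1 \<noteq> a 1 * c 2)"
    using neg_inertia_theta111[OF at] ni by (simp add: w)
  ultimately show ?L by blast
qed

lemma theta101_characterization:
  "(\<exists>a b c. pos_weights 2 a \<and> pos_weights 1 b \<and> pos_weights 2 c \<and>
      wgraph_iso G (theta 1 0 1 a b c)) \<longleftrightarrow>
    (\<exists>u v x z. theta101_at G u v x z \<and> neg_inertia G = 2)" (is "?L \<longleftrightarrow> ?R")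
proof
  assume ?L
  then obtain a b c where pos: "pos_weights 2 a" "pos_weights 1 b" "pos_weights 2 c"
    and iso: "wgraph_iso G (theta 1 0 1 a b c)"
    by blast
  from iso[unfolded theta101_iso_iff[OF weighted pos]]
  obtain u v x z where at: "theta101_at G u v x z"
    and w: "wt G u x = a 1" "wt G x v = a 2" "wt G u v = b 1" "wt G u z = c 1" "wt G z v = c 2"
    by blast
  have "neg_inertia G = 2"
    using neg_inertia_theta101[OF at] by (simp add: w)
  with at show ?R by blast
next
  assume ?R
  then obtain u v x z where at: "theta101_at G u v x z" and ni: "neg_inertia G = 2"
    by blast
  define a where "a = (!) [0, wt G u x, wt G x v]"
  define b where "b = (!) [0, wt G u v]"
  define c where "c = (!) [0, wt G u z, wt G z v]"
  have w: "wt G u x = a 1" "wt G x v = a 2" "wt G u v = b 1" "wt G u z = c 1" "wt G z v = c 2"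
    by (simp_all add: a_def b_def c_def)
  have "wt G s t > 0" if "t \<in> nbrs G s" for s t
    using wt_pos[OF that] .
  then have pos: "pos_weights 2 a" "pos_weights 1 b" "pos_weights 2 c"
    using at unfolding pos_weights_simps w[symmetric] theta101_at_def by simp_all
  moreover have "wgraph_iso G (theta 1 0 1 a b c)"
    unfolding theta101_iso_iff[OF weighted pos] using at w by blast
  ultimately show ?L by blast
qed

lemma theta102_characterization:
  "(\<exists>a b c. pos_weights 2 a \<and> pos_weights 1 b \<and> pos_weights 3 c \<and> b 1 * c 2 \<le> c 1 * c 3 \<and>
      wgraph_iso G (theta 1 0 2 a b c)) \<longleftrightarrow>
    (\<exists>u v x z1 z2. theta102_at G u v x z1 z2 \<and> neg_inertia G = 2)" (is "?L \<longleftrightarrow> ?R")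
proof
  assume ?L
  then obtain a b c where pos: "pos_weights 2 a" "pos_weights 1 b" "pos_weights 3 c"
    and cond: "b 1 * c 2 \<le> c 1 * c 3" and iso: "wgraph_iso G (theta 1 0 2 a b c)"
    by blast
  from iso[unfolded theta102_iso_iff[OF weighted pos]]
  obtain u v x z1 z2 where at: "theta102_at G u v x z1 z2"
    and w: "wt G u x = a 1" "wt G x v = a 2" "wt G u v = b 1" "wt G u z1 = c 1" "wt G z1 z2 = c 2" "wt G z2 v = c 3"
    by blast
  have "neg_inertia G = 2"
    using neg_inertia_theta102[OF at] cond by (simp add: w)
  with at show ?R by blast
next
  assume ?R
  then obtain u v x z1 z2 where at: "theta102_at G u v x z1 z2" and ni: "neg_inertia G = 2"
    by blast
  define a where "a = (!) [0, wt G u x, wt G x v]"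
  define b where "b = (!) [0, wt G u v]"
  define c where "c = (!) [0, wt G u z1, wt G z1 z2, wt G z2 v]"
  have w: "wt G u x = a 1" "wt G x v = a 2" "wt G u v = b 1" "wt G u z1 = c 1" "wt G z1 z2 = c 2" "wt G z2 v = c 3"
    by (simp_all add: a_def b_def c_def)
  have "wt G s t > 0" if "t \<in> nbrs G s" for s t
    using wt_pos[OF that] .
  then have pos: "pos_weights 2 a" "pos_weights 1 b" "pos_weights 3 c"
    using at unfolding pos_weights_simps w[symmetric] theta102_at_def by simp_all
  moreover have "wgraph_iso G (theta 1 0 2 a b c)"
    unfolding theta102_iso_iff[OF weighted pos] using at w by blast
  moreover have "b 1 * c 2 \<le> c 1 * c 3"
    using neg_inertia_theta102[OF at] ni by (simp add: w)
  ultimately show ?L by blast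
qed

lemma theta202_characterization:
  "(\<exists>a b c. pos_weights 3 a \<and> pos_weights 1 b \<and> pos_weights 3 c \<and> a 2 * b 1 * c 2 - a 1 * a 3 * c 2 - a 2 * c 1 * c 3 = 0 \<and>
      wgraph_iso G (theta 2 0 2 a b c)) \<longleftrightarrow>
    (\<exists>u v x1 x2 z1 z2. theta202_at G u v x1 x2 z1 z2 \<and> neg_inertia G = 2)" (is "?L \<longleftrightarrow> ?R")
proof
  assume ?L
  then obtain a b c where pos: "pos_weights 3 a" "pos_weights 1 b" "pos_weights 3 c"
    and cond: "a 2 * b 1 * c 2 - a 1 * a 3 * c 2 - a 2 * c 1 * c 3 = 0" and iso: "wgraph_iso G (theta 2 0 2 a b c)"
    by blast
  from iso[unfolded theta202_iso_iff[OF weighted pos]]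
  obtain u v x1 x2 z1 z2 where at: "theta202_at G u v x1 x2 z1 z2"
    and w: "wt G u x1 = a 1" "wt G x1 x2 = a 2" "wt G x2 v = a 3" "wt G u v = b 1" "wt G u z1 = c 1" "wt G z1 z2 = c 2" "wt G z2 v = c 3"
    by blast
  have "neg_inertia G = 2"
    using neg_inertia_theta202[OF at] cond by (simp add: w)
  with at show ?R by blast
next
  assume ?R
  then obtain u v x1 x2 z1 z2 where at: "theta202_at G u v x1 x2 z1 z2" and ni: "neg_inertia G = 2"
    by blast
  define a where "a = (!) [0, wt G u x1, wt G x1 x2, wt G x2 v]"
  define b where "b = (!) [0, wt G u v]"
  define c where "c = (!) [0, wt G u z1, wt G z1 z2, wt G z2 v]"
  have w: "wt G u x1 = a 1" "wt G x1 x2 = a 2" "wt G x2 v = a 3" "wt G u v = b 1" "wt G u z1 = c 1" "wt G z1 z2 = c 2" "wt G z2 v = c 3"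
    by (simp_all add: a_def b_def c_def)
  have "wt G s t > 0" if "t \<in> nbrs G s" for s t
    using wt_pos[OF that] .
  then have pos: "pos_weights 3 a" "pos_weights 1 b" "pos_weights 3 c"
    using at unfolding pos_weights_simps w[symmetric] theta202_at_def by simp_all
  moreover have "wgraph_iso G (theta 2 0 2 a b c)"
    unfolding theta202_iso_iff[OF weighted pos] using at w by blast
  moreover have "a 2 * b 1 * c 2 - a 1 * a 3 * c 2 - a 2 * c 1 * c 3 = 0"
    using neg_inertia_theta202[OF at] ni by (simp add: w)
  ultimately show ?L by blast
qed

lemma theta112_characterization:
  "(\<exists>a b c. pos_weights 2 a \<and> pos_weights 2 b \<and> pos_weights 3 c \<and> a 1 * b 2 = a 2 * b 1 \<and>
      wgraph_iso G (theta 1 1 2 a b c)) \<longleftrightarrow>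
    (\<exists>u v x y z1 z2. theta112_at G u v x y z1 z2 \<and> neg_inertia G = 2)" (is "?L \<longleftrightarrow> ?R")
proof
  assume ?L
  then obtain a b c where pos: "pos_weights 2 a" "pos_weights 2 b" "pos_weights 3 c"
    and cond: "a 1 * b 2 = a 2 * b 1" and iso: "wgraph_iso G (theta 1 1 2 a b c)"
    by blast
  from iso[unfolded theta112_iso_iff[OF weighted pos]]
  obtain u v x y z1 z2 where at: "theta112_at G u v x y z1 z2"
    and w: "wt G u x = a 1" "wt G x v = a 2" "wt G u y = b 1" "wt G y v = b 2" "wt G u z1 = c 1" "wt G z1 z2 = c 2" "wt G z2 v = c 3"
    by blast
  have "neg_inertia G = 2"
    using neg_inertia_theta112[OF at] cond by (simp add: w)
  with at show ?R by blast
next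
  assume ?R
  then obtain u v x y z1 z2 where at: "theta112_at G u v x y z1 z2" and ni: "neg_inertia G = 2"
    by blast
  define a where "a = (!) [0, wt G u x, wt G x v]"
  define b where "b = (!) [0, wt G u y, wt G y v]"
  define c where "c = (!) [0, wt G u z1, wt G z1 z2, wt G z2 v]"
  have w: "wt G u x = a 1" "wt G x v = a 2" "wt G u y = b 1" "wt G y v = b 2" "wt G u z1 = c 1" "wt G z1 z2 = c 2" "wt G z2 v = c 3"
    by (simp_all add: a_def b_def c_def)
  have "wt G s t > 0" if "t \<in> nbrs G s" for s t
    using wt_pos[OF that] .
  then have pos: "pos_weights 2 a" "pos_weights 2 b" "pos_weights 3 c"
    using at unfolding pos_weights_simps w[symmetric] theta112_at_def by simp_all
  moreover have "wgraph_iso G (theta 1 1 2 a b c)"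
    unfolding theta112_iso_iff[OF weighted pos] using at w by blast
  moreover have "a 1 * b 2 = a 2 * b 1"
    using neg_inertia_theta112[OF at] ni by (simp add: w)
  ultimately show ?L by blast
qed

end

theorem theorem4p5:
  fixes G :: "'a wgraph"
  assumes "weighted_graph G"
    and "bicyclic G"
    and "\<not> (\<exists>x. pendant G x)"
  shows "neg_inertia G = 2 \<longleftrightarrow>
      (\<exists>a b. pos_weights 4 a \<and> pos_weights 4 b \<and>
         a 1 * a 3 = a 2 * a 4 \<and> b 1 * b 3 = b 2 * b 4 \<and>
         wgraph_iso G (infinity414 a b)) \<or>
      (\<exists>a b c. pos_weights 2 a \<and> pos_weights 2 b \<and> pos_weights 2 c \<and>
         (a 2 * b 1 \<noteq> a 1 * b 2 \<or> a 2 * c 1 \<noteq> a 1 * c 2) \<and>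
         wgraph_iso G (theta 1 1 1 a b c)) \<or>
      (\<exists>a b c. pos_weights 2 a \<and> pos_weights 1 b \<and> pos_weights 2 c \<and>
         wgraph_iso G (theta 1 0 1 a b c)) \<or>
      (\<exists>a b c. pos_weights 2 a \<and> pos_weights 1 b \<and> pos_weights 3 c \<and>
         b 1 * c 2 \<le> c 1 * c 3 \<and>
         wgraph_iso G (theta 1 0 2 a b c)) \<or>
      (\<exists>a b c. pos_weights 3 a \<and> pos_weights 1 b \<and> pos_weights 3 c \<and>
         a 2 * b 1 * c 2 - a 1 * a 3 * c 2 - a 2 * c 1 * c 3 = 0 \<and>
         wgraph_iso G (theta 2 0 2 a b c)) \<or>
      (\<exists>a b c. pos_weights 2 a \<and> pos_weights 2 b \<and> pos_weights 3 c \<and>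
         a 1 * b 2 = a 2 * b 1 \<and>
         wgraph_iso G (theta 1 1 2 a b c))"
proof -
  interpret bicyclic_core G by unfold_locales (fact assms)+
  show ?thesis
    \<comment> \<open>After this rewriting every disjunct contains the inertia, so one direction is
      immediate and the other is the classification.\<close>
    unfolding infinity414_characterization theta111_characterization theta101_characterization
      theta102_characterization theta202_characterization theta112_characterization
  proof
    assume ni: "neg_inertia G = 2"
    then have "neg_inertia G < 3" by simp
    then show "(\<exists>v x1 x2 x3 y1 y2 y3. infinity414_at G v x1 x2 x3 y1 y2 y3 \<and> neg_inertia G = 2) \<or>
      (\<exists>u v x y z. theta111_at G u v x y z \<and> neg_inertia G = 2) \<or>
      (\<exists>u v x z. theta101_at G u v x z \<and> neg_inertia G = 2) \<or>
      (\<exists>u v x z1 z2. theta102_at G u v x z1 z2 \<and> neg_inertia G = 2) \<or>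
      (\<exists>u v x1 x2 z1 z2. theta202_at G u v x1 x2 z1 z2 \<and> neg_inertia G = 2) \<or>
      (\<exists>u v x y z1 z2. theta112_at G u v x y z1 z2 \<and> neg_inertia G = 2)"
      by (cases rule: classification) (use ni in metis)+
  qed (elim disjE exE conjE)
qed

end
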